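(* Let $H=\bigoplus_{n\in\mathbb{N}_0}H(n)$ be a graded Hopf algebra over a field $\Bbbk$ with $H(0)=\Bbbk G$ for some group $G$, and let $L=\bigoplus_{n\in\mathbb{N}_0}L(n)$ be a graded left $H$-comodule algebra. If $L$ is right $H$-simple and $L(0)^{\mathrm{co}H(0)}=\Bbbk$, then $L$ is (isomorphic, as a graded $H$-comodule algebra, to) a graded $H$-comodule subalgebra of $H^{\mathrm{coinv}}\#({}_\psi\Bbbk F)$ for some subgroup $F$ of $G$ and some $2$-cocycle $\psi$ of $F$.
   Context: Everything is over a field $\Bbbk$. A graded Hopf algebra is a Hopf algebra with an $\mathbb{N}_0$-grading of its underlying vector space such that multiplication, unit, comultiplication and counit preserve the grading (tensor products have the total grading; $\Bbbk$ is in degree $0$). A left $H$-comodule algebra is an algebra $L$ that is a left $H$-comodule whose coaction $\rho\colon L\to H\otimes L$, $\ell\mapsto\ell_{(-1)}\otimes\ell_{(0)}$, is an algebra map; it is graded if it has an $\mathbb{N}_0$-grading preserved by multiplication, unit and coaction. Then $L(0)$ is an $H(0)$-comodule algebra by restriction, and $L(0)^{\mathrm{co}H(0)}=\{\ell\in L(0)\mid\rho(\ell)=1\otimes\ell\}$. A graded $H$-comodule subalgebra is a subalgebra that is an $H$-subcomodule and a graded subspace, with the induced grading. $L$ is right $H$-simple if $L\neq0$ and its only right ideals that are $H$-subcomodules are $0$ and $L$. $H(0)=\Bbbk G$ is meant as Hopf algebras. Let $\pi\colon H\to H(0)$ be the canonical projection and $\iota\colon H(0)\to H$ the inclusion; both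 are Hopf algebra maps. $H^{\mathrm{coinv}}=\{r\in H\mid r_{(1)}\otimes\pi(r_{(2)})=r\otimes1\}$, with $\Delta(r)=r_{(1)}\otimes r_{(2)}$. For a left $H(0)$-comodule algebra $E$, $H^{\mathrm{coinv}}\#E$ is the left $H$-comodule algebra with underlying vector space $H^{\mathrm{coinv}}\otimes E$, multiplication $(a\otimes\ell)(b\otimes m)=a\,\iota(\ell_{(-2)})\,b\,\iota(S(\ell_{(-1)}))\otimes\ell_{(0)}m$ ($S$ the antipode of $H(0)$), and $H$-coaction $\rho(a\otimes\ell)=a_{(1)}\iota(\ell_{(-1)})\otimes a_{(2)}\otimes\ell_{(0)}$. It is graded with degree $n$ component $(H(n)\cap H^{\mathrm{coinv}})\otimes E$. A $2$-cocycle of a group $F$ is a map $\psi\colon F\times F\to\Bbbk^\times$ with $\psi(a,b)\psi(ab,c)=\psi(b,c)\psi(a,bc)$ and $\psi(a,e)=1=\psi(e,a)$. For a subgroup $F\subset G$, ${}_\psi\Bbbk F$ is the $\Bbbk G$-comodule algebra with underlying space $\Bbbk F$, product $g*h=\psi(g,h)gh$ and coaction $\rho(g)=g\otimes g$ for $g,h\in F$. *)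

theory Defs
  imports
    Complex_Main
    "HOL-Library.Function_Algebras"
    "HOL-Library.Poly_Mapping"
    "HOL-Algebra.Group"
begin

text \<open>
  A vector space is a subspace \<open>carr V\<close> of an ambient vector space whose underlying additive group
  is a type of class \<open>ab_group_add\<close>, so that subobjects, and tensor products of subobjects, are
  subsets of the ambient object. The operations matter on the carriers only.
\<close>

record ('k, 'v) vect =
  carr :: "'v set"
  scl :: "'k \<Rightarrow> 'v \<Rightarrow> 'v"

locale vect_space = vector_space "scl V"
  for V :: "('k::field, 'v::ab_group_add, 'x) vect_scheme" +
  assumes subspace_carr: "subspace (carr V)"

definition klinear ::
  "('k, 'v::ab_group_add, 'x) vect_scheme \<Rightarrow> ('k, 'w::ab_group_add, 'y) vect_scheme
    \<Rightarrow> ('v \<Rightarrow> 'w) \<Rightarrow> bool" where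
  "klinear V W f \<longleftrightarrow>
    (\<forall>x\<in>carr V. f x \<in> carr W) \<and>
    (\<forall>x\<in>carr V. \<forall>y\<in>carr V. f (x + y) = f x + f y) \<and>
    (\<forall>c. \<forall>x\<in>carr V. f (scl V c x) = scl W c (f x))"

definition kbilinear ::
  "('k, 'v::ab_group_add, 'x) vect_scheme \<Rightarrow> ('k, 'w::ab_group_add, 'y) vect_scheme
    \<Rightarrow> ('k, 'u::ab_group_add, 'z) vect_scheme \<Rightarrow> ('v \<Rightarrow> 'w \<Rightarrow> 'u) \<Rightarrow> bool" where
  "kbilinear V W U b \<longleftrightarrow>
    (\<forall>x\<in>carr V. klinear W U (b x)) \<and> (\<forall>y\<in>carr W. klinear V U (\<lambda>x. b x y))"

section \<open>Tensor products\<close>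

text \<open>
  The pure tensor \<open>v \<otimes> w\<close> is evaluation at \<open>(v, w)\<close> of bilinear forms on the ambient spaces.
  Since bilinear forms separate the elements of a tensor product over a field, the span of these
  functionals is the tensor product; its universal property is \<open>sweedler_tens\<close> together with
  \<open>klinear_sweedler\<close> and \<open>tensor_space_repr\<close> below. The forms live on the ambient spaces, so for
  subspaces \<open>A\<close>, \<open>B\<close> of \<open>V\<close>, \<open>W\<close> the space \<open>A \<otimes> B\<close> is literally contained in \<open>V \<otimes> W\<close>.
\<close>

type_synonym ('v, 'w, 'k) tensor = "('v \<Rightarrow> 'w \<Rightarrow> 'k) \<Rightarrow> 'k"

definition bilinear_form ::
  "('k::field, 'v::ab_group_add, 'x) vect_scheme \<Rightarrow> ('k, 'w::ab_group_add, 'y) vect_scheme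
    \<Rightarrow> ('v \<Rightarrow> 'w \<Rightarrow> 'k) \<Rightarrow> bool" where
  "bilinear_form V W \<beta> \<longleftrightarrow>
    (\<forall>v. Vector_Spaces.linear (scl W) (*) (\<beta> v)) \<and>
    (\<forall>w. Vector_Spaces.linear (scl V) (*) (\<lambda>v. \<beta> v w))"

definition tens ::
  "('k::field, 'v::ab_group_add, 'x) vect_scheme \<Rightarrow> ('k, 'w::ab_group_add, 'y) vect_scheme
    \<Rightarrow> 'v \<Rightarrow> 'w \<Rightarrow> ('v, 'w, 'k) tensor" where
  "tens V W v w = (\<lambda>\<beta>. if bilinear_form V W \<beta> then \<beta> v w else 0)"

definition tscale :: "'k::field \<Rightarrow> ('v, 'w, 'k) tensor \<Rightarrow> ('v, 'w, 'k) tensor" where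
  "tscale c t = (\<lambda>\<beta>. c * t \<beta>)"

definition tensor_space ::
  "('k::field, 'v::ab_group_add, 'x) vect_scheme \<Rightarrow> ('k, 'w::ab_group_add, 'y) vect_scheme
    \<Rightarrow> ('k, ('v, 'w, 'k) tensor) vect" where
  "tensor_space V W =
    \<lparr>carr = module.span tscale {tens V W v w | v w. v \<in> carr V \<and> w \<in> carr W}, scl = tscale\<rparr>"

text \<open>
  \<open>sweedler V W t b\<close> is the value at \<open>t \<in> V \<otimes> W\<close> of the linear map induced by the bilinear map
  \<open>b\<close>; in Sweedler notation it is \<open>b t\<^sub>1 t\<^sub>2\<close>.
\<close>

definition sweedler ::
  "('k::field, 'v::ab_group_add, 'x) vect_scheme \<Rightarrow> ('k, 'w::ab_group_add, 'y) vect_scheme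
    \<Rightarrow> ('v, 'w, 'k) tensor \<Rightarrow> ('v \<Rightarrow> 'w \<Rightarrow> 'u::ab_group_add) \<Rightarrow> 'u" where
  "sweedler V W t b =
    (THE u. \<exists>ps. set ps \<subseteq> carr V \<times> carr W \<and>
      t = (\<Sum>(v, w)\<leftarrow>ps. tens V W v w) \<and> u = (\<Sum>(v, w)\<leftarrow>ps. b v w))"

lemma vector_space_tscale: "vector_space (tscale :: 'k::field \<Rightarrow> ('v, 'w, 'k) tensor \<Rightarrow> _)"
  by unfold_locales (auto simp: tscale_def fun_eq_iff algebra_simps)

lemma vector_space_mult: "vector_space ((*) :: 'k::field \<Rightarrow> 'k \<Rightarrow> 'k)"
  by unfold_locales (auto simp: algebra_simps)

lemma kbilinear_tens:
  assumes V: "vect_space V" and W: "vect_space W"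
  shows "kbilinear V W (tensor_space V W) (tens V W)"
proof -
  interpret V: vect_space V by fact
  interpret W: vect_space W by fact
  interpret T: vector_space "tscale :: 'a \<Rightarrow> ('b, 'd, 'a) tensor \<Rightarrow> _" by (rule vector_space_tscale)
  have mem: "tens V W v w \<in> carr (tensor_space V W)" if "v \<in> carr V" "w \<in> carr W" for v w
    unfolding tensor_space_def using that by (auto intro!: T.span_base)
  have form: "\<beta> (x + y) w = \<beta> x w + \<beta> y w" "\<beta> (scl V c x) w = c * \<beta> x w"
    "\<beta> v (z + z') = \<beta> v z + \<beta> v z'" "\<beta> v (scl W c z) = c * \<beta> v z"
    if "bilinear_form V W \<beta>" for \<beta> v w x y z z' c
  proof -
    interpret l: Vector_Spaces.linear "scl V" "(*)" "\<lambda>v. \<beta> v w"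
      using that by (simp add: bilinear_form_def)
    interpret r: Vector_Spaces.linear "scl W" "(*)" "\<beta> v"
      using that by (simp add: bilinear_form_def)
    show "\<beta> (x + y) w = \<beta> x w + \<beta> y w" "\<beta> (scl V c x) w = c * \<beta> x w"
      "\<beta> v (z + z') = \<beta> v z + \<beta> v z'" "\<beta> v (scl W c z) = c * \<beta> v z"
      by (rule l.add l.scale r.add r.scale)+
  qed
  have scl: "scl (tensor_space V W) = tscale" by (simp add: tensor_space_def)
  show ?thesis
    unfolding kbilinear_def klinear_def scl
    by (intro conjI ballI allI mem)
      (simp_all add: tens_def fun_eq_iff tscale_def form)
qed

lemma tensor_space_repr:
  assumes V: "vect_space V" and t: "t \<in> carr (tensor_space V W)"
  obtains ps where "set ps \<subseteq> carr V \<times> carr W" "t = (\<Sum>(v, w)\<leftarrow>ps. tens V W v w)"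
proof -
  interpret V: vect_space V by fact
  interpret T: vector_space "tscale :: 'a \<Rightarrow> ('b, 'd, 'a) tensor \<Rightarrow> _" by (rule vector_space_tscale)
  have "\<exists>ps. set ps \<subseteq> carr V \<times> carr W \<and> t = (\<Sum>(v, w)\<leftarrow>ps. tens V W v w)"
    using t unfolding tensor_space_def vect.simps
  proof (induction rule: T.span_induct_alt)
    case base
    show ?case by (rule exI[of _ "[]"]) simp
  next
    case (step c x y)
    then obtain v w ps where *: "x = tens V W v w" "v \<in> carr V" "w \<in> carr W"
      "set ps \<subseteq> carr V \<times> carr W" "y = (\<Sum>(v, w)\<leftarrow>ps. tens V W v w)" by blast
    have "tscale c x = tens V W (scl V c v) w"
    proof (rule ext)
      fix \<beta>
      show "tscale c x \<beta> = tens V W (scl V c v) w \<beta>"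
      proof (cases "bilinear_form V W \<beta>")
        case True
        then interpret Vector_Spaces.linear "scl V" "(*)" "\<lambda>v. \<beta> v w" by (simp add: bilinear_form_def)
        show ?thesis using True by (simp add: * tscale_def tens_def scale)
      qed (simp add: * tscale_def tens_def)
    qed
    moreover have "scl V c v \<in> carr V"
      using * V.subspace_carr by (simp add: V.subspace_scale)
    ultimately show ?case
      using * by (intro exI[of _ "(scl V c v, w) # ps"]) auto
  qed
  then show thesis using that by blast
qed

lemma linear_projection:
  assumes "vect_space V"
  obtains p where "Vector_Spaces.linear (scl V) (scl V) p" "\<And>x. p x \<in> carr V"
    "\<And>x. x \<in> carr V \<Longrightarrow> p x = x"
proof -
  interpret vect_space V by fact
  interpret P: vector_space_pair "scl V" "scl V" by unfold_locales
  have "Vector_Spaces.linear (scl V) (scl V) id" by (rule linear_id)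
  from P.linear_exists_left_inverse_on[OF this subspace_carr]
  obtain p where "p ` UNIV \<subseteq> carr V" "\<forall>v\<in>carr V. p (id v) = v"
    "Vector_Spaces.linear (scl V) (scl V) p" by auto
  then show thesis using that[of p] by auto
qed

lemma sweedler_well_defined:
  assumes V: "vect_space V" and W: "vect_space W" and U: "vect_space U"
    and b: "kbilinear V W U b"
    and ps: "set ps \<subseteq> carr V \<times> carr W" and qs: "set qs \<subseteq> carr V \<times> carr W"
    and eq: "(\<Sum>(v, w)\<leftarrow>ps. tens V W v w) = (\<Sum>(v, w)\<leftarrow>qs. tens V W v w)"
  shows "(\<Sum>(v, w)\<leftarrow>ps. b v w) = (\<Sum>(v, w)\<leftarrow>qs. b v w)"
proof (rule ccontr)
  interpret V: vect_space V by fact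
  interpret W: vect_space W by fact
  interpret U: vect_space U by fact
  interpret K: vector_space "(*) :: 'a \<Rightarrow> 'a \<Rightarrow> 'a" by (rule vector_space_mult)
  interpret UK: vector_space_pair "scl U" "(*)" by unfold_locales
  let ?d = "(\<Sum>(v, w)\<leftarrow>ps. b v w) - (\<Sum>(v, w)\<leftarrow>qs. b v w)"
  assume "\<not> ?thesis"
  then have ind: "U.independent {?d}" by simp
  obtain \<phi> where \<phi>: "Vector_Spaces.linear (scl U) (*) \<phi>" "\<phi> ?d = 1"
    using UK.linear_construct[OF ind, of "\<lambda>_. 1"] UK.construct_basis[OF ind, of _ "\<lambda>_. 1"] by blast
  interpret phi: Vector_Spaces.linear "scl U" "(*)" \<phi> by fact
  obtain p where p: "Vector_Spaces.linear (scl V) (scl V) p" "\<And>x. p x \<in> carr V"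
    "\<And>x. x \<in> carr V \<Longrightarrow> p x = x" using linear_projection[OF V] by blast
  obtain q where q: "Vector_Spaces.linear (scl W) (scl W) q" "\<And>x. q x \<in> carr W"
    "\<And>x. x \<in> carr W \<Longrightarrow> q x = x" using linear_projection[OF W] by blast
  interpret p: Vector_Spaces.linear "scl V" "scl V" p by fact
  interpret q: Vector_Spaces.linear "scl W" "scl W" q by fact
  define \<beta> where "\<beta> v w = \<phi> (b (p v) (q w))" for v w
  have "bilinear_form V W \<beta>"
    unfolding bilinear_form_def \<beta>_def
    using b p(2) q(2)
    by (auto simp: kbilinear_def klinear_def p.add q.add p.scale q.scale phi.add phi.scale
        intro!: Vector_Spaces.linear.intro module_hom.intro module_hom_axioms.intro
          V.vector_space_axioms W.vector_space_axioms K.vector_space_axioms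
          V.module_axioms W.module_axioms K.module_axioms)
  then have tens: "tens V W v w \<beta> = \<phi> (b v w)" if "v \<in> carr V" "w \<in> carr W" for v w
    using that p(3) q(3) by (simp add: tens_def \<beta>_def)
  have *: "(\<Sum>(v, w)\<leftarrow>rs. tens V W v w) \<beta> = \<phi> (\<Sum>(v, w)\<leftarrow>rs. b v w)"
    if "set rs \<subseteq> carr V \<times> carr W" for rs
    using that
  proof (induction rs)
    case Nil
    show ?case by (simp add: phi.zero)
  next
    case (Cons r rs)
    obtain v w where r: "r = (v, w)" by (cases r)
    show ?case using Cons by (simp add: r tens phi.add)
  qed
  have "\<phi> ?d = 0"
    using *[OF ps] *[OF qs] eq by (simp add: phi.diff)
  with \<phi>(2) show False by simp
qed

lemma sweedler_sum:
  assumes "vect_space V" "vect_space W" "vect_space U" "kbilinear V W U b"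
    and "set ps \<subseteq> carr V \<times> carr W"
  shows "sweedler V W (\<Sum>(v, w)\<leftarrow>ps. tens V W v w) b = (\<Sum>(v, w)\<leftarrow>ps. b v w)"
  unfolding sweedler_def
proof (rule the_equality)
  show "\<exists>qs. set qs \<subseteq> carr V \<times> carr W \<and>
    (\<Sum>(v, w)\<leftarrow>ps. tens V W v w) = (\<Sum>(v, w)\<leftarrow>qs. tens V W v w) \<and>
    (\<Sum>(v, w)\<leftarrow>ps. b v w) = (\<Sum>(v, w)\<leftarrow>qs. b v w)"
    using assms(5) by (intro exI[of _ ps] conjI refl)
next
  fix u
  assume "\<exists>qs. set qs \<subseteq> carr V \<times> carr W \<and>
    (\<Sum>(v, w)\<leftarrow>ps. tens V W v w) = (\<Sum>(v, w)\<leftarrow>qs. tens V W v w) \<and>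
    u = (\<Sum>(v, w)\<leftarrow>qs. b v w)"
  then obtain qs where qs: "set qs \<subseteq> carr V \<times> carr W"
    "(\<Sum>(v, w)\<leftarrow>ps. tens V W v w) = (\<Sum>(v, w)\<leftarrow>qs. tens V W v w)"
    "u = (\<Sum>(v, w)\<leftarrow>qs. b v w)" by (elim exE conjE)
  show "u = (\<Sum>(v, w)\<leftarrow>ps. b v w)"
    using sweedler_well_defined[OF assms(1-5) qs(1,2)] qs(3) by (rule trans[OF _ sym, rotated])
qed

lemma sweedler_tens:
  assumes "vect_space V" "vect_space W" "vect_space U" "kbilinear V W U b"
    and "v \<in> carr V" "w \<in> carr W"
  shows "sweedler V W (tens V W v w) b = b v w"
  using sweedler_sum[OF assms(1-4), of "[(v, w)]"] assms(5,6) by simp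

lemma klinear_sweedler:
  assumes V: "vect_space V" and W: "vect_space W" and U: "vect_space U"
    and b: "kbilinear V W U b"
  shows "klinear (tensor_space V W) U (\<lambda>t. sweedler V W t b)"
proof -
  interpret V: vect_space V by fact
  interpret W: vect_space W by fact
  interpret U: vect_space U by fact
  interpret T: vector_space "tscale :: 'a \<Rightarrow> ('b, 'd, 'a) tensor \<Rightarrow> _" by (rule vector_space_tscale)
  note sw = sweedler_sum[OF V W U b]
  have tl: "klinear V (tensor_space V W) (\<lambda>v. tens V W v w)" if "w \<in> carr W" for w
    using kbilinear_tens[OF V W] that by (simp add: kbilinear_def)
  have bl: "klinear V U (\<lambda>v. b v w)" if "w \<in> carr W" for w
    using b that by (simp add: kbilinear_def)
  show ?thesis
    unfolding klinear_def
  proof (intro conjI ballI allI)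
    fix s assume s: "s \<in> carr (tensor_space V W)"
    obtain ps where ps: "set ps \<subseteq> carr V \<times> carr W" "s = (\<Sum>(v, w)\<leftarrow>ps. tens V W v w)"
      using tensor_space_repr[OF V s] by blast
    have "(\<Sum>(v, w)\<leftarrow>ps. b v w) \<in> carr U"
      using ps(1)
    proof (induction ps)
      case (Cons p ps)
      then have "b (fst p) (snd p) \<in> carr U" using bl[of "snd p"] by (auto simp: klinear_def)
      then show ?case using Cons U.subspace_carr by (auto simp: U.subspace_add split: prod.splits)
    qed (use U.subspace_carr in \<open>simp add: U.subspace_0\<close>)
    then show "sweedler V W s b \<in> carr U" using ps sw by simp
    fix c
    define qs where "qs = map (\<lambda>(v, w). (scl V c v, w)) ps"
    have qs: "set qs \<subseteq> carr V \<times> carr W"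
      using ps(1) V.subspace_carr by (auto simp: qs_def V.subspace_scale)
    have ts: "tens V W (scl V c v) w = tscale c (tens V W v w)"
      if "v \<in> carr V" "w \<in> carr W" for v w
      using tl[OF that(2)] that(1) by (simp add: klinear_def tensor_space_def)
    have bs: "b (scl V c v) w = scl U c (b v w)" if "v \<in> carr V" "w \<in> carr W" for v w
      using bl[OF that(2)] that(1) by (simp add: klinear_def)
    have "(\<Sum>(v, w)\<leftarrow>qs. tens V W v w) = tscale c s"
      unfolding ps(2) qs_def using ps(1)
      by (induction ps) (auto simp: ts T.scale_right_distrib)
    moreover have "(\<Sum>(v, w)\<leftarrow>qs. b v w) = scl U c (\<Sum>(v, w)\<leftarrow>ps. b v w)"
      unfolding qs_def using ps(1)
      by (induction ps) (auto simp: bs U.scale_right_distrib)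
    ultimately show "sweedler V W (scl (tensor_space V W) c s) b = scl U c (sweedler V W s b)"
      using sw[OF qs] sw[OF ps(1)] ps(2) by (simp add: tensor_space_def)
  next
    fix s t assume st: "s \<in> carr (tensor_space V W)" "t \<in> carr (tensor_space V W)"
    obtain ps where ps: "set ps \<subseteq> carr V \<times> carr W" "s = (\<Sum>(v, w)\<leftarrow>ps. tens V W v w)"
      using tensor_space_repr[OF V st(1)] by blast
    obtain qs where qs: "set qs \<subseteq> carr V \<times> carr W" "t = (\<Sum>(v, w)\<leftarrow>qs. tens V W v w)"
      using tensor_space_repr[OF V st(2)] by blast
    show "sweedler V W (s + t) b = sweedler V W s b + sweedler V W t b"
      using sw[of "ps @ qs"] sw[OF ps(1)] sw[OF qs(1)] ps qs by simp
  qed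
qed

section \<open>Algebras, Hopf algebras, comodule algebras\<close>

record ('k, 'a) alg = "('k, 'a) vect" +
  mul :: "'a \<Rightarrow> 'a \<Rightarrow> 'a"
  unity :: 'a

record ('k, 'h) hopf = "('k, 'h) alg" +
  comul :: "'h \<Rightarrow> ('h, 'h, 'k) tensor"
  counit :: "'h \<Rightarrow> 'k"
  antipode :: "'h \<Rightarrow> 'h"

record ('k, 'h, 'l) comod_alg = "('k, 'l) alg" +
  coact :: "'l \<Rightarrow> ('h, 'l, 'k) tensor"

locale k_algebra = vect_space A
  for A :: "('k::field, 'a::ab_group_add, 'x) alg_scheme" +
  assumes mul_bilinear: "kbilinear A A A (mul A)"
    and unity_closed: "unity A \<in> carr A"
    and mul_assoc: "\<lbrakk>x \<in> carr A; y \<in> carr A; z \<in> carr A\<rbrakk>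
      \<Longrightarrow> mul A (mul A x y) z = mul A x (mul A y z)"
    and mul_unity_left: "x \<in> carr A \<Longrightarrow> mul A (unity A) x = x"
    and mul_unity_right: "x \<in> carr A \<Longrightarrow> mul A x (unity A) = x"

definition alg_hom ::
  "('k, 'a::ab_group_add, 'x) alg_scheme \<Rightarrow> ('k, 'b::ab_group_add, 'y) alg_scheme
    \<Rightarrow> ('a \<Rightarrow> 'b) \<Rightarrow> bool" where
  "alg_hom A B f \<longleftrightarrow> klinear A B f \<and> f (unity A) = unity B \<and>
    (\<forall>x\<in>carr A. \<forall>y\<in>carr A. f (mul A x y) = mul B (f x) (f y))"

definition field_alg :: "('k::field, 'k) alg" where
  "field_alg = \<lparr>carr = UNIV, scl = (*), mul = (*), unity = 1\<rparr>"

definition tensor_alg ::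
  "('k::field, 'a::ab_group_add, 'x) alg_scheme \<Rightarrow> ('k, 'b::ab_group_add, 'y) alg_scheme
    \<Rightarrow> ('k, ('a, 'b, 'k) tensor) alg" where
  "tensor_alg A B =
    \<lparr>carr = carr (tensor_space A B), scl = scl (tensor_space A B),
     mul = (\<lambda>s t. sweedler A B s (\<lambda>a b. sweedler A B t (\<lambda>a' b'.
       tens A B (mul A a a') (mul B b b')))),
     unity = tens A B (unity A) (unity B)\<rparr>"

locale hopf_algebra = k_algebra H
  for H :: "('k::field, 'h::ab_group_add, 'x) hopf_scheme" +
  assumes comul_alg_hom: "alg_hom H (tensor_alg H H) (comul H)"
    and counit_alg_hom: "alg_hom H field_alg (counit H)"
    and coassoc: "h \<in> carr H \<Longrightarrow>
      sweedler H H (comul H h) (\<lambda>a b. sweedler H H (comul H a) (\<lambda>a1 a2.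
        tens H (tensor_space H H) a1 (tens H H a2 b))) =
      sweedler H H (comul H h) (\<lambda>a b. tens H (tensor_space H H) a (comul H b))"
    and counit_left: "h \<in> carr H \<Longrightarrow>
      sweedler H H (comul H h) (\<lambda>a b. scl H (counit H a) b) = h"
    and counit_right: "h \<in> carr H \<Longrightarrow>
      sweedler H H (comul H h) (\<lambda>a b. scl H (counit H b) a) = h"
    and antipode_linear: "klinear H H (antipode H)"
    and antipode_left: "h \<in> carr H \<Longrightarrow>
      sweedler H H (comul H h) (\<lambda>a b. mul H (antipode H a) b) = scl H (counit H h) (unity H)"
    and antipode_right: "h \<in> carr H \<Longrightarrow>
      sweedler H H (comul H h) (\<lambda>a b. mul H a (antipode H b)) = scl H (counit H h) (unity H)"

locale comodule_algebra = H: hopf_algebra H + L: k_algebra L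
  for H :: "('k::field, 'h::ab_group_add, 'x) hopf_scheme"
    and L :: "('k, 'h, 'l::ab_group_add, 'y) comod_alg_scheme" +
  assumes coact_alg_hom: "alg_hom L (tensor_alg H L) (coact L)"
    and coact_coassoc: "l \<in> carr L \<Longrightarrow>
      sweedler H L (coact L l) (\<lambda>h l0. sweedler H H (comul H h) (\<lambda>h1 h2.
        tens H (tensor_space H L) h1 (tens H L h2 l0))) =
      sweedler H L (coact L l) (\<lambda>h l0. tens H (tensor_space H L) h (coact L l0))"
    and coact_counit: "l \<in> carr L \<Longrightarrow>
      sweedler H L (coact L l) (\<lambda>h l0. scl L (counit H h) l0) = l"

text \<open>
  Hopf algebra isomorphisms need not mention the antipode: a bialgebra map between Hopf algebras
  preserves it.
\<close>

definition hopf_iso ::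
  "('k::field, 'a::ab_group_add, 'x) hopf_scheme \<Rightarrow> ('k, 'b::ab_group_add, 'y) hopf_scheme
    \<Rightarrow> ('a \<Rightarrow> 'b) \<Rightarrow> bool" where
  "hopf_iso A B f \<longleftrightarrow> alg_hom A B f \<and> bij_betw f (carr A) (carr B) \<and>
    (\<forall>a\<in>carr A. comul B (f a) = sweedler A A (comul A a) (\<lambda>x y. tens B B (f x) (f y))) \<and>
    (\<forall>a\<in>carr A. counit B (f a) = counit A a)"

definition subcomodule ::
  "('k::field, 'h::ab_group_add, 'x) hopf_scheme \<Rightarrow> ('k, 'h, 'l::ab_group_add, 'y) comod_alg_scheme
    \<Rightarrow> 'l set \<Rightarrow> bool" where
  "subcomodule H L I \<longleftrightarrow> module.subspace (scl L) I \<and> I \<subseteq> carr L \<and>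
    (\<forall>x\<in>I. coact L x \<in> carr (tensor_space H (L\<lparr>carr := I\<rparr>)))"

definition right_ideal :: "('k::field, 'a::ab_group_add, 'x) alg_scheme \<Rightarrow> 'a set \<Rightarrow> bool" where
  "right_ideal A I \<longleftrightarrow> module.subspace (scl A) I \<and> I \<subseteq> carr A \<and>
    (\<forall>x\<in>I. \<forall>a\<in>carr A. mul A x a \<in> I)"

definition right_simple ::
  "('k::field, 'h::ab_group_add, 'x) hopf_scheme \<Rightarrow> ('k, 'h, 'l::ab_group_add, 'y) comod_alg_scheme
    \<Rightarrow> bool" where
  "right_simple H L \<longleftrightarrow> carr L \<noteq> {0} \<and>
    (\<forall>I. right_ideal L I \<and> subcomodule H L I \<longrightarrow> I = {0} \<or> I = carr L)"

definition coinvariants ::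
  "('k::field, 'h::ab_group_add, 'x) hopf_scheme \<Rightarrow> ('k, 'h, 'l::ab_group_add, 'y) comod_alg_scheme
    \<Rightarrow> 'l set" where
  "coinvariants H L = {l \<in> carr L. coact L l = tens H L (unity H) l}"

section \<open>Gradings\<close>

definition decomposes :: "(nat \<Rightarrow> 'v::ab_group_add set) \<Rightarrow> 'v \<Rightarrow> (nat \<Rightarrow> 'v) \<Rightarrow> bool" where
  "decomposes Vn x f \<longleftrightarrow> (\<forall>n. f n \<in> Vn n) \<and> finite {n. f n \<noteq> 0} \<and> x = (\<Sum>n | f n \<noteq> 0. f n)"

definition graded_space ::
  "('k::field, 'v::ab_group_add, 'x) vect_scheme \<Rightarrow> (nat \<Rightarrow> 'v set) \<Rightarrow> bool" where
  "graded_space V Vn \<longleftrightarrow>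
    (\<forall>n. module.subspace (scl V) (Vn n) \<and> Vn n \<subseteq> carr V) \<and>
    (\<forall>x\<in>carr V. \<exists>!f. decomposes Vn x f)"

definition component :: "(nat \<Rightarrow> 'v::ab_group_add set) \<Rightarrow> nat \<Rightarrow> 'v \<Rightarrow> 'v" where
  "component Vn n x = (THE f. decomposes Vn x f) n"

definition tensor_grading ::
  "('k::field, 'v::ab_group_add, 'x) vect_scheme \<Rightarrow> (nat \<Rightarrow> 'v set)
    \<Rightarrow> ('k, 'w::ab_group_add, 'y) vect_scheme \<Rightarrow> (nat \<Rightarrow> 'w set)
    \<Rightarrow> nat \<Rightarrow> ('v, 'w, 'k) tensor set" where
  "tensor_grading V Vn W Wn n = module.span tscale
    {tens V W v w | v w i j. i + j = n \<and> v \<in> Vn i \<and> w \<in> Wn j}"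

definition graded_algebra ::
  "('k::field, 'a::ab_group_add, 'x) alg_scheme \<Rightarrow> (nat \<Rightarrow> 'a set) \<Rightarrow> bool" where
  "graded_algebra A An \<longleftrightarrow> k_algebra A \<and> graded_space A An \<and> unity A \<in> An 0 \<and>
    (\<forall>i j. \<forall>x\<in>An i. \<forall>y\<in>An j. mul A x y \<in> An (i + j))"

definition graded_hopf_algebra ::
  "('k::field, 'h::ab_group_add, 'x) hopf_scheme \<Rightarrow> (nat \<Rightarrow> 'h set) \<Rightarrow> bool" where
  "graded_hopf_algebra H Hn \<longleftrightarrow> hopf_algebra H \<and> graded_algebra H Hn \<and>
    (\<forall>n. \<forall>h\<in>Hn n. comul H h \<in> tensor_grading H Hn H Hn n) \<and>
    (\<forall>n>0. \<forall>h\<in>Hn n. counit H h = 0)"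

definition graded_comodule_algebra ::
  "('k::field, 'h::ab_group_add, 'x) hopf_scheme \<Rightarrow> (nat \<Rightarrow> 'h set)
    \<Rightarrow> ('k, 'h, 'l::ab_group_add, 'y) comod_alg_scheme \<Rightarrow> (nat \<Rightarrow> 'l set) \<Rightarrow> bool" where
  "graded_comodule_algebra H Hn L Ln \<longleftrightarrow> comodule_algebra H L \<and> graded_algebra L Ln \<and>
    (\<forall>n. \<forall>l\<in>Ln n. coact L l \<in> tensor_grading H Hn L Ln n)"

definition graded_comodule_subalgebra ::
  "('k::field, 'h::ab_group_add, 'x) hopf_scheme \<Rightarrow> ('k, 'h, 'l::ab_group_add, 'y) comod_alg_scheme
    \<Rightarrow> (nat \<Rightarrow> 'l set) \<Rightarrow> 'l set \<Rightarrow> bool" where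
  "graded_comodule_subalgebra H L Ln S \<longleftrightarrow>
    subcomodule H L S \<and> unity L \<in> S \<and> (\<forall>x\<in>S. \<forall>y\<in>S. mul L x y \<in> S) \<and>
    graded_space (L\<lparr>carr := S\<rparr>) (\<lambda>n. Ln n \<inter> S)"

definition graded_comodule_algebra_iso ::
  "('k::field, 'h::ab_group_add, 'x) hopf_scheme
    \<Rightarrow> ('k, 'h, 'l::ab_group_add, 'y) comod_alg_scheme \<Rightarrow> (nat \<Rightarrow> 'l set)
    \<Rightarrow> ('k, 'h, 'm::ab_group_add, 'z) comod_alg_scheme \<Rightarrow> (nat \<Rightarrow> 'm set)
    \<Rightarrow> ('l \<Rightarrow> 'm) \<Rightarrow> bool" where
  "graded_comodule_algebra_iso H L Ln M Mn f \<longleftrightarrow>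
    alg_hom L M f \<and> bij_betw f (carr L) (carr M) \<and>
    (\<forall>l\<in>carr L. coact M (f l) = sweedler H L (coact L l) (\<lambda>h l0. tens H M h (f l0))) \<and>
    (\<forall>n. f ` Ln n = Mn n)"

text \<open>
  The Hopf algebra \<open>H(0)\<close>. The antipode of a graded Hopf algebra restricts to it, as the degree
  zero part of the antipode is again a convolution inverse of the identity.
\<close>

definition degree_zero ::
  "('k, 'h, 'x) hopf_scheme \<Rightarrow> (nat \<Rightarrow> 'h set) \<Rightarrow> ('k, 'h, 'x) hopf_scheme" where
  "degree_zero H Hn = H\<lparr>carr := Hn 0\<rparr>"

definition degree_zero_comod ::
  "('k, 'h, 'l, 'y) comod_alg_scheme \<Rightarrow> (nat \<Rightarrow> 'l set) \<Rightarrow> ('k, 'h, 'l, 'y) comod_alg_scheme" where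
  "degree_zero_comod L Ln = L\<lparr>carr := Ln 0\<rparr>"

section \<open>The comodule algebra \<open>H\<^sup>c\<^sup>o\<^sup>i\<^sup>n\<^sup>v # E\<close>\<close>

text \<open>
  \<open>H(0)\<close> is a subset of \<open>H\<close>, so the inclusion \<open>\<iota>\<close> is not written, and \<open>H \<otimes> H(0)\<close> lies in \<open>H \<otimes> H\<close>.
\<close>

definition Hcoinv ::
  "('k::field, 'h::ab_group_add, 'x) hopf_scheme \<Rightarrow> (nat \<Rightarrow> 'h set) \<Rightarrow> 'h set" where
  "Hcoinv H Hn = {r \<in> carr H.
    sweedler H H (comul H r) (\<lambda>a b. tens H H a (component Hn 0 b)) = tens H H r (unity H)}"

definition smash ::
  "('k::field, 'h::ab_group_add, 'x) hopf_scheme \<Rightarrow> (nat \<Rightarrow> 'h set)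
    \<Rightarrow> ('k, 'h, 'e::ab_group_add, 'y) comod_alg_scheme
    \<Rightarrow> ('k, 'h, ('h, 'e, 'k) tensor) comod_alg" where
  "smash H Hn E =
    (let H0 = degree_zero H Hn; R = H\<lparr>carr := Hcoinv H Hn\<rparr> in
    \<lparr>carr = carr (tensor_space R E),
     scl = tscale,
     mul = (\<lambda>s t. sweedler R E s (\<lambda>a l. sweedler R E t (\<lambda>b m.
       sweedler H0 E (coact E l) (\<lambda>x l0. sweedler H0 H0 (comul H0 x) (\<lambda>x1 x2.
         tens H E (mul H (mul H (mul H a x1) b) (antipode H0 x2)) (mul E l0 m)))))),
     unity = tens H E (unity H) (unity E),
     coact = (\<lambda>t. sweedler R E t (\<lambda>a l. sweedler H H (comul H a) (\<lambda>a1 a2.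
       sweedler H0 E (coact E l) (\<lambda>x l0.
         tens H (tensor_space H E) (mul H a1 x) (tens H E a2 l0)))))\<rparr>)"

definition smash_grading ::
  "('k::field, 'h::ab_group_add, 'x) hopf_scheme \<Rightarrow> (nat \<Rightarrow> 'h set)
    \<Rightarrow> ('k, 'h, 'e::ab_group_add, 'y) comod_alg_scheme
    \<Rightarrow> nat \<Rightarrow> ('h, 'e, 'k) tensor set" where
  "smash_grading H Hn E n = carr (tensor_space (H\<lparr>carr := Hn n \<inter> Hcoinv H Hn\<rparr>) E)"

text \<open>Transport of the coaction along a Hopf algebra isomorphism \<open>\<phi> : K \<rightarrow> H\<close>.\<close>

definition push_coact ::
  "('k::field, 'a::ab_group_add, 'x) hopf_scheme \<Rightarrow> ('k, 'h::ab_group_add, 'y) hopf_scheme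
    \<Rightarrow> ('a \<Rightarrow> 'h) \<Rightarrow> ('k, 'a, 'e::ab_group_add) comod_alg \<Rightarrow> ('k, 'h, 'e) comod_alg" where
  "push_coact K H \<phi> E =
    \<lparr>carr = carr E, scl = scl E, mul = mul E, unity = unity E,
     coact = (\<lambda>e. sweedler K E (coact E e) (\<lambda>x e0. tens H E (\<phi> x) e0))\<rparr>"

section \<open>Group algebras and twisted group algebras\<close>

text \<open>
  \<open>\<Bbbk>F\<close> is the space of finitely supported functions with support in \<open>F\<close>.
\<close>

definition pm_scale :: "'k::field \<Rightarrow> ('g \<Rightarrow>\<^sub>0 'k) \<Rightarrow> ('g \<Rightarrow>\<^sub>0 'k)" where
  "pm_scale c x = Poly_Mapping.map (\<lambda>a. c * a) x"

definition two_cocycle ::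
  "('g, 'm) monoid_scheme \<Rightarrow> 'g set \<Rightarrow> ('g \<Rightarrow> 'g \<Rightarrow> 'k::field) \<Rightarrow> bool" where
  "two_cocycle G F \<psi> \<longleftrightarrow>
    (\<forall>a\<in>F. \<forall>b\<in>F. \<psi> a b \<noteq> 0) \<and>
    (\<forall>a\<in>F. \<forall>b\<in>F. \<forall>c\<in>F.
      \<psi> a b * \<psi> (a \<otimes>\<^bsub>G\<^esub> b) c = \<psi> b c * \<psi> a (b \<otimes>\<^bsub>G\<^esub> c)) \<and>
    (\<forall>a\<in>F. \<psi> a \<one>\<^bsub>G\<^esub> = 1 \<and> \<psi> \<one>\<^bsub>G\<^esub> a = 1)"

definition twisted_mul ::
  "('g, 'm) monoid_scheme \<Rightarrow> ('g \<Rightarrow> 'g \<Rightarrow> 'k::field) \<Rightarrow> ('g \<Rightarrow>\<^sub>0 'k) \<Rightarrow> ('g \<Rightarrow>\<^sub>0 'k) \<Rightarrow> ('g \<Rightarrow>\<^sub>0 'k)"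
  where
  "twisted_mul G \<psi> x y = (\<Sum>g\<in>Poly_Mapping.keys x. \<Sum>h\<in>Poly_Mapping.keys y.
    Poly_Mapping.single (g \<otimes>\<^bsub>G\<^esub> h)
      (Poly_Mapping.lookup x g * Poly_Mapping.lookup y h * \<psi> g h))"

text \<open>The linear map with \<open>g \<mapsto> g \<otimes> g\<close>.\<close>

definition grouplike_coact :: "('g \<Rightarrow>\<^sub>0 'k::field) \<Rightarrow> ('g \<Rightarrow>\<^sub>0 'k, 'g \<Rightarrow>\<^sub>0 'k, 'k) tensor" where
  "grouplike_coact x =
    (let V = \<lparr>carr = UNIV, scl = pm_scale\<rparr> in
     \<Sum>g\<in>Poly_Mapping.keys x. tscale (Poly_Mapping.lookup x g)
       (tens V V (Poly_Mapping.single g 1) (Poly_Mapping.single g 1)))"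

definition group_hopf :: "('g, 'm) monoid_scheme \<Rightarrow> ('k::field, 'g \<Rightarrow>\<^sub>0 'k) hopf" where
  "group_hopf G =
    \<lparr>carr = {x. Poly_Mapping.keys x \<subseteq> carrier G},
     scl = pm_scale,
     mul = twisted_mul G (\<lambda>_ _. 1),
     unity = Poly_Mapping.single \<one>\<^bsub>G\<^esub> 1,
     comul = grouplike_coact,
     counit = (\<lambda>x. \<Sum>g\<in>Poly_Mapping.keys x. Poly_Mapping.lookup x g),
     antipode = (\<lambda>x. \<Sum>g\<in>Poly_Mapping.keys x.
       Poly_Mapping.single (inv\<^bsub>G\<^esub> g) (Poly_Mapping.lookup x g))\<rparr>"

definition twisted_group_algebra ::
  "('g, 'm) monoid_scheme \<Rightarrow> 'g set \<Rightarrow> ('g \<Rightarrow> 'g \<Rightarrow> 'k::field)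
    \<Rightarrow> ('k, 'g \<Rightarrow>\<^sub>0 'k, 'g \<Rightarrow>\<^sub>0 'k) comod_alg" where
  "twisted_group_algebra G F \<psi> =
    \<lparr>carr = {x. Poly_Mapping.keys x \<subseteq> F},
     scl = pm_scale,
     mul = twisted_mul G \<psi>,
     unity = Poly_Mapping.single \<one>\<^bsub>G\<^esub> 1,
     coact = grouplike_coact\<rparr>"

end

(* Write [g] for a group element seen in H(0). The space L(0) is graded by G via the coaction.
  Since a homogeneous x in L(0) generates a right ideal xL that is a subcomodule, right simplicity
  makes every nonzero homogeneous element of L(0) invertible, and L(0)_e = k then makes every
  nonzero component L(0)_g one-dimensional. Hence L(0) is a twisted group algebra of its support F,
  with basis u g. Let coord g l be the coefficient of u g in the degree zero part of l, and let
  T g l = l_(-1) coord g l_(0). The embedding is l |-> sum_g T g l [g]^(-1) (x) g, which is the map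
  L -> H box_{H(0)} L(0) followed by the isomorphism of the cotensor product with H^coinv # L(0).
  Its kernel is the common kernel of the maps T g; this is a right ideal and a subcomodule not
  containing 1, hence zero. *)
theory Submission
  imports Defs
begin

section \<open>Linear maps and tensor products\<close>

text \<open>The cotensor product itself is never formed. Identifying L(0) with the twisted group
  algebra, the \<open>T g l\<close> are the coordinates of l_(-1) \<otimes> p(l_(0)), where p is the
  projection to degree zero. With a grading by natural numbers p is an algebra map, so this
  assignment is one too, and its kernel is a right ideal. The kernel is a subcomodule because
  \<Delta>(\<open>T g l\<close>) = l_(-1) \<otimes> \<open>T g\<close> l_(0): once the left legs are
  chosen linearly independent, all right legs lie in the kernel. The factor [g]^(-1) produces
  coinvariants because \<open>T g l\<close> has degree zero part \<open>coord g l\<close> times [g];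
  conjugation by [g] in the smash product absorbs this factor again. Two obstacles shape the text.
  \<open>sweedler\<close> has a specified value only at bilinear maps, so a nested Sweedler
  expression must be shown linear in each variable before it can be evaluated on finite sums of pure
  tensors. And \<open>F\<close> may be infinite, so sums over group elements run over finite
  supports, which are enlarged to common index sets whenever two of them meet.\<close>

context vect_space
begin

lemma carr_zero: "0 \<in> carr V"
  and carr_add: "x \<in> carr V \<Longrightarrow> y \<in> carr V \<Longrightarrow> x + y \<in> carr V"
  and carr_diff: "x \<in> carr V \<Longrightarrow> y \<in> carr V \<Longrightarrow> x - y \<in> carr V"
  and carr_scale: "x \<in> carr V \<Longrightarrow> scl V c x \<in> carr V"
  and carr_sum: "(\<And>i. i \<in> I \<Longrightarrow> f i \<in> carr V) \<Longrightarrow> sum f I \<in> carr V"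
  using subspace_carr by (auto intro: subspace_0 subspace_add subspace_diff subspace_scale subspace_sum)

lemma vect_space_subspace: "subspace S \<Longrightarrow> vect_space (V\<lparr>carr := S\<rparr>)"
  by (intro vect_space.intro vect_space_axioms.intro) (simp_all add: vector_space_axioms)

end

lemma klinearI:
  assumes "\<And>x. x \<in> carr V \<Longrightarrow> f x \<in> carr W"
    and "\<And>x y. x \<in> carr V \<Longrightarrow> y \<in> carr V \<Longrightarrow> f (x + y) = f x + f y"
    and "\<And>c x. x \<in> carr V \<Longrightarrow> f (scl V c x) = scl W c (f x)"
  shows "klinear V W f"
  using assms by (simp add: klinear_def)

lemma klinear_closed: "klinear V W f \<Longrightarrow> x \<in> carr V \<Longrightarrow> f x \<in> carr W"
  and klinear_add: "klinear V W f \<Longrightarrow> x \<in> carr V \<Longrightarrow> y \<in> carr V \<Longrightarrow> f (x + y) = f x + f y"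
  and klinear_scale: "klinear V W f \<Longrightarrow> x \<in> carr V \<Longrightarrow> f (scl V c x) = scl W c (f x)"
  by (simp_all add: klinear_def)

lemma klinear_zero:
  assumes "vect_space V" "klinear V W f"
  shows "f 0 = 0"
  using klinear_add[OF assms(2), of 0 0] vect_space.carr_zero[OF assms(1)] by simp

lemma klinear_diff:
  assumes "vect_space V" "klinear V W f" "x \<in> carr V" "y \<in> carr V"
  shows "f (x - y) = f x - f y"
  using klinear_add[OF assms(2), of "x - y" y] vect_space.carr_diff[OF assms(1)] assms(3,4)
  by (simp add: algebra_simps)

lemma klinear_sum:
  assumes V: "vect_space V" and f: "klinear V W f" and g: "\<And>i. i \<in> I \<Longrightarrow> g i \<in> carr V"
  shows "f (sum g I) = (\<Sum>i\<in>I. f (g i))"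
  using g
proof (induction I rule: infinite_finite_induct)
  case (insert x A)
  then show ?case
    by (simp add: klinear_add[OF f] vect_space.carr_sum[OF V])
qed (simp_all add: klinear_zero[OF V f])

lemma klinear_image_subspace:
  assumes V: "vect_space V" and W: "vect_space W" and f: "klinear V W f"
  shows "module.subspace (scl W) (f ` carr V)"
proof -
  interpret V: vect_space V by fact
  interpret W: vect_space W by fact
  show ?thesis
    unfolding W.subspace_def
  proof (intro conjI ballI allI)
    show "0 \<in> f ` carr V" using klinear_zero[OF V f] V.carr_zero by (metis imageI)
    show "x + y \<in> f ` carr V" if "x \<in> f ` carr V" "y \<in> f ` carr V" for x y
      using that klinear_add[OF f, symmetric] V.carr_add by (auto intro!: imageI)
    show "scl W c x \<in> f ` carr V" if "x \<in> f ` carr V" for c x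
      using that klinear_scale[OF f, symmetric] V.carr_scale by (auto intro!: imageI)
  qed
qed

lemma klinear_ident: "klinear V V (\<lambda>x. x)"
  by (simp add: klinear_def)

lemma klinear_compose: "klinear V W f \<Longrightarrow> klinear W U g \<Longrightarrow> klinear V U (\<lambda>x. g (f x))"
  by (simp add: klinear_def)

lemma klinear_weaken: "klinear V W f \<Longrightarrow> carr W \<subseteq> carr W' \<Longrightarrow> scl W = scl W' \<Longrightarrow> klinear V W' f"
  by (auto simp: klinear_def)

lemma klinear_restrict: "klinear V W f \<Longrightarrow> carr V' \<subseteq> carr V \<Longrightarrow> scl V' = scl V \<Longrightarrow> klinear V' W f"
  unfolding klinear_def by (metis subsetD)

lemma klinear_scale_const:
  assumes "vect_space W" "klinear V W f"
  shows "klinear V W (\<lambda>x. scl W c (f x))"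
proof -
  interpret W: vect_space W by fact
  show ?thesis using assms(2)
    by (simp add: klinear_def W.carr_scale W.scale_right_distrib W.scale_left_commute)
qed

lemma klinear_sum_fun:
  assumes W: "vect_space W" and f: "\<And>i. i \<in> I \<Longrightarrow> klinear V W (f i)"
  shows "klinear V W (\<lambda>x. \<Sum>i\<in>I. f i x)"
proof -
  interpret W: vect_space W by fact
  show ?thesis
    using f by (intro klinearI)
      (auto simp: klinear_def sum.distrib W.scale_sum_right intro!: W.carr_sum sum.cong)
qed

text \<open>Only the values of \<open>f\<close> on \<open>carr V\<close> matter, so the inverse is
  the choice function \<open>inv_into\<close>; injectivity identifies its values.\<close>

lemma klinear_inv_into:
  assumes V: "vect_space V" and f: "klinear V W f" and bij: "bij_betw f (carr V) (carr W)"
  shows "klinear W V (inv_into (carr V) f)"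
proof (rule klinearI)
  interpret V: vect_space V by fact
  note inj = bij_betw_imp_inj_on[OF bij]
  have cl: "inv_into (carr V) f y \<in> carr V" and eq: "f (inv_into (carr V) f y) = y"
    if "y \<in> carr W" for y
    using that bij by (auto simp: bij_betw_def inv_into_into f_inv_into_f)
  fix x y c assume xy: "x \<in> carr W"
  show "inv_into (carr V) f x \<in> carr V" by (rule cl[OF xy])
  show "inv_into (carr V) f (scl W c x) = scl V c (inv_into (carr V) f x)"
    by (rule inv_into_f_eq[OF inj]) (simp_all add: V.carr_scale cl xy klinear_scale[OF f] eq)
  assume y: "y \<in> carr W"
  show "inv_into (carr V) f (x + y) = inv_into (carr V) f x + inv_into (carr V) f y"
    by (rule inv_into_f_eq[OF inj]) (simp_all add: V.carr_add cl xy y klinear_add[OF f] eq)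
qed

lemma kbilinearI:
  assumes "\<And>x. x \<in> carr V \<Longrightarrow> klinear W U (b x)"
    and "\<And>y. y \<in> carr W \<Longrightarrow> klinear V U (\<lambda>x. b x y)"
  shows "kbilinear V W U b"
  using assms by (simp add: kbilinear_def)

lemma kbilinear_left: "kbilinear V W U b \<Longrightarrow> klinear X V f \<Longrightarrow> w \<in> carr W \<Longrightarrow> klinear X U (\<lambda>x. b (f x) w)"
  and kbilinear_right: "kbilinear V W U b \<Longrightarrow> klinear X W h \<Longrightarrow> v \<in> carr V \<Longrightarrow> klinear X U (\<lambda>x. b v (h x))"
  by (auto simp: kbilinear_def intro: klinear_compose)

lemma kbilinear_closed: "kbilinear V W U b \<Longrightarrow> v \<in> carr V \<Longrightarrow> w \<in> carr W \<Longrightarrow> b v w \<in> carr U"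
  by (auto simp: kbilinear_def klinear_def)

lemma kbilinear_sum_left:
  "vect_space V \<Longrightarrow> kbilinear V W U b \<Longrightarrow> w \<in> carr W \<Longrightarrow> (\<And>i. i \<in> I \<Longrightarrow> g i \<in> carr V) \<Longrightarrow>
    b (sum g I) w = (\<Sum>i\<in>I. b (g i) w)"
  using klinear_sum[of V U "\<lambda>x. b x w" I g] by (simp add: kbilinear_def)

lemma kbilinear_sum_right:
  "vect_space W \<Longrightarrow> kbilinear V W U b \<Longrightarrow> v \<in> carr V \<Longrightarrow> (\<And>i. i \<in> I \<Longrightarrow> g i \<in> carr W) \<Longrightarrow>
    b v (sum g I) = (\<Sum>i\<in>I. b v (g i))"
  using klinear_sum[of W U "b v" I g] by (simp add: kbilinear_def)

lemma kbilinear_sum_sum: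
  assumes V: "vect_space V" and W: "vect_space W" and b: "kbilinear V W U b"
    and f: "\<And>i. i \<in> I \<Longrightarrow> f i \<in> carr V" and g: "\<And>j. j \<in> J \<Longrightarrow> g j \<in> carr W"
  shows "b (sum f I) (sum g J) = (\<Sum>i\<in>I. \<Sum>j\<in>J. b (f i) (g j))"
proof -
  have "sum g J \<in> carr W" using g by (rule vect_space.carr_sum[OF W])
  then have "b (sum f I) (sum g J) = (\<Sum>i\<in>I. b (f i) (sum g J))"
    by (rule kbilinear_sum_left[OF V b]) (rule f)
  also have "\<dots> = (\<Sum>i\<in>I. \<Sum>j\<in>J. b (f i) (g j))"
    by (intro sum.cong refl kbilinear_sum_right[OF W b] f g)
  finally show ?thesis .
qed

section \<open>Pure tensors and finite presentations of tensors\<close>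

text \<open>Bilinear forms live on the ambient spaces, so \<open>tens\<close> does not see carriers.
  This moves tensors freely between a space and the same space with a smaller carrier.\<close>

lemma tens_cong: "scl V = scl V' \<Longrightarrow> scl W = scl W' \<Longrightarrow> tens V W = tens V' W'"
  by (intro ext) (simp add: tens_def bilinear_form_def)

lemma tens_add_left: "tens V W (v + v') w = tens V W v w + tens V W v' w"
  and tens_add_right: "tens V W v (w + w') = tens V W v w + tens V W v w'"
  and tens_scale_left: "tens V W (scl V c v) w = tscale c (tens V W v w)"
  and tens_scale_right: "tens V W v (scl W c w) = tscale c (tens V W v w)"
  by (auto simp: tens_def fun_eq_iff tscale_def bilinear_form_def Vector_Spaces.linear_iff)

lemma tens_zero_left: "tens V W 0 w = 0"
  using tens_add_left[of V W 0 0 w] by simp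

lemma tens_zero_right: "tens V W v 0 = 0"
  using tens_add_right[of V W v 0 0] by simp

lemma tens_sum_left: "tens V W (sum f I) w = (\<Sum>i\<in>I. tens V W (f i) w)"
  by (induction I rule: infinite_finite_induct) (simp_all add: tens_zero_left tens_add_left)

lemma tens_sum_right: "tens V W v (sum f I) = (\<Sum>i\<in>I. tens V W v (f i))"
  by (induction I rule: infinite_finite_induct) (simp_all add: tens_zero_right tens_add_right)

lemma tens_diff_right: "tens V W v (w - w') = tens V W v w - tens V W v w'"
  using tens_add_right[of V W v "w - w'" w'] by (simp add: algebra_simps)

lemma scl_tensor_space [simp]: "scl (tensor_space V W) = tscale"
  by (simp add: tensor_space_def)

lemma vect_space_tensor:
  fixes V :: "('k::field, 'v::ab_group_add, 'x) vect_scheme"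
    and W :: "('k, 'w::ab_group_add, 'y) vect_scheme"
  shows "vect_space (tensor_space V W)"
proof -
  interpret T: vector_space "tscale :: 'k \<Rightarrow> ('v, 'w, 'k) tensor \<Rightarrow> _" by (rule vector_space_tscale)
  show ?thesis
    by (intro vect_space.intro vect_space_axioms.intro)
      (simp_all add: tensor_space_def T.vector_space_axioms)
qed

lemma tens_closed:
  fixes V :: "('k::field, 'v::ab_group_add, 'x) vect_scheme"
    and W :: "('k, 'w::ab_group_add, 'y) vect_scheme"
  assumes "v \<in> carr V" "w \<in> carr W"
  shows "tens V W v w \<in> carr (tensor_space V W)"
proof -
  interpret T: vector_space "tscale :: 'k \<Rightarrow> ('v, 'w, 'k) tensor \<Rightarrow> _" by (rule vector_space_tscale)
  show ?thesis
    using assms unfolding tensor_space_def by (auto intro!: T.span_base)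
qed

text \<open>Take any presentation, choose a maximal independent set among its left legs and collect
  the right legs. Evaluations of \<open>sweedler\<close> then become sums over a finite set, and
  independence of the left legs later allows coefficients to be compared.\<close>

lemma tensor_space_basis_repr:
  assumes V: "vect_space V" and W: "vect_space W" and t: "t \<in> carr (tensor_space V W)"
  obtains B w where "finite B" "B \<subseteq> carr V" "\<not> module.dependent (scl V) B"
    "\<And>v. w v \<in> carr W" "t = (\<Sum>v\<in>B. tens V W v (w v))"
proof -
  interpret V: vect_space V by fact
  interpret W: vect_space W by fact
  interpret T: vector_space "tscale :: 'a \<Rightarrow> ('b, 'd, 'a) tensor \<Rightarrow> _" by (rule vector_space_tscale)
  obtain ps where ps: "set ps \<subseteq> carr V \<times> carr W" "t = (\<Sum>(v, w)\<leftarrow>ps. tens V W v w)"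
    using tensor_space_repr[OF V t] by blast
  obtain B where B: "B \<subseteq> fst ` set ps" "V.independent B" "fst ` set ps \<subseteq> V.span B"
    by (rule V.maximal_independent_subset)
  have fin: "finite B" using B(1) by (rule finite_subset) simp
  let ?r = "\<lambda>v. V.representation B v"
  have exp: "tens V W v w = (\<Sum>b\<in>B. tens V W b (scl W (?r v b) w))" if "v \<in> V.span B" for v w
  proof -
    have "v = (\<Sum>b\<in>B. scl V (?r v b) b)"
      using V.sum_representation_eq[OF B(2) that fin] by simp
    then have "tens V W v w = tens V W (\<Sum>b\<in>B. scl V (?r v b) b) w" by simp
    also have "\<dots> = (\<Sum>b\<in>B. tens V W b (scl W (?r v b) w))"
      by (simp add: tens_sum_left tens_scale_left tens_scale_right)
    finally show ?thesis .
  qed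
  define w where "w b = (\<Sum>(v, w)\<leftarrow>ps. scl W (?r v b) w)" for b
  have "t = (\<Sum>b\<in>B. tens V W b (w b))"
    using B(3) unfolding ps(2) w_def
    by (induction ps) (auto simp: exp sum.distrib tens_add_right tens_zero_right)
  moreover have "w b \<in> carr W" for b
    using ps(1) unfolding w_def
    by (induction ps) (auto simp: W.carr_zero intro!: W.carr_add W.carr_scale)
  moreover have "B \<subseteq> carr V" using B(1) ps(1) by fastforce
  ultimately show thesis using that fin B(2) by blast
qed

lemma sweedler_finite_sum:
  assumes "vect_space V" "vect_space W" "vect_space U" "kbilinear V W U b"
    and "\<And>i. i \<in> I \<Longrightarrow> v i \<in> carr V" "\<And>i. i \<in> I \<Longrightarrow> w i \<in> carr W"
  shows "sweedler V W (\<Sum>i\<in>I. tens V W (v i) (w i)) b = (\<Sum>i\<in>I. b (v i) (w i))"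
  using assms
  by (simp add: klinear_sum[OF vect_space_tensor klinear_sweedler[OF assms(1-4)]] tens_closed
      sweedler_tens[OF assms(1-4)])

lemma sweedler_closed:
  assumes "vect_space V" "vect_space W" "vect_space U" "kbilinear V W U b"
    and "t \<in> carr (tensor_space V W)"
  shows "sweedler V W t b \<in> carr U"
  using klinear_closed[OF klinear_sweedler[OF assms(1-4)] assms(5)] .

lemma klinear_apply_sweedler:
  assumes V: "vect_space V" and W: "vect_space W" and U: "vect_space U" and U': "vect_space U'"
    and b: "kbilinear V W U b" and f: "klinear U U' f"
    and t: "t \<in> carr (tensor_space V W)"
  shows "f (sweedler V W t b) = sweedler V W t (\<lambda>v w. f (b v w))"
proof -
  have fb: "kbilinear V W U' (\<lambda>v w. f (b v w))"
    using b f by (auto simp: kbilinear_def intro: klinear_compose)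
  obtain B w where B: "finite B" "B \<subseteq> carr V" "\<And>v. w v \<in> carr W" "t = (\<Sum>v\<in>B. tens V W v (w v))"
    using tensor_space_basis_repr[OF V W t] by metis
  show ?thesis
    unfolding B(4) using B(2,3)
    by (simp add: sweedler_finite_sum[OF V W U b] sweedler_finite_sum[OF V W U' fb] subsetD
        klinear_sum[OF U f] kbilinear_closed[OF b])
qed

lemma klinear_sweedler_arg:
  assumes "vect_space V" "vect_space W" "vect_space U" "kbilinear V W U b"
    and "klinear X (tensor_space V W) \<tau>"
  shows "klinear X U (\<lambda>x. sweedler V W (\<tau> x) b)"
  using klinear_compose[OF assms(5) klinear_sweedler[OF assms(1-4)]] .

text \<open>Linearity in a parameter on which the bilinear map depends: one presentation of
  \<open>t\<close>, chosen independently of \<open>x\<close>, turns the expression into a fixed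
  finite sum of linear maps.\<close>

lemma klinear_sweedler_fun:
  assumes V: "vect_space V" and W: "vect_space W" and U: "vect_space U" and X: "vect_space X"
    and t: "t \<in> carr (tensor_space V W)"
    and b: "\<And>x. x \<in> carr X \<Longrightarrow> kbilinear V W U (b x)"
    and x: "\<And>v w. v \<in> carr V \<Longrightarrow> w \<in> carr W \<Longrightarrow> klinear X U (\<lambda>x. b x v w)"
  shows "klinear X U (\<lambda>x. sweedler V W t (b x))"
proof -
  obtain B w where B: "finite B" "B \<subseteq> carr V" "\<And>v. w v \<in> carr W" "t = (\<Sum>v\<in>B. tens V W v (w v))"
    using tensor_space_basis_repr[OF V W t] by metis
  have eq: "sweedler V W t (b x) = (\<Sum>v\<in>B. b x v (w v))" if "x \<in> carr X" for x
    unfolding B(4) using B(2,3) by (simp add: sweedler_finite_sum[OF V W U b[OF that]] subsetD)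
  have "klinear X U (\<lambda>x. \<Sum>v\<in>B. b x v (w v))"
    using B(2,3) by (intro klinear_sum_fun[OF U] x) auto
  then show ?thesis
    by (simp add: klinear_def eq vect_space.carr_add[OF X] vect_space.carr_scale[OF X])
qed

section \<open>Slices of tensors and comparison of coefficients\<close>

lemma field_alg_simps [simp]: "carr field_alg = UNIV" "scl field_alg = (*)" "mul field_alg = (*)"
    "unity field_alg = 1"
  by (simp_all add: field_alg_def)

lemma kbilinear_scl: "vect_space V \<Longrightarrow> kbilinear field_alg V V (scl V)"
proof -
  assume "vect_space V"
  then interpret V: vect_space V .
  show ?thesis by (auto simp: kbilinear_def klinear_def V.carr_scale V.scale_right_distrib
        V.scale_left_distrib V.scale_left_commute)
qed

lemma kbilinear_slice_left:
  assumes W: "vect_space W" and \<xi>: "klinear V field_alg \<xi>"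
  shows "kbilinear V W W (\<lambda>v w. scl W (\<xi> v) w)"
proof (rule kbilinearI)
  show "klinear W W (scl W (\<xi> v))" for v
    using klinear_scale_const[OF W klinear_ident] .
  show "w \<in> carr W \<Longrightarrow> klinear V W (\<lambda>v. scl W (\<xi> v) w)" for w
    by (rule kbilinear_left[OF kbilinear_scl[OF W] \<xi>])
qed

lemma kbilinear_slice_right:
  assumes V: "vect_space V" and \<xi>: "klinear W field_alg \<xi>"
  shows "kbilinear V W V (\<lambda>v w. scl V (\<xi> w) v)"
  using kbilinear_slice_left[OF V \<xi>] by (simp add: kbilinear_def)

text \<open>Slicing the relation with \<open>\<xi> i\<close> in the left leg isolates
  \<open>w i\<close>. The functionals need only be linear on \<open>carr V\<close>, so coordinates
  on H(0) qualify although they come with no extension to the ambient space.\<close>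

lemma tens_family_zero:
  assumes V: "vect_space V" and W: "vect_space W" and "finite I"
    and \<xi>: "\<And>i. i \<in> I \<Longrightarrow> klinear V field_alg (\<xi> i)"
    and v: "\<And>i. i \<in> I \<Longrightarrow> v i \<in> carr V" and w: "\<And>i. i \<in> I \<Longrightarrow> w i \<in> carr W"
    and dual: "\<And>i j. i \<in> I \<Longrightarrow> j \<in> I \<Longrightarrow> \<xi> i (v j) = (if i = j then 1 else 0)"
    and zero: "(\<Sum>i\<in>I. tens V W (v i) (w i)) = 0" and i: "i \<in> I"
  shows "w i = 0"
proof -
  interpret W: vect_space W by fact
  note bl = kbilinear_slice_left[OF W \<xi>[OF i]]
  have "0 = sweedler V W (\<Sum>i\<in>I. tens V W (v i) (w i)) (\<lambda>v w. scl W (\<xi> i v) w)"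
    unfolding zero by (rule klinear_zero[OF vect_space_tensor klinear_sweedler[OF V W W bl], symmetric])
  also have "\<dots> = (\<Sum>j\<in>I. scl W (\<xi> i (v j)) (w j))"
    by (rule sweedler_finite_sum[OF V W W bl v w])
  also have "\<dots> = (\<Sum>j\<in>I. if j = i then w j else 0)"
    using i by (intro sum.cong) (auto simp: dual)
  also have "\<dots> = w i" using i \<open>finite I\<close> by simp
  finally show ?thesis by simp
qed

text \<open>The dual functionals required by \<open>tens_family_zero\<close> are obtained by
  extending them from the independent set \<open>B\<close> to the ambient space.\<close>

lemma tens_independent_zero:
  assumes V: "vect_space V" and W: "vect_space W" and B: "finite B" "B \<subseteq> carr V"
    "\<not> module.dependent (scl V) B"
    and w: "\<And>v. v \<in> B \<Longrightarrow> w v \<in> carr W"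
    and zero: "(\<Sum>v\<in>B. tens V W v (w v)) = 0" and b: "b \<in> B"
  shows "w b = 0"
proof -
  interpret V: vect_space V by fact
  interpret K: vector_space "(*) :: 'a \<Rightarrow> 'a \<Rightarrow> 'a" by (rule vector_space_mult)
  interpret P: vector_space_pair "scl V" "(*)" by unfold_locales
  have "\<exists>\<xi>. Vector_Spaces.linear (scl V) (*) \<xi> \<and> (\<forall>x\<in>B. \<xi> x = (if i = x then 1 else 0))" for i
    using P.linear_independent_extend[OF B(3)] .
  then obtain \<xi> where \<xi>: "\<And>i. Vector_Spaces.linear (scl V) (*) (\<xi> i)"
    "\<And>i x. x \<in> B \<Longrightarrow> \<xi> i x = (if i = x then 1 else 0)" by metis
  have lin: "klinear V field_alg (\<xi> i)" for i
    using \<xi>(1)[of i] by (simp add: klinear_def Vector_Spaces.linear_iff)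
  show ?thesis
    by (rule tens_family_zero[OF V W B(1) lin _ w _ zero b]) (use B(2) \<xi>(2) in auto)
qed

text \<open>Rewriting under the binder is legitimate only for arguments in the carriers; outside
  them \<open>b\<close> and \<open>b'\<close> may differ.\<close>

lemma sweedler_cong:
  assumes V: "vect_space V" and W: "vect_space W" and U: "vect_space U" and b: "kbilinear V W U b"
    and eq: "\<And>v w. v \<in> carr V \<Longrightarrow> w \<in> carr W \<Longrightarrow> b v w = b' v w"
    and t: "t \<in> carr (tensor_space V W)"
  shows "sweedler V W t b = sweedler V W t b'"
proof -
  interpret V: vect_space V by fact
  interpret W: vect_space W by fact
  have b': "kbilinear V W U b'"
    using b by (simp add: kbilinear_def klinear_def eq V.carr_add W.carr_add V.carr_scale W.carr_scale)
  obtain B w where B: "finite B" "B \<subseteq> carr V" "\<And>v. w v \<in> carr W" "t = (\<Sum>v\<in>B. tens V W v (w v))"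
    using tensor_space_basis_repr[OF V W t] by metis
  show ?thesis
    unfolding B(4) using B(2,3)
    by (auto simp: sweedler_finite_sum[OF V W U b] sweedler_finite_sum[OF V W U b'] subsetD eq intro!: sum.cong)
qed

lemma sweedler_tens_self:
  assumes V: "vect_space V" and W: "vect_space W" and t: "t \<in> carr (tensor_space V W)"
  shows "sweedler V W t (tens V W) = t"
proof -
  obtain B w where B: "finite B" "B \<subseteq> carr V" "\<And>v. w v \<in> carr W" "t = (\<Sum>v\<in>B. tens V W v (w v))"
    using tensor_space_basis_repr[OF V W t] by metis
  show ?thesis
    using sweedler_finite_sum[OF V W vect_space_tensor kbilinear_tens[OF V W], of B "\<lambda>v. v" w] B by auto
qed

section \<open>Graded spaces and algebras\<close>

lemma alg_hom_klinear: "alg_hom A B f \<Longrightarrow> klinear A B f"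
  and alg_hom_mul: "alg_hom A B f \<Longrightarrow> x \<in> carr A \<Longrightarrow> y \<in> carr A \<Longrightarrow> f (mul A x y) = mul B (f x) (f y)"
  and alg_hom_unity: "alg_hom A B f \<Longrightarrow> f (unity A) = unity B"
  by (simp_all add: alg_hom_def)

lemma klinear_mul_left: "k_algebra A \<Longrightarrow> klinear X A f \<Longrightarrow> a \<in> carr A \<Longrightarrow> klinear X A (\<lambda>x. mul A (f x) a)"
  and klinear_mul_right: "k_algebra A \<Longrightarrow> klinear X A f \<Longrightarrow> a \<in> carr A \<Longrightarrow> klinear X A (\<lambda>x. mul A a (f x))"
  and mul_closed: "k_algebra A \<Longrightarrow> a \<in> carr A \<Longrightarrow> b \<in> carr A \<Longrightarrow> mul A a b \<in> carr A"
  by (auto dest: k_algebra.mul_bilinear intro: kbilinear_left kbilinear_right kbilinear_closed)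

lemma mul_zero_left: "k_algebra A \<Longrightarrow> a \<in> carr A \<Longrightarrow> mul A 0 a = 0"
  and mul_zero_right: "k_algebra A \<Longrightarrow> a \<in> carr A \<Longrightarrow> mul A a 0 = 0"
proof -
  assume A: "k_algebra A" "a \<in> carr A"
  then have V: "vect_space A" by (simp add: k_algebra_def)
  show "mul A 0 a = 0" by (rule klinear_zero[OF V klinear_mul_left[OF A(1) klinear_ident A(2)]])
  show "mul A a 0 = 0" by (rule klinear_zero[OF V klinear_mul_right[OF A(1) klinear_ident A(2)]])
qed

text \<open>Stated for finite sums because coactions and coproducts are always expanded that way;
  taking \<open>{()}\<close> as an index set covers pure tensors.\<close>

lemma tensor_alg_mul_tens:
  assumes A: "k_algebra A" and B: "k_algebra B"
    and I: "\<And>i. i \<in> I \<Longrightarrow> a i \<in> carr A" "\<And>i. i \<in> I \<Longrightarrow> b i \<in> carr B"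
    and J: "\<And>j. j \<in> J \<Longrightarrow> c j \<in> carr A" "\<And>j. j \<in> J \<Longrightarrow> d j \<in> carr B"
  shows "mul (tensor_alg A B) (\<Sum>i\<in>I. tens A B (a i) (b i)) (\<Sum>j\<in>J. tens A B (c j) (d j))
    = (\<Sum>i\<in>I. \<Sum>j\<in>J. tens A B (mul A (a i) (c j)) (mul B (b i) (d j)))"
proof -
  have VA: "vect_space A" and VB: "vect_space B" using A B by (simp_all add: k_algebra_def)
  note VT = vect_space_tensor[of A B]
  let ?T = "tensor_space A B"
  note kt = kbilinear_tens[OF VA VB]
  let ?b = "\<lambda>a b a' b'. tens A B (mul A a a') (mul B b b')"
  note ks = kbilinear_left[OF kt] kbilinear_right[OF kt] klinear_mul_left[OF A] klinear_mul_right[OF A]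
    klinear_mul_left[OF B] klinear_mul_right[OF B] klinear_ident mul_closed[OF A] mul_closed[OF B]
  have b: "kbilinear A B ?T (?b x y)" if "x \<in> carr A" "y \<in> carr B" for x y
    using that by (intro kbilinearI ks)
  have t: "(\<Sum>j\<in>J. tens A B (c j) (d j)) \<in> carr ?T" using J by (auto intro!: vect_space.carr_sum[OF VT] tens_closed)
  have b': "kbilinear A B ?T (\<lambda>a b. sweedler A B (\<Sum>j\<in>J. tens A B (c j) (d j)) (?b a b))"
    by (intro kbilinearI klinear_sweedler_fun[OF VA VB VT] VA VB t b) (intro ks; assumption)+
  have "mul (tensor_alg A B) (\<Sum>i\<in>I. tens A B (a i) (b i)) (\<Sum>j\<in>J. tens A B (c j) (d j))
    = (\<Sum>i\<in>I. sweedler A B (\<Sum>j\<in>J. tens A B (c j) (d j)) (?b (a i) (b i)))"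
    using sweedler_finite_sum[OF VA VB VT b' I] by (simp add: tensor_alg_def)
  also have "\<dots> = (\<Sum>i\<in>I. \<Sum>j\<in>J. ?b (a i) (b i) (c j) (d j))"
    by (intro sum.cong refl sweedler_finite_sum[OF VA VB VT b] I J)
  finally show ?thesis .
qed

lemma decomposes_sum:
  assumes "decomposes Vn x f" "finite A" "{n. f n \<noteq> 0} \<subseteq> A"
  shows "x = (\<Sum>n\<in>A. f n)"
  using assms unfolding decomposes_def by (metis (mono_tags, lifting) DiffE mem_Collect_eq sum.mono_neutral_left)

text \<open>Any finite set containing the support is enough, so the exact support of a sum or an
  image need not be computed.\<close>

lemma decomposesI:
  assumes "\<And>n. f n \<in> Vn n" "finite A" "{n. f n \<noteq> 0} \<subseteq> A" "x = (\<Sum>n\<in>A. f n)"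
  shows "decomposes Vn x f"
proof -
  have "(\<Sum>n\<in>A. f n) = (\<Sum>n | f n \<noteq> 0. f n)"
    using assms(2,3) by (intro sum.mono_neutral_right) auto
  then show ?thesis
    using assms(1,4) finite_subset[OF assms(3,2)] unfolding decomposes_def by metis
qed

lemma graded_space_subset: "graded_space V Vn \<Longrightarrow> x \<in> Vn n \<Longrightarrow> x \<in> carr V"
  by (auto simp: graded_space_def)

lemma graded_space_vect_space:
  assumes "vect_space V" "graded_space V Vn"
  shows "vect_space (V\<lparr>carr := Vn n\<rparr>)"
  using assms by (auto simp: graded_space_def intro: vect_space.vect_space_subspace)

lemma component_decomposes:
  assumes "graded_space V Vn" "x \<in> carr V"
  shows "decomposes Vn x (\<lambda>n. component Vn n x)"
proof -
  have "\<exists>!f. decomposes Vn x f" using assms by (simp add: graded_space_def)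
  then show ?thesis unfolding component_def by (rule theI')
qed

lemma component_unique:
  assumes "graded_space V Vn" "x \<in> carr V" "decomposes Vn x f"
  shows "component Vn n x = f n"
proof -
  have "\<exists>!f. decomposes Vn x f" using assms by (simp add: graded_space_def)
  then show ?thesis unfolding component_def using assms(3) by (simp add: the1_equality)
qed

lemma component_mem:
  assumes "graded_space V Vn" "x \<in> carr V"
  shows "component Vn n x \<in> Vn n"
  using component_decomposes[OF assms] by (simp add: decomposes_def)

lemma finite_component:
  assumes "graded_space V Vn" "x \<in> carr V"
  shows "finite {n. component Vn n x \<noteq> 0}"
  using component_decomposes[OF assms] by (simp add: decomposes_def)

lemma component_sum_eq:
  assumes "graded_space V Vn" "x \<in> carr V" "finite A" "{n. component Vn n x \<noteq> 0} \<subseteq> A"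
  shows "(\<Sum>n\<in>A. component Vn n x) = x"
  using decomposes_sum[OF component_decomposes[OF assms(1,2)] assms(3,4)] by simp

lemma component_homogeneous:
  assumes V: "vect_space V" and gr: "graded_space V Vn" and x: "x \<in> Vn m"
  shows "component Vn n x = (if n = m then x else 0)"
proof -
  interpret V: vect_space V by fact
  have "V.subspace (Vn n)" for n using gr by (simp add: graded_space_def)
  then have "decomposes Vn x (\<lambda>n. if n = m then x else 0)"
    using x by (auto simp: decomposes_def V.subspace_0)
  from component_unique[OF gr graded_space_subset[OF gr x] this] show ?thesis .
qed

lemma klinear_component:
  assumes V: "vect_space V" and gr: "graded_space V Vn"
  shows "klinear V (V\<lparr>carr := Vn n\<rparr>) (component Vn n)"
proof (rule klinearI)
  interpret V: vect_space V by fact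
  have sub: "V.subspace (Vn n)" for n using gr by (simp add: graded_space_def)
  note mem = component_mem[OF gr]
  fix x y c assume x: "x \<in> carr V"
  show "component Vn n x \<in> carr (V\<lparr>carr := Vn n\<rparr>)" using mem[OF x] by simp
  have "{n. scl V c (component Vn n x) \<noteq> 0} \<subseteq> {n. component Vn n x \<noteq> 0}" by auto
  moreover have "scl V c x = (\<Sum>n | component Vn n x \<noteq> 0. scl V c (component Vn n x))"
    using component_sum_eq[OF gr x finite_component[OF gr x] order_refl] by (simp add: V.scale_sum_right[symmetric])
  ultimately have "decomposes Vn (scl V c x) (\<lambda>n. scl V c (component Vn n x))"
    by (intro decomposesI[OF _ finite_component[OF gr x]]) (simp_all add: mem x sub V.subspace_scale)
  then show "component Vn n (scl V c x) = scl (V\<lparr>carr := Vn n\<rparr>) c (component Vn n x)"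
    using component_unique[OF gr V.carr_scale[OF x]] by simp
  assume y: "y \<in> carr V"
  let ?A = "{n. component Vn n x \<noteq> 0} \<union> {n. component Vn n y \<noteq> 0}"
  have A: "finite ?A" "{n. component Vn n x + component Vn n y \<noteq> 0} \<subseteq> ?A"
    using finite_component[OF gr x] finite_component[OF gr y] by auto
  have "x + y = (\<Sum>n\<in>?A. component Vn n x + component Vn n y)"
    using component_sum_eq[OF gr x A(1)] component_sum_eq[OF gr y A(1)] by (simp add: sum.distrib)
  then have "decomposes Vn (x + y) (\<lambda>n. component Vn n x + component Vn n y)"
    by (intro decomposesI[OF _ A]) (simp_all add: mem x y sub V.subspace_add)
  then show "component Vn n (x + y) = component Vn n x + component Vn n y"
    using component_unique[OF gr V.carr_add[OF x y]] by simp
qed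

lemma graded_space_ext:
  assumes V: "vect_space V" and gr: "graded_space V Vn" and f: "klinear V W f" and g: "klinear V W g"
    and eq: "\<And>n x. x \<in> Vn n \<Longrightarrow> f x = g x" and x: "x \<in> carr V"
  shows "f x = g x"
proof -
  note s = component_sum_eq[OF gr x finite_component[OF gr x] order_refl, symmetric]
  have c: "component Vn n x \<in> carr V" for n using graded_space_subset[OF gr component_mem[OF gr x]] .
  have "f x = (\<Sum>n | component Vn n x \<noteq> 0. f (component Vn n x))"
    by (subst s) (rule klinear_sum[OF V f c])
  also have "\<dots> = (\<Sum>n | component Vn n x \<noteq> 0. g (component Vn n x))"
    using eq[OF component_mem[OF gr x]] by (rule sum.cong[OF refl])
  also have "\<dots> = g x" using s klinear_sum[OF V g, of "{n. component Vn n x \<noteq> 0}" "\<lambda>n. component Vn n x"] c by simp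
  finally show ?thesis .
qed

text \<open>In a grading by natural numbers i + j = 0 forces i = j = 0, so a product acquires a
  degree zero part only from the degree zero parts of its factors.\<close>

lemma component_zero_mul:
  assumes gr: "graded_algebra A An" and x: "x \<in> carr A" and y: "y \<in> carr A"
  shows "component An 0 (mul A x y) = mul A (component An 0 x) (component An 0 y)"
proof -
  have alg: "k_algebra A" and gs: "graded_space A An" using gr by (auto simp: graded_algebra_def)
  then have V: "vect_space A" by (simp add: k_algebra_def)
  have lin: "klinear A A (component An 0)"
    by (rule klinear_weaken[OF klinear_component[OF V gs]]) (use gs in \<open>auto simp: graded_space_def\<close>)
  note sub = graded_space_subset[OF gs]
  have cl: "x \<in> carr A \<Longrightarrow> component An 0 x \<in> carr A" for x
    using klinear_closed[OF lin] .
  have hom: "component An 0 (mul A x y) = mul A (component An 0 x) (component An 0 y)"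
    if "x \<in> An i" "y \<in> An j" for x y i j
  proof -
    have xy: "mul A x y \<in> An (i + j)" using gr that by (simp add: graded_algebra_def)
    have "mul A 0 y = 0" "mul A x 0 = 0" "mul A 0 0 = 0"
      using that sub by (auto intro!: mul_zero_left[OF alg] mul_zero_right[OF alg] vect_space.carr_zero[OF V])
    then show ?thesis
      by (auto simp: component_homogeneous[OF V gs xy] component_homogeneous[OF V gs that(1)]
          component_homogeneous[OF V gs that(2)])
  qed
  \<comment> \<open>\<open>graded_space_ext\<close> handles one variable at a time: here
    \<open>y\<close> is arbitrary and \<open>x\<close> still homogeneous.\<close>
  have "component An 0 (mul A x y) = mul A (component An 0 x) (component An 0 y)" if x: "x \<in> An i" for x i
    using klinear_compose[OF klinear_mul_right[OF alg klinear_ident sub[OF x]] lin]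
      klinear_mul_right[OF alg lin cl[OF sub[OF x]]] hom[OF x] y
    by (rule graded_space_ext[OF V gs])
  with klinear_compose[OF klinear_mul_left[OF alg klinear_ident y] lin]
    klinear_mul_left[OF alg lin cl[OF y]] show ?thesis
    using x by (rule graded_space_ext[OF V gs])
qed

text \<open>Transport of structure. Uniqueness holds because the inverse of \<open>f\<close> carries
  a decomposition of \<open>y\<close> back to one of its preimage.\<close>

lemma graded_space_image:
  assumes V: "vect_space V" and W: "vect_space W" and gr: "graded_space V Vn"
    and f: "klinear V W f" and bij: "bij_betw f (carr V) (carr W)"
  shows "graded_space W (\<lambda>n. f ` Vn n)"
proof -
  interpret V: vect_space V by fact
  interpret W: vect_space W by fact
  let ?g = "inv_into (carr V) f"
  note g = klinear_inv_into[OF V f bij]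
  note sub = graded_space_subset[OF gr]
  have fg: "f (?g y) = y" if "y \<in> carr W" for y using that bij by (auto simp: bij_betw_def f_inv_into_f)
  have gf: "?g (f x) = x" if "x \<in> carr V" for x using that bij by (simp add: bij_betw_def)
  have cl: "f x \<in> carr W" if "x \<in> Vn n" for x n using klinear_closed[OF f sub[OF that]] .
  have "klinear (V\<lparr>carr := Vn n\<rparr>) W f" for n
    by (rule klinear_restrict[OF f]) (use sub in auto)
  then have "W.subspace (f ` Vn n)" for n
    using klinear_image_subspace[OF graded_space_vect_space[OF V gr, of n] W, of f] by simp
  moreover have "\<exists>!h. decomposes (\<lambda>n. f ` Vn n) y h" if y: "y \<in> carr W" for y
  proof (rule ex1I)
    let ?x = "?g y"
    have x: "?x \<in> carr V" using klinear_closed[OF g y] .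
    let ?c = "\<lambda>n. component Vn n ?x"
    have c: "?c n \<in> Vn n" for n using component_mem[OF gr x] .
    have "{n. f (?c n) \<noteq> 0} \<subseteq> {n. ?c n \<noteq> 0}" using klinear_zero[OF V f] by auto
    moreover have "y = (\<Sum>n | ?c n \<noteq> 0. f (?c n))"
      using component_sum_eq[OF gr x finite_component[OF gr x] order_refl] fg[OF y]
        klinear_sum[OF V f, of "{n. ?c n \<noteq> 0}" ?c] sub[OF c] by simp
    ultimately show "decomposes (\<lambda>n. f ` Vn n) y (\<lambda>n. f (?c n))"
      using c by (intro decomposesI[OF _ finite_component[OF gr x]]) auto
    fix h assume h: "decomposes (\<lambda>n. f ` Vn n) y h"
    have hm: "h n \<in> f ` Vn n" for n using h by (simp add: decomposes_def)
    have hW: "h n \<in> carr W" for n using hm[of n] cl by auto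
    have gm: "?g (h n) \<in> Vn n" for n using hm[of n] gf sub by auto
    have nz: "{n. ?g (h n) \<noteq> 0} \<subseteq> {n. h n \<noteq> 0}" using klinear_zero[OF W g] by auto
    have fin: "finite {n. h n \<noteq> 0}" using h by (simp add: decomposes_def)
    have "y = (\<Sum>n | h n \<noteq> 0. h n)" using h by (simp add: decomposes_def)
    then have "?x = (\<Sum>n | h n \<noteq> 0. ?g (h n))"
      using klinear_sum[OF W g, of "{n. h n \<noteq> 0}" h] hW by simp
    then have "decomposes Vn ?x (\<lambda>n. ?g (h n))"
      using gm by (intro decomposesI[OF _ fin nz])
    then have "?c n = ?g (h n)" for n by (rule component_unique[OF gr x])
    then show "h = (\<lambda>n. f (?c n))" using fg[OF hW] by auto
  qed
  ultimately show ?thesis using cl by (auto simp: graded_space_def)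
qed

section \<open>Finitely supported functions\<close>

lemma lookup_pm_scale [simp]: "Poly_Mapping.lookup (pm_scale c x) g = c * Poly_Mapping.lookup x g"
  by (simp add: pm_scale_def map.rep_eq when_def)

lemma vector_space_pm_scale: "vector_space pm_scale"
  by unfold_locales (auto intro!: poly_mapping_eqI simp: lookup_add algebra_simps)

lemma keys_pm_scale: "Poly_Mapping.keys (pm_scale c x) \<subseteq> Poly_Mapping.keys x"
  by (auto simp: in_keys_iff)

lemma pm_scale_single: "pm_scale c (Poly_Mapping.single g a) = Poly_Mapping.single g (c * a)"
  by (rule poly_mapping_eqI) (simp add: lookup_single when_def)

text \<open>Records the carrier and the scaling only, so that the same lemmas serve the group
  algebra, the twisted group algebra and its push-forward, whatever their products and coactions
  are.\<close>

definition finsupp_on :: "('k::field, 'g \<Rightarrow>\<^sub>0 'k, 'x) vect_scheme \<Rightarrow> 'g set \<Rightarrow> bool" where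
  "finsupp_on E F \<longleftrightarrow> carr E = {x. Poly_Mapping.keys x \<subseteq> F} \<and> scl E = pm_scale"

lemma vect_space_finsupp_on:
  assumes "finsupp_on E F"
  shows "vect_space E"
proof -
  interpret P: vector_space "pm_scale :: 'a \<Rightarrow> ('b \<Rightarrow>\<^sub>0 'a) \<Rightarrow> _" by (rule vector_space_pm_scale)
  have "P.subspace {x. Poly_Mapping.keys x \<subseteq> F}"
    unfolding P.subspace_def using keys_pm_scale Poly_Mapping.keys_add by (fastforce simp: subset_iff)
  then show ?thesis
    using assms by (intro vect_space.intro vect_space_axioms.intro)
      (simp_all add: finsupp_on_def P.vector_space_axioms)
qed

lemma single_in_finsupp_on: "finsupp_on E F \<Longrightarrow> g \<in> F \<Longrightarrow> Poly_Mapping.single g a \<in> carr E"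
  by (auto simp: finsupp_on_def split: if_splits)

lemma klinear_lookup: "finsupp_on E F \<Longrightarrow> klinear E field_alg (\<lambda>x. Poly_Mapping.lookup x g)"
  by (rule klinearI) (auto simp: finsupp_on_def lookup_add)

lemma finsupp_expand:
  assumes "finite A" "Poly_Mapping.keys x \<subseteq> A"
  shows "x = (\<Sum>g\<in>A. pm_scale (Poly_Mapping.lookup x g) (Poly_Mapping.single g 1))"
proof (rule poly_mapping_eqI)
  fix k
  have "(\<Sum>g\<in>A. Poly_Mapping.lookup (pm_scale (Poly_Mapping.lookup x g) (Poly_Mapping.single g 1)) k)
      = (\<Sum>g\<in>A. if g = k then Poly_Mapping.lookup x k else 0)"
    by (intro sum.cong) (auto simp: lookup_single when_def)
  also have "\<dots> = Poly_Mapping.lookup x k"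
    using assms by (auto simp: in_keys_iff subset_iff)
  finally show "Poly_Mapping.lookup x k =
      Poly_Mapping.lookup (\<Sum>g\<in>A. pm_scale (Poly_Mapping.lookup x g) (Poly_Mapping.single g 1)) k"
    by (simp add: lookup_sum)
qed

definition lin_ext :: "('k::field, 'u::ab_group_add, 'x) vect_scheme \<Rightarrow> ('g \<Rightarrow> 'u) \<Rightarrow> ('g \<Rightarrow>\<^sub>0 'k) \<Rightarrow> 'u" where
  "lin_ext U c x = (\<Sum>g\<in>Poly_Mapping.keys x. scl U (Poly_Mapping.lookup x g) (c g))"

lemma lin_ext_superset:
  assumes "vect_space U" "finite A" "Poly_Mapping.keys x \<subseteq> A"
  shows "lin_ext U c x = (\<Sum>g\<in>A. scl U (Poly_Mapping.lookup x g) (c g))"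
proof -
  interpret U: vect_space U by fact
  show ?thesis
    unfolding lin_ext_def using assms(2,3)
    by (intro sum.mono_neutral_left) (auto simp: in_keys_iff)
qed

lemma lin_ext_single: "vect_space U \<Longrightarrow> lin_ext U c (Poly_Mapping.single g a) = scl U a (c g)"
  by (subst lin_ext_superset[of U "{g}"]) auto

lemma klinear_lin_ext:
  assumes U: "vect_space U" and E: "finsupp_on E F" and c: "\<And>g. g \<in> F \<Longrightarrow> c g \<in> carr U"
  shows "klinear E U (lin_ext U c)"
proof (rule klinearI)
  interpret U: vect_space U by fact
  fix x y a assume x: "x \<in> carr E"
  show "lin_ext U c x \<in> carr U"
    using x E c unfolding lin_ext_def by (auto simp: finsupp_on_def intro!: U.carr_sum U.carr_scale)
  show "lin_ext U c (scl E a x) = scl U a (lin_ext U c x)"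
    using E keys_pm_scale[of a x]
    by (simp add: lin_ext_superset[OF U, of "Poly_Mapping.keys x"] finsupp_on_def U.scale_sum_right)
  assume "y \<in> carr E"
  have "lin_ext U c z = (\<Sum>g\<in>Poly_Mapping.keys x \<union> Poly_Mapping.keys y. scl U (Poly_Mapping.lookup z g) (c g))"
    if "z \<in> {x, y, x + y}" for z
    using that Poly_Mapping.keys_add[of x y] by (intro lin_ext_superset[OF U]) auto
  then show "lin_ext U c (x + y) = lin_ext U c x + lin_ext U c y"
    by (simp add: lookup_add U.scale_left_distrib sum.distrib)
qed

text \<open>The defining double sum runs over supports that vary with \<open>x\<close> and
  \<open>y\<close>; as an iterated linear extension its bilinearity becomes visible.\<close>

lemma twisted_mul_lin_ext:
  assumes "finsupp_on E F"
  shows "twisted_mul G \<psi> x y = lin_ext E (\<lambda>g. lin_ext E (\<lambda>h. Poly_Mapping.single (g \<otimes>\<^bsub>G\<^esub> h) (\<psi> g h)) y) x"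
proof -
  interpret vect_space E using vect_space_finsupp_on[OF assms] .
  have "scl E = pm_scale" using assms by (simp add: finsupp_on_def)
  then show ?thesis
    unfolding twisted_mul_def lin_ext_def scale_sum_right by (simp add: pm_scale_single mult_ac)
qed

lemma kbilinear_twisted_mul:
  assumes E: "finsupp_on E F" and F: "\<And>g h. g \<in> F \<Longrightarrow> h \<in> F \<Longrightarrow> g \<otimes>\<^bsub>G\<^esub> h \<in> F"
  shows "kbilinear E E E (twisted_mul G \<psi>)"
proof (rule kbilinearI)
  note V = vect_space_finsupp_on[OF E]
  interpret vect_space E by (rule V)
  have sg: "Poly_Mapping.single (g \<otimes>\<^bsub>G\<^esub> h) (\<psi> g h) \<in> carr E" if "g \<in> F" "h \<in> F" for g h
    using single_in_finsupp_on[OF E F[OF that]] .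
  have inner: "klinear E E (lin_ext E (\<lambda>h. Poly_Mapping.single (g \<otimes>\<^bsub>G\<^esub> h) (\<psi> g h)))" if "g \<in> F" for g
    using sg[OF that] by (rule klinear_lin_ext[OF V E])
  show "klinear E E (twisted_mul G \<psi> x)" if "x \<in> carr E" for x
    unfolding twisted_mul_lin_ext[OF E] lin_ext_def[of E _ x]
    using that E by (intro klinear_sum_fun[OF V] klinear_scale_const[OF V] inner) (auto simp: finsupp_on_def)
  show "klinear E E (\<lambda>x. twisted_mul G \<psi> x y)" if "y \<in> carr E" for y
    unfolding twisted_mul_lin_ext[OF E]
    using klinear_closed[OF inner that] by (rule klinear_lin_ext[OF V E])
qed

lemma twisted_mul_single:
  "twisted_mul G \<psi> (Poly_Mapping.single g a) (Poly_Mapping.single h b)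
    = Poly_Mapping.single (g \<otimes>\<^bsub>G\<^esub> h) (a * b * \<psi> g h)"
  by (simp add: twisted_mul_def)

lemma grouplike_coact_lin_ext:
  assumes "finsupp_on E F" "finsupp_on E' F'"
  shows "grouplike_coact = lin_ext (tensor_space E E')
    (\<lambda>g. tens E E' (Poly_Mapping.single g 1) (Poly_Mapping.single g 1))"
proof -
  have "tens \<lparr>carr = UNIV, scl = pm_scale\<rparr> \<lparr>carr = UNIV, scl = pm_scale\<rparr> = tens E E'"
    using assms by (intro tens_cong) (simp_all add: finsupp_on_def)
  then show ?thesis
    by (intro ext) (simp add: grouplike_coact_def lin_ext_def Let_def)
qed

section \<open>Graded Hopf algebras with group algebra in degree zero\<close>

locale graded_hopf_group = group G
  for G :: "('g, 'm) monoid_scheme" (structure) +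
  fixes H :: "('k::field, 'h::ab_group_add) hopf" and Hn :: "nat \<Rightarrow> 'h set"
    and \<phi> :: "('g \<Rightarrow>\<^sub>0 'k) \<Rightarrow> 'h"
  assumes graded_hopf: "graded_hopf_algebra H Hn"
    and iso: "hopf_iso (group_hopf G) (degree_zero H Hn) \<phi>"
begin

abbreviation H0 where "H0 \<equiv> degree_zero H Hn"
abbreviation KG :: "('k, 'g \<Rightarrow>\<^sub>0 'k) hopf" where "KG \<equiv> group_hopf G"

text \<open>The element [g] of the overview.\<close>

definition \<gamma> where "\<gamma> g = \<phi> (Poly_Mapping.single g 1)"

lemma hopf: "hopf_algebra H" and gralg: "graded_algebra H Hn"
  using graded_hopf by (simp_all add: graded_hopf_algebra_def)

lemma alg: "k_algebra H" and grs: "graded_space H Hn"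
  using hopf gralg by (simp_all add: hopf_algebra_def graded_algebra_def)

lemma VH: "vect_space H"
  using alg by (simp add: k_algebra_def)

lemma H0_simps [simp]: "carr H0 = Hn 0" "scl H0 = scl H" "mul H0 = mul H" "unity H0 = unity H"
    "comul H0 = comul H" "counit H0 = counit H" "antipode H0 = antipode H"
  by (simp_all add: degree_zero_def)

lemma VH0: "vect_space H0"
  using graded_space_vect_space[OF VH grs, of 0] by (simp add: degree_zero_def)

lemma H0_sub: "h \<in> Hn 0 \<Longrightarrow> h \<in> carr H"
  using graded_space_subset[OF grs] .

lemma unity_H0: "unity H \<in> Hn 0"
  and mul_H0_right: "x \<in> Hn n \<Longrightarrow> y \<in> Hn 0 \<Longrightarrow> mul H x y \<in> Hn n"
  using gralg by (simp_all add: graded_algebra_def) (metis add_0_right)+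

lemma unity_H: "unity H \<in> carr H"
  using unity_H0 by (rule H0_sub)

lemma KG: "finsupp_on KG (carrier G)"
  by (simp add: finsupp_on_def group_hopf_def)

lemmas VKG = vect_space_finsupp_on[OF KG]

lemma \<phi>_hom: "alg_hom KG H0 \<phi>" and \<phi>_bij: "bij_betw \<phi> (carr KG) (Hn 0)"
  using iso by (simp_all add: hopf_iso_def)

lemmas \<phi>_lin = alg_hom_klinear[OF \<phi>_hom]

lemma single_KG: "g \<in> carrier G \<Longrightarrow> Poly_Mapping.single g a \<in> carr KG"
  by (rule single_in_finsupp_on[OF KG])

lemma \<gamma>_H0: "g \<in> carrier G \<Longrightarrow> \<gamma> g \<in> Hn 0"
  unfolding \<gamma>_def using klinear_closed[OF \<phi>_lin single_KG] by simp

lemma \<gamma>_H: "g \<in> carrier G \<Longrightarrow> \<gamma> g \<in> carr H"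
  using \<gamma>_H0 H0_sub by blast

lemma \<gamma>_mult: "g \<in> carrier G \<Longrightarrow> h \<in> carrier G \<Longrightarrow> mul H (\<gamma> g) (\<gamma> h) = \<gamma> (g \<otimes> h)"
  using alg_hom_mul[OF \<phi>_hom single_KG single_KG, of g h 1 1]
  by (simp add: \<gamma>_def group_hopf_def twisted_mul_single)

lemma \<gamma>_one: "\<gamma> \<one> = unity H"
  using alg_hom_unity[OF \<phi>_hom] by (simp add: \<gamma>_def group_hopf_def)

lemma mul_one [simp]: "x \<in> carr H \<Longrightarrow> mul H x (unity H) = x" "x \<in> carr H \<Longrightarrow> mul H (unity H) x = x"
  using k_algebra.mul_unity_right[OF alg] k_algebra.mul_unity_left[OF alg] by auto

lemmas H_assoc = k_algebra.mul_assoc[OF alg]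
lemmas H_mul = mul_closed[OF alg]

lemma \<gamma>_cancel:
  assumes "g \<in> carrier G" "x \<in> carr H"
  shows "mul H (mul H x (\<gamma> g)) (\<gamma> (inv g)) = x" "mul H (mul H x (\<gamma> (inv g))) (\<gamma> g) = x"
  using assms by (simp_all add: H_assoc \<gamma>_H \<gamma>_mult \<gamma>_one)

lemma comul_\<gamma>:
  assumes g: "g \<in> carrier G"
  shows "comul H (\<gamma> g) = tens H H (\<gamma> g) (\<gamma> g)"
proof -
  have tt: "tens H0 H0 = tens H H" by (rule tens_cong) simp_all
  have "comul KG (Poly_Mapping.single g 1) = tens KG KG (Poly_Mapping.single g 1) (Poly_Mapping.single g 1)"
  proof -
    have "comul KG = grouplike_coact" by (simp add: group_hopf_def)
    then show ?thesis
      by (simp add: grouplike_coact_lin_ext[OF KG KG] lin_ext_single[OF vect_space_tensor] tscale_def)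
  qed
  moreover have "kbilinear KG KG (tensor_space H0 H0) (\<lambda>x y. tens H0 H0 (\<phi> x) (\<phi> y))"
    using kbilinear_tens[OF VH0 VH0] \<phi>_lin klinear_closed[OF \<phi>_lin]
    by (intro kbilinearI) (auto intro: kbilinear_left kbilinear_right)
  ultimately show ?thesis
    using iso sweedler_tens[OF VKG VKG vect_space_tensor, of H0 H0 "\<lambda>x y. tens H0 H0 (\<phi> x) (\<phi> y)"]
      single_KG[OF g]
    by (simp add: hopf_iso_def \<gamma>_def tt)
qed

lemma counit_\<gamma>:
  assumes g: "g \<in> carrier G"
  shows "counit H (\<gamma> g) = 1"
  using iso single_KG[OF g, of 1] by (auto simp: hopf_iso_def \<gamma>_def group_hopf_def)

lemma antipode_lin: "klinear H H (antipode H)"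
  using hopf by (rule hopf_algebra.antipode_linear)

text \<open>\<open>hopf_iso\<close> does not mention the antipode. For a group-like element the
  antipode axiom says that its antipode is a left inverse, and cancelling \<open>\<gamma> g\<close>
  on the right identifies it.\<close>

lemma antipode_\<gamma>:
  assumes g: "g \<in> carrier G"
  shows "antipode H (\<gamma> g) = \<gamma> (inv g)"
proof -
  let ?S = "antipode H (\<gamma> g)"
  have S: "?S \<in> carr H" using klinear_closed[OF antipode_lin \<gamma>_H[OF g]] .
  have b: "kbilinear H H H (\<lambda>a b. mul H (antipode H a) b)"
    by (intro kbilinearI klinear_mul_left[OF alg] klinear_mul_right[OF alg] klinear_ident antipode_lin
        klinear_closed[OF antipode_lin])
  interpret H: vect_space H by (rule VH)
  have "mul H ?S (\<gamma> g) = unity H"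
    using hopf_algebra.antipode_left[OF hopf \<gamma>_H[OF g]] sweedler_tens[OF VH VH VH b \<gamma>_H[OF g] \<gamma>_H[OF g]]
    by (simp add: comul_\<gamma>[OF g] counit_\<gamma>[OF g])
  then have "mul H (mul H ?S (\<gamma> g)) (\<gamma> (inv g)) = \<gamma> (inv g)" using g by (simp add: \<gamma>_H)
  then show ?thesis using \<gamma>_cancel(1)[OF g S] by simp
qed

text \<open>The functionals dual to the basis \<open>\<gamma>\<close> of H(0); they are meaningful
  on H(0) only.\<close>

definition \<xi> where "\<xi> g h = Poly_Mapping.lookup (inv_into (carr KG) \<phi> h) g"

lemma \<xi>_lin: "klinear H0 field_alg (\<xi> g)"
  unfolding \<xi>_def
  by (rule klinear_compose[OF klinear_inv_into[OF VKG \<phi>_lin] klinear_lookup[OF KG]]) (simp add: \<phi>_bij)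

lemma \<xi>_\<gamma>: "h \<in> carrier G \<Longrightarrow> \<xi> g (\<gamma> h) = (if g = h then 1 else 0)"
  using bij_betw_imp_inj_on[OF \<phi>_bij] single_KG[of h 1]
  by (simp add: \<xi>_def \<gamma>_def lookup_single when_def)

text \<open>The expansion is offered over every sufficiently large finite \<open>B\<close>, so that
  several elements can be expanded over one common index set.\<close>

lemma H0_expand:
  assumes h: "h \<in> Hn 0"
  obtains A where "finite A" "A \<subseteq> carrier G" "\<And>B. finite B \<Longrightarrow> A \<subseteq> B \<Longrightarrow> B \<subseteq> carrier G \<Longrightarrow> h = (\<Sum>g\<in>B. scl H (\<xi> g h) (\<gamma> g))"
proof -
  let ?x = "inv_into (carr KG) \<phi> h"
  have x: "?x \<in> carr KG" "\<phi> ?x = h"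
    using h \<phi>_bij by (auto simp: bij_betw_def inv_into_into f_inv_into_f)
  have "h = (\<Sum>g\<in>B. scl H (\<xi> g h) (\<gamma> g))"
    if B: "finite B" "Poly_Mapping.keys ?x \<subseteq> B" "B \<subseteq> carrier G" for B
  proof -
    have "h = \<phi> (\<Sum>g\<in>B. pm_scale (\<xi> g h) (Poly_Mapping.single g 1))"
      using finsupp_expand[OF B(1,2)] x(2) by (simp add: \<xi>_def)
    also have "\<dots> = (\<Sum>g\<in>B. \<phi> (pm_scale (\<xi> g h) (Poly_Mapping.single g 1)))"
      using B(3) by (intro klinear_sum[OF VKG \<phi>_lin]) (auto simp: pm_scale_single single_KG)
    also have "\<dots> = (\<Sum>g\<in>B. scl H (\<xi> g h) (\<gamma> g))"
      using B(3) klinear_scale[OF \<phi>_lin single_KG] KG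
      by (intro sum.cong) (auto simp: finsupp_on_def \<gamma>_def)
    finally show ?thesis .
  qed
  moreover have "Poly_Mapping.keys ?x \<subseteq> carrier G" using x(1) KG by (simp add: finsupp_on_def)
  ultimately show thesis using that[of "Poly_Mapping.keys ?x"] by simp
qed

lemma comul_lin: "klinear H (tensor_space H H) (comul H)"
  using alg_hom_klinear[OF hopf_algebra.comul_alg_hom[OF hopf]] by (simp add: klinear_def tensor_alg_def)

text \<open>In total degree zero both legs have degree zero, so H(0) is closed under the
  coproduct.\<close>

lemma comul_H0: "klinear H0 (tensor_space H0 H0) (comul H)"
proof -
  have "comul H h \<in> carr (tensor_space H0 H0)" if "h \<in> Hn 0" for h
  proof -
    have "comul H h \<in> tensor_grading H Hn H Hn 0"
      using graded_hopf that by (simp add: graded_hopf_algebra_def)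
    moreover have "tens H0 H0 = tens H H" by (rule tens_cong) simp_all
    ultimately show ?thesis by (simp add: tensor_grading_def tensor_space_def)
  qed
  then show ?thesis using klinear_restrict[OF comul_lin, of H0] H0_sub by (auto simp: klinear_def)
qed

lemma comp_lin: "klinear H H (component Hn 0)"
  by (rule klinear_weaken[OF klinear_component[OF VH grs]]) (auto intro: H0_sub)

lemma comp_H0: "h \<in> Hn 0 \<Longrightarrow> component Hn 0 h = h"
  by (simp add: component_homogeneous[OF VH grs])

text \<open>This is (id \<otimes> \<pi>)\<Delta>. The coinvariants are the equalizer of it and the
  linear map r \<mapsto> r \<otimes> 1, hence a subspace, as \<open>VR\<close> records.\<close>

definition coinv_map where
  "coinv_map r = sweedler H H (comul H r) (\<lambda>a b. tens H H a (component Hn 0 b))"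

lemma coinv_bilinear: "kbilinear H H (tensor_space H H) (\<lambda>a b. tens H H a (component Hn 0 b))"
  using klinear_closed[OF comp_lin] comp_lin
  by (intro kbilinearI kbilinear_left[OF kbilinear_tens[OF VH VH]] kbilinear_right[OF kbilinear_tens[OF VH VH]] klinear_ident) auto

lemma coinv_map_lin: "klinear H (tensor_space H H) coinv_map"
  unfolding coinv_map_def
  by (rule klinear_sweedler_arg[OF VH VH vect_space_tensor coinv_bilinear comul_lin])

abbreviation R where "R \<equiv> H\<lparr>carr := Hcoinv H Hn\<rparr>"

lemma Hcoinv_iff: "r \<in> Hcoinv H Hn \<longleftrightarrow> r \<in> carr H \<and> coinv_map r = tens H H r (unity H)"
  by (simp add: Hcoinv_def coinv_map_def)

lemma VR: "vect_space R"
proof -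
  interpret H: vect_space H by (rule VH)
  have "H.subspace (Hcoinv H Hn)"
    unfolding H.subspace_def
    using klinear_zero[OF VH coinv_map_lin] klinear_add[OF coinv_map_lin] klinear_scale[OF coinv_map_lin]
    by (auto simp: Hcoinv_iff H.carr_zero H.carr_add H.carr_scale tens_zero_left tens_add_left tens_scale_left)
  then show ?thesis by (rule H.vect_space_subspace)
qed

end

section \<open>The smash product with a twisted group algebra\<close>

locale graded_smash = graded_hopf_group G H Hn \<phi>
  for G :: "('g, 'm) monoid_scheme" (structure)
    and H :: "('k::field, 'h::ab_group_add) hopf" and Hn :: "nat \<Rightarrow> 'h set"
    and \<phi> :: "('g \<Rightarrow>\<^sub>0 'k) \<Rightarrow> 'h" +
  fixes F :: "'g set" and \<psi> :: "'g \<Rightarrow> 'g \<Rightarrow> 'k"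
  assumes subgroup_F: "subgroup F G"
begin

abbreviation E where "E \<equiv> push_coact KG H0 \<phi> (twisted_group_algebra G F \<psi>)"
abbreviation M where "M \<equiv> smash H Hn E"

lemma F_G: "g \<in> F \<Longrightarrow> g \<in> carrier G"
  and F_mult: "g \<in> F \<Longrightarrow> h \<in> F \<Longrightarrow> g \<otimes> h \<in> F"
  and F_one: "\<one> \<in> F"
  using subgroup_F by (auto simp: subgroup_def)

lemma E_simps [simp]: "scl E = pm_scale" "mul E = twisted_mul G \<psi>"
    "unity E = Poly_Mapping.single \<one> 1" "carr E = {x. Poly_Mapping.keys x \<subseteq> F}"
  by (simp_all add: push_coact_def twisted_group_algebra_def)

lemma E: "finsupp_on E F"
  by (simp add: finsupp_on_def)

lemmas VE = vect_space_finsupp_on[OF E]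
lemmas mul_E = kbilinear_twisted_mul[OF E F_mult, where \<psi> = \<psi>]
lemmas single_E = single_in_finsupp_on[OF E]

abbreviation K where "K \<equiv> twisted_group_algebra G F \<psi>"

lemma twisted: "finsupp_on K F"
  by (simp add: finsupp_on_def twisted_group_algebra_def)

lemmas VK = vect_space_finsupp_on[OF twisted]

lemma coact_E: "coact E e = sweedler KG K (grouplike_coact e) (\<lambda>x e0. tens H0 E (\<phi> x) e0)"
proof -
  have "tens H0 K = tens H0 E"
    using twisted E by (intro tens_cong) (simp_all add: finsupp_on_def)
  moreover have "coact K = grouplike_coact" by (simp add: twisted_group_algebra_def)
  ultimately show ?thesis by (simp add: push_coact_def)
qed

lemma push_bilinear: "kbilinear KG K (tensor_space H0 E) (\<lambda>x e0. tens H0 E (\<phi> x) e0)"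
proof -
  have "klinear K E (\<lambda>x. x)" using twisted E by (simp add: klinear_def finsupp_on_def)
  moreover have "x \<in> carr E" if "x \<in> carr K" for x
    using that twisted E by (simp add: finsupp_on_def)
  ultimately show ?thesis
    by (intro kbilinearI kbilinear_left[OF kbilinear_tens[OF VH0 VE]] klinear_closed[OF \<phi>_lin]
        kbilinear_right[OF kbilinear_tens[OF VH0 VE]] \<phi>_lin)
qed

lemma coact_E_lin: "klinear E (tensor_space H0 E) (coact E)"
proof -
  have "klinear E (tensor_space KG K) grouplike_coact"
    unfolding grouplike_coact_lin_ext[OF KG twisted]
    by (rule klinear_lin_ext[OF vect_space_tensor E])
      (auto intro!: tens_closed single_KG single_in_finsupp_on[OF twisted] F_G)
  then show ?thesis
    unfolding coact_E by (rule klinear_sweedler_arg[OF VKG VK vect_space_tensor push_bilinear])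
qed

lemma coact_E_single:
  assumes g: "g \<in> F"
  shows "coact E (Poly_Mapping.single g 1) = tens H0 E (\<gamma> g) (Poly_Mapping.single g 1)"
proof -
  have "grouplike_coact (Poly_Mapping.single g (1::'k)) = tens KG K (Poly_Mapping.single g 1) (Poly_Mapping.single g 1)"
    by (simp add: grouplike_coact_lin_ext[OF KG twisted] lin_ext_single[OF vect_space_tensor] tscale_def)
  then show ?thesis
    using sweedler_tens[OF VKG VK vect_space_tensor push_bilinear
        single_KG[OF F_G[OF g]] single_in_finsupp_on[OF twisted g], of 1 1]
    by (simp only: coact_E \<gamma>_def)
qed

section \<open>Multiplication of the smash product on pure tensors\<close>

lemma M_simps [simp]: "carr M = carr (tensor_space R E)" "scl M = tscale"
    "unity M = tens H E (unity H) (Poly_Mapping.single \<one> 1)"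
  by (simp_all add: smash_def Let_def)

lemma tens_R [simp]: "tens R E = tens H E"
  by (rule tens_cong) simp_all

lemma tens_H0 [simp]: "tens H0 E = tens H E" "tens H0 H0 = tens H H"
  by (rule tens_cong; simp)+

lemma R_H: "a \<in> carr R \<Longrightarrow> a \<in> carr H"
  by (simp add: Hcoinv_iff)

lemma H0_H: "x \<in> carr H0 \<Longrightarrow> x \<in> carr H"
  by (simp add: H0_sub)

lemma lin_R_H: "klinear R H (\<lambda>x. x)" and lin_H0_H: "klinear H0 H (\<lambda>x. x)"
  by (auto simp: klinear_def R_H H0_sub Hcoinv_iff)

text \<open>The product in \<open>smash\<close> nests four Sweedler sums. Its layers are named from
  the inside out, and each is shown linear in every variable that is still free, since the next
  \<open>sweedler\<close> can be evaluated only at a bilinear map.\<close>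

abbreviation smash_term where
  "smash_term a b l0 m x1 x2 \<equiv>
    tens H E (mul H (mul H (mul H a x1) b) (antipode H x2)) (mul E l0 m)"

abbreviation smash_inner where
  "smash_inner a b l0 m x \<equiv> sweedler H0 H0 (comul H x) (smash_term a b l0 m)"

abbreviation smash_outer where
  "smash_outer a l b m \<equiv> sweedler H0 E (coact E l) (\<lambda>x l0. smash_inner a b l0 m x)"

lemma M_mul: "mul M s t = sweedler R E s (\<lambda>a l. sweedler R E t (smash_outer a l))"
  by (simp add: smash_def Let_def)

lemmas klin_rules = kbilinear_left[OF kbilinear_tens[OF VH VE]] kbilinear_right[OF kbilinear_tens[OF VH VE]]
  kbilinear_left[OF mul_E] kbilinear_right[OF mul_E]
  klinear_mul_left[OF alg] klinear_mul_right[OF alg] klinear_compose[OF _ antipode_lin]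
  lin_R_H lin_H0_H klinear_ident
  H_mul kbilinear_closed[OF mul_E] klinear_closed[OF antipode_lin]

lemma smash_term_lin:
  shows "\<lbrakk>b \<in> carr R; l0 \<in> carr E; m \<in> carr E; x1 \<in> carr H0; x2 \<in> carr H0\<rbrakk>
    \<Longrightarrow> klinear R (tensor_space H E) (\<lambda>a. smash_term a b l0 m x1 x2)"
  and "\<lbrakk>a \<in> carr R; l0 \<in> carr E; m \<in> carr E; x1 \<in> carr H0; x2 \<in> carr H0\<rbrakk>
    \<Longrightarrow> klinear R (tensor_space H E) (\<lambda>b. smash_term a b l0 m x1 x2)"
  and "\<lbrakk>a \<in> carr R; b \<in> carr R; m \<in> carr E; x1 \<in> carr H0; x2 \<in> carr H0\<rbrakk>
    \<Longrightarrow> klinear E (tensor_space H E) (\<lambda>l0. smash_term a b l0 m x1 x2)"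
  and "\<lbrakk>a \<in> carr R; b \<in> carr R; l0 \<in> carr E; x1 \<in> carr H0; x2 \<in> carr H0\<rbrakk>
    \<Longrightarrow> klinear E (tensor_space H E) (\<lambda>m. smash_term a b l0 m x1 x2)"
  and "\<lbrakk>a \<in> carr R; b \<in> carr R; l0 \<in> carr E; m \<in> carr E; x2 \<in> carr H0\<rbrakk>
    \<Longrightarrow> klinear H0 (tensor_space H E) (\<lambda>x1. smash_term a b l0 m x1 x2)"
  and "\<lbrakk>a \<in> carr R; b \<in> carr R; l0 \<in> carr E; m \<in> carr E; x1 \<in> carr H0\<rbrakk>
    \<Longrightarrow> klinear H0 (tensor_space H E) (\<lambda>x2. smash_term a b l0 m x1 x2)"
  unfolding E_simps(2)
  by (intro klin_rules; (assumption | rule R_H H0_H; assumption))+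

lemma smash_term_bilinear:
  "\<lbrakk>a \<in> carr R; b \<in> carr R; l0 \<in> carr E; m \<in> carr E\<rbrakk>
    \<Longrightarrow> kbilinear H0 H0 (tensor_space H E) (smash_term a b l0 m)"
  by (intro kbilinearI smash_term_lin)

lemma smash_inner_lin:
  shows "\<lbrakk>b \<in> carr R; l0 \<in> carr E; m \<in> carr E; x \<in> carr H0\<rbrakk>
    \<Longrightarrow> klinear R (tensor_space H E) (\<lambda>a. smash_inner a b l0 m x)"
  and "\<lbrakk>a \<in> carr R; l0 \<in> carr E; m \<in> carr E; x \<in> carr H0\<rbrakk>
    \<Longrightarrow> klinear R (tensor_space H E) (\<lambda>b. smash_inner a b l0 m x)"
  and "\<lbrakk>a \<in> carr R; b \<in> carr R; m \<in> carr E; x \<in> carr H0\<rbrakk>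
    \<Longrightarrow> klinear E (tensor_space H E) (\<lambda>l0. smash_inner a b l0 m x)"
  and "\<lbrakk>a \<in> carr R; b \<in> carr R; l0 \<in> carr E; x \<in> carr H0\<rbrakk>
    \<Longrightarrow> klinear E (tensor_space H E) (\<lambda>m. smash_inner a b l0 m x)"
  and "\<lbrakk>a \<in> carr R; b \<in> carr R; l0 \<in> carr E; m \<in> carr E\<rbrakk>
    \<Longrightarrow> klinear H0 (tensor_space H E) (\<lambda>x. smash_inner a b l0 m x)"
  by (intro klinear_sweedler_fun[OF VH0 VH0 vect_space_tensor VR klinear_closed[OF comul_H0]]
        klinear_sweedler_fun[OF VH0 VH0 vect_space_tensor VE klinear_closed[OF comul_H0]]
        smash_term_bilinear smash_term_lin; assumption)+
    (intro klinear_sweedler_arg[OF VH0 VH0 vect_space_tensor _ comul_H0] smash_term_bilinear; assumption)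

lemma smash_inner_bilinear:
  "\<lbrakk>a \<in> carr R; b \<in> carr R; m \<in> carr E\<rbrakk>
    \<Longrightarrow> kbilinear H0 E (tensor_space H E) (\<lambda>x l0. smash_inner a b l0 m x)"
  by (intro kbilinearI smash_inner_lin)

lemma smash_outer_lin:
  shows "\<lbrakk>b \<in> carr R; m \<in> carr E; l \<in> carr E\<rbrakk>
    \<Longrightarrow> klinear R (tensor_space H E) (\<lambda>a. smash_outer a l b m)"
  and "\<lbrakk>a \<in> carr R; m \<in> carr E; l \<in> carr E\<rbrakk>
    \<Longrightarrow> klinear R (tensor_space H E) (\<lambda>b. smash_outer a l b m)"
  and "\<lbrakk>a \<in> carr R; b \<in> carr R; l \<in> carr E\<rbrakk>
    \<Longrightarrow> klinear E (tensor_space H E) (\<lambda>m. smash_outer a l b m)"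
  and "\<lbrakk>a \<in> carr R; b \<in> carr R; m \<in> carr E\<rbrakk>
    \<Longrightarrow> klinear E (tensor_space H E) (\<lambda>l. smash_outer a l b m)"
  by (intro klinear_sweedler_fun[OF VH0 VE vect_space_tensor VR klinear_closed[OF coact_E_lin]]
        klinear_sweedler_fun[OF VH0 VE vect_space_tensor VE klinear_closed[OF coact_E_lin]]
        smash_inner_bilinear smash_inner_lin; assumption)+
    (intro klinear_sweedler_arg[OF VH0 VE vect_space_tensor _ coact_E_lin] smash_inner_bilinear; assumption)

lemma smash_outer_bilinear:
  "\<lbrakk>a \<in> carr R; l \<in> carr E\<rbrakk> \<Longrightarrow> kbilinear R E (tensor_space H E) (smash_outer a l)"
  by (intro kbilinearI smash_outer_lin)

lemma M_mul_bilinear_aux: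
  assumes "t \<in> carr (tensor_space R E)"
  shows "kbilinear R E (tensor_space H E) (\<lambda>a l. sweedler R E t (smash_outer a l))"
  by (intro kbilinearI klinear_sweedler_fun[OF VR VE vect_space_tensor _ assms] VR VE
      smash_outer_bilinear smash_outer_lin; assumption)

text \<open>The codomain is the ambient H \<otimes> E, which is all that distributing
  \<open>mul M\<close> over finite sums calls for. That products of embedded elements stay in the
  image comes later from multiplicativity of \<open>embed\<close>.\<close>

lemma M_mul_bilinear: "kbilinear (tensor_space R E) (tensor_space R E) (tensor_space H E) (mul M)"
  unfolding M_mul
proof (rule kbilinearI)
  show "klinear (tensor_space R E) (tensor_space H E) (\<lambda>t. sweedler R E s (\<lambda>a l. sweedler R E t (smash_outer a l)))"
    if "s \<in> carr (tensor_space R E)" for s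
    by (intro klinear_sweedler_fun[OF VR VE vect_space_tensor vect_space_tensor that] M_mul_bilinear_aux
        klinear_sweedler[OF VR VE vect_space_tensor] smash_outer_bilinear)
  show "klinear (tensor_space R E) (tensor_space H E) (\<lambda>s. sweedler R E s (\<lambda>a l. sweedler R E t (smash_outer a l)))"
    if "t \<in> carr (tensor_space R E)" for t
    by (rule klinear_sweedler[OF VR VE vect_space_tensor M_mul_bilinear_aux[OF that]])
qed

text \<open>A group-like \<open>\<gamma> g\<close> has both Sweedler legs equal to itself, so all
  inner sums collapse and the twist becomes conjugation of \<open>b\<close> by
  \<open>\<gamma> g\<close>.\<close>

lemma M_mul_tens:
  assumes a: "a \<in> carr R" and b: "b \<in> carr R" and g: "g \<in> F" and h: "h \<in> F"
  shows "mul M (tens H E a (Poly_Mapping.single g 1)) (tens H E b (Poly_Mapping.single h 1)) =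
    tens H E (mul H (mul H (mul H a (\<gamma> g)) b) (\<gamma> (inv g))) (Poly_Mapping.single (g \<otimes> h) (\<psi> g h))"
proof -
  note sg = single_E[OF g, of 1] and sh = single_E[OF h, of 1]
  have gH: "\<gamma> g \<in> carr H0" using \<gamma>_H0[OF F_G[OF g]] by simp
  have tR: "tens R E b (Poly_Mapping.single h 1) \<in> carr (tensor_space R E)"
    by (rule tens_closed[OF b sh])
  have "mul M (tens R E a (Poly_Mapping.single g 1)) (tens R E b (Poly_Mapping.single h 1)) =
    smash_outer a (Poly_Mapping.single g 1) b (Poly_Mapping.single h 1)"
    unfolding M_mul sweedler_tens[OF VR VE vect_space_tensor M_mul_bilinear_aux[OF tR] a sg]
    by (rule sweedler_tens[OF VR VE vect_space_tensor smash_outer_bilinear[OF a sg] b sh])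
  also have "\<dots> = smash_inner a b (Poly_Mapping.single g 1) (Poly_Mapping.single h 1) (\<gamma> g)"
    unfolding coact_E_single[OF g]
    by (rule sweedler_tens[OF VH0 VE vect_space_tensor smash_inner_bilinear[OF a b sh] gH sg])
  also have "\<dots> = smash_term a b (Poly_Mapping.single g 1) (Poly_Mapping.single h 1) (\<gamma> g) (\<gamma> g)"
    unfolding comul_\<gamma>[OF F_G[OF g]] tens_H0(2)[symmetric]
    by (subst sweedler_tens[OF VH0 VH0 vect_space_tensor smash_term_bilinear[OF a b sg sh] gH gH])
      simp
  finally show ?thesis
    by (simp add: twisted_mul_single antipode_\<gamma>[OF F_G[OF g]])
qed

section \<open>Coaction of the smash product on pure tensors\<close>

abbreviation coact_term where
  "coact_term l0 x a1 a2 \<equiv> tens H (tensor_space H E) (mul H a1 x) (tens H E a2 l0)"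

lemma M_coact: "coact M t = sweedler R E t (\<lambda>a l. sweedler H H (comul H a) (\<lambda>a1 a2.
       sweedler H0 E (coact E l) (\<lambda>x l0. coact_term l0 x a1 a2)))"
  by (simp add: smash_def Let_def)

lemmas klin_rules' = klin_rules kbilinear_left[OF kbilinear_tens[OF VH vect_space_tensor]]
  kbilinear_right[OF kbilinear_tens[OF VH vect_space_tensor]] tens_closed[of _ H _ E]

lemma coact_term_lin:
  shows "\<lbrakk>a2 \<in> carr H; l0 \<in> carr E; x \<in> carr H0\<rbrakk>
    \<Longrightarrow> klinear H (tensor_space H (tensor_space H E)) (\<lambda>a1. coact_term l0 x a1 a2)"
  and "\<lbrakk>a1 \<in> carr H; l0 \<in> carr E; x \<in> carr H0\<rbrakk>
    \<Longrightarrow> klinear H (tensor_space H (tensor_space H E)) (\<lambda>a2. coact_term l0 x a1 a2)"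
  and "\<lbrakk>a1 \<in> carr H; a2 \<in> carr H; x \<in> carr H0\<rbrakk>
    \<Longrightarrow> klinear E (tensor_space H (tensor_space H E)) (\<lambda>l0. coact_term l0 x a1 a2)"
  and "\<lbrakk>a1 \<in> carr H; a2 \<in> carr H; l0 \<in> carr E\<rbrakk>
    \<Longrightarrow> klinear H0 (tensor_space H (tensor_space H E)) (\<lambda>x. coact_term l0 x a1 a2)"
  by (intro klin_rules'; (assumption | rule H0_H; assumption))+

abbreviation coact_inner where
  "coact_inner l a1 a2 \<equiv> sweedler H0 E (coact E l) (\<lambda>x l0. coact_term l0 x a1 a2)"

lemma coact_term_bilinear:
  "\<lbrakk>a1 \<in> carr H; a2 \<in> carr H\<rbrakk>
    \<Longrightarrow> kbilinear H0 E (tensor_space H (tensor_space H E)) (\<lambda>x l0. coact_term l0 x a1 a2)"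
  by (intro kbilinearI coact_term_lin)

lemma coact_inner_lin:
  shows "\<lbrakk>a2 \<in> carr H; l \<in> carr E\<rbrakk>
    \<Longrightarrow> klinear H (tensor_space H (tensor_space H E)) (\<lambda>a1. coact_inner l a1 a2)"
  and "\<lbrakk>a1 \<in> carr H; l \<in> carr E\<rbrakk>
    \<Longrightarrow> klinear H (tensor_space H (tensor_space H E)) (\<lambda>a2. coact_inner l a1 a2)"
  and "\<lbrakk>a1 \<in> carr H; a2 \<in> carr H\<rbrakk>
    \<Longrightarrow> klinear E (tensor_space H (tensor_space H E)) (\<lambda>l. coact_inner l a1 a2)"
  by (intro klinear_sweedler_fun[OF VH0 VE vect_space_tensor VH klinear_closed[OF coact_E_lin]]
        coact_term_bilinear coact_term_lin; assumption)+
    (intro klinear_sweedler_arg[OF VH0 VE vect_space_tensor _ coact_E_lin] coact_term_bilinear; assumption)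

lemma coact_inner_bilinear:
  "l \<in> carr E \<Longrightarrow> kbilinear H H (tensor_space H (tensor_space H E)) (coact_inner l)"
  by (intro kbilinearI coact_inner_lin)

lemma coact_outer_bilinear:
  "kbilinear R E (tensor_space H (tensor_space H E)) (\<lambda>a l. sweedler H H (comul H a) (coact_inner l))"
proof (rule kbilinearI)
  show "klinear E (tensor_space H (tensor_space H E)) (\<lambda>l. sweedler H H (comul H a) (coact_inner l))"
    if "a \<in> carr R" for a
    by (intro klinear_sweedler_fun[OF VH VH vect_space_tensor VE] klinear_closed[OF comul_lin R_H[OF that]]
        coact_inner_bilinear coact_inner_lin)
  show "klinear R (tensor_space H (tensor_space H E)) (\<lambda>a. sweedler H H (comul H a) (coact_inner l))"
    if "l \<in> carr E" for l
    by (intro klinear_sweedler_arg[OF VH VH vect_space_tensor] coact_inner_bilinear that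
        klinear_compose[OF lin_R_H comul_lin])
qed

lemma M_coact_lin: "klinear (tensor_space R E) (tensor_space H (tensor_space H E)) (coact M)"
  unfolding M_coact by (rule klinear_sweedler[OF VR VE vect_space_tensor coact_outer_bilinear])

lemma M_coact_tens:
  assumes a: "a \<in> carr R" and g: "g \<in> F"
  shows "coact M (tens H E a (Poly_Mapping.single g 1)) =
    sweedler H H (comul H a) (\<lambda>a1 a2. coact_term (Poly_Mapping.single g 1) (\<gamma> g) a1 a2)"
proof -
  note sg = single_E[OF g, of 1]
  have gH: "\<gamma> g \<in> carr H0" using \<gamma>_H0[OF F_G[OF g]] by simp
  have "coact M (tens R E a (Poly_Mapping.single g 1)) =
      sweedler H H (comul H a) (coact_inner (Poly_Mapping.single g 1))"
    unfolding M_coact by (rule sweedler_tens[OF VR VE vect_space_tensor coact_outer_bilinear a sg])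
  \<comment> \<open>The inner sum over the coaction of \<open>g\<close> collapses to one term, but
    only for legs in the carrier of \<open>H\<close>, hence the use of
    \<open>sweedler_cong\<close>.\<close>
  also have "\<dots> = sweedler H H (comul H a) (\<lambda>a1 a2. coact_term (Poly_Mapping.single g 1) (\<gamma> g) a1 a2)"
    unfolding coact_E_single[OF g]
    by (rule sweedler_cong[OF VH VH vect_space_tensor coact_inner_bilinear[OF sg, unfolded coact_E_single[OF g]]
          _ klinear_closed[OF comul_lin R_H[OF a]]])
      (rule sweedler_tens[OF VH0 VE vect_space_tensor coact_term_bilinear gH sg])
  finally show ?thesis by simp
qed

end

section \<open>The degree zero part of a right simple comodule algebra\<close>

locale simple_comod = graded_hopf_group G H Hn \<phi>
  for G :: "('g, 'm) monoid_scheme" (structure)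
    and H :: "('k::field, 'h::ab_group_add) hopf" and Hn :: "nat \<Rightarrow> 'h set"
    and \<phi> :: "('g \<Rightarrow>\<^sub>0 'k) \<Rightarrow> 'h" +
  fixes L :: "('k, 'h, 'l::ab_group_add) comod_alg" and Ln :: "nat \<Rightarrow> 'l set"
  assumes graded_comod: "graded_comodule_algebra H Hn L Ln"
    and simple: "right_simple H L"
    and coinv: "coinvariants (degree_zero H Hn) (degree_zero_comod L Ln) = {scl L c (unity L) | c. True}"
begin

abbreviation L0 where "L0 \<equiv> degree_zero_comod L Ln"

lemma comod: "comodule_algebra H L" and gralg_L: "graded_algebra L Ln"
  using graded_comod by (simp_all add: graded_comodule_algebra_def)

lemma alg_L: "k_algebra L" and grs_L: "graded_space L Ln"
  using comod gralg_L by (simp_all add: comodule_algebra_def graded_algebra_def)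

lemma VL: "vect_space L"
  using alg_L by (simp add: k_algebra_def)

lemma L0_simps [simp]: "carr L0 = Ln 0" "scl L0 = scl L" "mul L0 = mul L" "unity L0 = unity L"
    "coact L0 = coact L"
  by (simp_all add: degree_zero_comod_def)

lemma VL0: "vect_space L0"
  using graded_space_vect_space[OF VL grs_L, of 0] by (simp add: degree_zero_comod_def)

lemma L_sub: "l \<in> Ln n \<Longrightarrow> l \<in> carr L"
  using graded_space_subset[OF grs_L] .

lemma L0_mul: "x \<in> Ln 0 \<Longrightarrow> y \<in> Ln 0 \<Longrightarrow> mul L x y \<in> Ln 0"
  and unity_L0: "unity L \<in> Ln 0"
  using gralg_L by (simp_all add: graded_algebra_def) (metis add_0_right)

lemma unity_L: "unity L \<in> carr L"
  using unity_L0 by (rule L_sub)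

lemma mul_one_L [simp]: "x \<in> carr L \<Longrightarrow> mul L x (unity L) = x" "x \<in> carr L \<Longrightarrow> mul L (unity L) x = x"
  using k_algebra.mul_unity_right[OF alg_L] k_algebra.mul_unity_left[OF alg_L] by auto

lemmas L_assoc = k_algebra.mul_assoc[OF alg_L]
lemmas L_mul = mul_closed[OF alg_L]

lemma L_scale_left: "x \<in> carr L \<Longrightarrow> y \<in> carr L \<Longrightarrow> mul L (scl L c x) y = scl L c (mul L x y)"
  and L_scale_right: "x \<in> carr L \<Longrightarrow> y \<in> carr L \<Longrightarrow> mul L x (scl L c y) = scl L c (mul L x y)"
  using k_algebra.mul_bilinear[OF alg_L] by (simp_all add: kbilinear_def klinear_def)

lemma unity_L_nonzero: "unity L \<noteq> 0"
proof
  assume "unity L = 0"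
  then have "x = 0" if "x \<in> carr L" for x
    using mul_one_L(1)[OF that] mul_zero_right[OF alg_L that] by simp
  then have "carr L = {0}" using vect_space.carr_zero[OF VL] by blast
  then show False using simple by (simp add: right_simple_def)
qed

lemma coact_hom: "alg_hom L (tensor_alg H L) (coact L)"
  using comodule_algebra.coact_alg_hom[OF comod] .

lemma coact_lin: "klinear L (tensor_space H L) (coact L)"
  using alg_hom_klinear[OF coact_hom] by (simp add: klinear_def tensor_alg_def)

lemma coact_one: "coact L (unity L) = tens H L (unity H) (unity L)"
  using alg_hom_unity[OF coact_hom] by (simp add: tensor_alg_def)

lemma coact_mul: "x \<in> carr L \<Longrightarrow> y \<in> carr L \<Longrightarrow> coact L (mul L x y) = mul (tensor_alg H L) (coact L x) (coact L y)"
  by (rule alg_hom_mul[OF coact_hom])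

lemma tens_H0L [simp]: "tens H0 L0 = tens H L" "tens H0 L = tens H L"
  by (rule tens_cong; simp)+

lemma coact_L0:
  assumes "l \<in> Ln 0"
  shows "coact L l \<in> carr (tensor_space H0 L0)"
proof -
  have "coact L l \<in> tensor_grading H Hn L Ln 0"
    using graded_comod assms by (simp add: graded_comodule_algebra_def)
  then show ?thesis by (simp add: tensor_grading_def tensor_space_def)
qed

section \<open>The G-grading of L(0) given by its coaction\<close>

definition Lg :: "'g \<Rightarrow> 'l set" where "Lg g = {l \<in> Ln 0. coact L l = tens H L (\<gamma> g) l}"

lemma Lg_L0: "x \<in> Lg g \<Longrightarrow> x \<in> Ln 0"
  and Lg_L: "x \<in> Lg g \<Longrightarrow> x \<in> carr L"
  and Lg_coact: "x \<in> Lg g \<Longrightarrow> coact L x = tens H L (\<gamma> g) x"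
  by (auto simp: Lg_def L_sub)

lemma Lg_zero: "0 \<in> Lg g"
  using klinear_zero[OF VL coact_lin] vect_space.carr_zero[OF VL0] by (simp add: Lg_def tens_zero_right)

lemma Lg_scale: "x \<in> Lg g \<Longrightarrow> scl L c x \<in> Lg g"
  using klinear_scale[OF coact_lin] vect_space.carr_scale[OF VL0]
  by (auto simp: Lg_def tens_scale_right L_sub)

lemma Lg_diff: "x \<in> Lg g \<Longrightarrow> y \<in> Lg g \<Longrightarrow> x - y \<in> Lg g"
  using klinear_diff[OF VL coact_lin] vect_space.carr_diff[OF VL0]
  by (auto simp: Lg_def tens_diff_right L_sub)

lemma Lg_mult:
  assumes g: "g \<in> carrier G" "h \<in> carrier G" and x: "x \<in> Lg g" "y \<in> Lg h"
  shows "mul L x y \<in> Lg (g \<otimes> h)"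
proof -
  have "coact L (mul L x y) = tens H L (\<gamma> (g \<otimes> h)) (mul L x y)"
    using tensor_alg_mul_tens[OF alg alg_L, of "{()}" "\<lambda>_. \<gamma> g" "\<lambda>_. x" "{()}" "\<lambda>_. \<gamma> h" "\<lambda>_. y"] g
    by (simp add: coact_mul Lg_L[OF x(1)] Lg_L[OF x(2)] Lg_coact[OF x(1)] Lg_coact[OF x(2)] \<gamma>_H \<gamma>_mult)
  then show ?thesis using x by (simp add: Lg_def L0_mul)
qed

text \<open>The hypothesis on coinvariants in graded form: since \<open>\<gamma> \<one>\<close> is
  the unit of \<open>H\<close>, the identity component of L(0) consists of the coinvariants.\<close>

lemma Lg_one: "Lg \<one> = {scl L c (unity L) | c. True}"
  unfolding coinv[symmetric] by (auto simp: coinvariants_def Lg_def \<gamma>_one)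

lemma unity_Lg: "unity L \<in> Lg \<one>"
  by (simp add: Lg_def \<gamma>_one coact_one unity_L0)

text \<open>The injective relabelling \<open>e\<close> allows families indexed by h with group
  elements g h, as they arise after multiplication by an element of degree g.\<close>

lemma \<gamma>_family_zero:
  assumes "vect_space W" "finite I" "inj_on e I" "\<And>i. i \<in> I \<Longrightarrow> e i \<in> carrier G"
    and "\<And>i. i \<in> I \<Longrightarrow> y i \<in> carr W" and "(\<Sum>i\<in>I. tens H W (\<gamma> (e i)) (y i)) = 0" and "i \<in> I"
  shows "y i = 0"
proof -
  have "tens H W = tens H0 W" by (rule tens_cong) simp_all
  then show ?thesis
    using assms \<xi>_lin
    by (intro tens_family_zero[OF VH0 assms(1,2), of "\<lambda>i. \<xi> (e i)" "\<lambda>i. \<gamma> (e i)"])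
      (auto simp: \<gamma>_H0 \<xi>_\<gamma> inj_on_def)
qed

text \<open>The coaction tags each summand with its own \<open>\<gamma> (e i)\<close>, and these are
  linearly independent.\<close>

lemma Lg_independent:
  assumes I: "finite I" "inj_on e I" "\<And>i. i \<in> I \<Longrightarrow> e i \<in> carrier G"
    and y: "\<And>i. i \<in> I \<Longrightarrow> y i \<in> Lg (e i)" and zero: "(\<Sum>i\<in>I. y i) = 0" and i: "i \<in> I"
  shows "y i = 0"
proof -
  have "(\<Sum>i\<in>I. tens H L (\<gamma> (e i)) (y i)) = coact L (\<Sum>i\<in>I. y i)"
    using Lg_coact[OF y] klinear_sum[OF VL coact_lin, of I y] Lg_L[OF y] by simp
  then have "(\<Sum>i\<in>I. tens H L (\<gamma> (e i)) (y i)) = 0"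
    by (simp add: zero klinear_zero[OF VL coact_lin])
  then show ?thesis
    by (intro \<gamma>_family_zero[OF VL I _ _ i] Lg_L[OF y])
qed

lemma coassoc_bilinear:
  "l0 \<in> carr L \<Longrightarrow> kbilinear H H (tensor_space H (tensor_space H L))
    (\<lambda>h1 h2. tens H (tensor_space H L) h1 (tens H L h2 l0))"
  by (intro kbilinearI kbilinear_left[OF kbilinear_tens[OF VH VL]]
      kbilinear_left[OF kbilinear_tens[OF VH vect_space_tensor]]
      kbilinear_right[OF kbilinear_tens[OF VH vect_space_tensor]] klinear_ident tens_closed)

text \<open>Coassociativity evaluated on an arbitrary finite presentation of the coaction, which
  makes it usable both for splitting L(0) and for computing the coproduct of
  \<open>T g l\<close>.\<close>

lemma coassoc_sum:
  assumes l: "l \<in> carr L" and co: "coact L l = (\<Sum>i\<in>I. tens H L (v i) (w i))"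
    and v: "\<And>i. i \<in> I \<Longrightarrow> v i \<in> carr H" and w: "\<And>i. i \<in> I \<Longrightarrow> w i \<in> carr L"
  shows "(\<Sum>i\<in>I. tens H (tensor_space H L) (v i) (coact L (w i))) =
    (\<Sum>i\<in>I. sweedler H H (comul H (v i)) (\<lambda>h1 h2. tens H (tensor_space H L) h1 (tens H L h2 (w i))))"
proof -
  let ?T = "tensor_space H L"
  note kt = kbilinear_tens[OF VH VL] kbilinear_tens[OF VH vect_space_tensor[of H L]]
  have b2: "kbilinear H L (tensor_space H ?T) (\<lambda>h l0. sweedler H H (comul H h) (\<lambda>h1 h2. tens H ?T h1 (tens H L h2 l0)))"
  proof (rule kbilinearI)
    show "klinear L (tensor_space H ?T) (\<lambda>l0. sweedler H H (comul H h) (\<lambda>h1 h2. tens H ?T h1 (tens H L h2 l0)))"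
      if "h \<in> carr H" for h
      by (intro klinear_sweedler_fun[OF VH VH vect_space_tensor VL klinear_closed[OF comul_lin that]]
          coassoc_bilinear kbilinear_right[OF kt(1)] kbilinear_right[OF kt(2)] klinear_ident)
    show "klinear H (tensor_space H ?T) (\<lambda>h. sweedler H H (comul H h) (\<lambda>h1 h2. tens H ?T h1 (tens H L h2 l0)))"
      if "l0 \<in> carr L" for l0
      by (rule klinear_sweedler_arg[OF VH VH vect_space_tensor coassoc_bilinear[OF that] comul_lin])
  qed
  have b3: "kbilinear H L (tensor_space H ?T) (\<lambda>h l0. tens H ?T h (coact L l0))"
    by (intro kbilinearI kbilinear_left[OF kt(2)] kbilinear_right[OF kt(2)] klinear_ident coact_lin
        klinear_closed[OF coact_lin])
  show ?thesis
    using comodule_algebra.coact_coassoc[OF comod l]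
      sweedler_finite_sum[OF VH VL vect_space_tensor b2, where I = I and v = v and w = w, OF v w]
      sweedler_finite_sum[OF VH VL vect_space_tensor b3, where I = I and v = v and w = w, OF v w]
    by (simp add: co)
qed

text \<open>A comodule over a group algebra is graded by the group. Write the coaction of
  \<open>l\<close> as a sum of \<open>\<gamma> g\<close> \<otimes> \<open>y g\<close>; the counit
  gives that \<open>l\<close> is the sum of the \<open>y g\<close>, and coassociativity, compared at
  each \<open>\<gamma> g\<close>, gives that \<open>y g\<close> has degree g.\<close>

lemma L0_decomp:
  assumes l: "l \<in> Ln 0"
  obtains A y where "finite A" "A \<subseteq> carrier G" "\<And>g. y g \<in> Lg g" "l = (\<Sum>g\<in>A. y g)"
proof -
  interpret L0: vect_space L0 by (rule VL0)
  obtain B w where B: "finite B" "B \<subseteq> Hn 0" "\<And>v. w v \<in> Ln 0" "coact L l = (\<Sum>v\<in>B. tens H L v (w v))"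
    using tensor_space_basis_repr[OF VH0 VL0 coact_L0[OF l]] by (metis H0_simps(1) L0_simps(1) tens_H0L(1))
  define P where "P v A \<longleftrightarrow> finite A \<and> A \<subseteq> carrier G \<and> (\<forall>C. finite C \<longrightarrow> A \<subseteq> C \<longrightarrow>
      C \<subseteq> carrier G \<longrightarrow> v = (\<Sum>g\<in>C. scl H (\<xi> g v) (\<gamma> g)))" for v A
  have "\<exists>A. P v A" if "v \<in> B" for v
    using that B(2) H0_expand[of v] unfolding P_def by (metis subsetD)
  then obtain A' where "P v (A' v)" if "v \<in> B" for v
    by metis
  then have A': "\<And>v. v \<in> B \<Longrightarrow> finite (A' v)" "\<And>v. v \<in> B \<Longrightarrow> A' v \<subseteq> carrier G"
    "\<And>v C. v \<in> B \<Longrightarrow> finite C \<Longrightarrow> A' v \<subseteq> C \<Longrightarrow> C \<subseteq> carrier G \<Longrightarrow> v = (\<Sum>g\<in>C. scl H (\<xi> g v) (\<gamma> g))"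
    unfolding P_def by blast+
  \<comment> \<open>One finite set of group elements over which all left legs in \<open>B\<close>
    can be expanded at once.\<close>
  define A where "A = (\<Union>v\<in>B. A' v)"
  have A: "finite A" "A \<subseteq> carrier G" "\<And>v. v \<in> B \<Longrightarrow> v = (\<Sum>g\<in>A. scl H (\<xi> g v) (\<gamma> g))"
    using A'(1,2) B(1) by (auto simp: A_def intro!: A'(3))
  define y where "y g = (if g \<in> A then \<Sum>v\<in>B. scl L (\<xi> g v) (w v) else 0)" for g
  have y0: "y g \<in> Ln 0" for g
    using B(3) L0.carr_sum[of B] L0.carr_scale L0.carr_zero by (simp add: y_def)
  have "coact L l = (\<Sum>v\<in>B. \<Sum>g\<in>A. tens H L (scl H (\<xi> g v) (\<gamma> g)) (w v))"
    unfolding B(4) tens_sum_left[symmetric] using A(3) by (intro sum.cong) auto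
  also have "\<dots> = (\<Sum>g\<in>A. tens H L (\<gamma> g) (y g))"
    by (subst sum.swap) (simp add: y_def tens_sum_right tens_scale_left tens_scale_right)
  finally have co: "coact L l = (\<Sum>g\<in>A. tens H L (\<gamma> g) (y g))" .
  note yL = L_sub[OF y0]
  have AH: "g \<in> A \<Longrightarrow> \<gamma> g \<in> carr H" for g using A(2) \<gamma>_H by blast
  have bl: "kbilinear H L L (\<lambda>h l0. scl L (counit H h) l0)"
    using alg_hom_klinear[OF hopf_algebra.counit_alg_hom[OF hopf]] by (rule kbilinear_slice_left[OF VL])
  interpret L: vect_space L by (rule VL)
  have "l = (\<Sum>g\<in>A. scl L (counit H (\<gamma> g)) (y g))"
    using comodule_algebra.coact_counit[OF comod L_sub[OF l]] sweedler_finite_sum[OF VH VL VL bl, where I = A and v = \<gamma> and w = y, OF AH yL]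
    by (simp add: co)
  also have "\<dots> = (\<Sum>g\<in>A. y g)" using A(2) by (intro sum.cong) (auto simp: counit_\<gamma>)
  finally have sum: "l = (\<Sum>g\<in>A. y g)" .
  let ?T = "tensor_space H L"
  have "(\<Sum>g\<in>A. tens H ?T (\<gamma> g) (coact L (y g))) =
      (\<Sum>g\<in>A. sweedler H H (comul H (\<gamma> g)) (\<lambda>h1 h2. tens H ?T h1 (tens H L h2 (y g))))"
    by (rule coassoc_sum[OF L_sub[OF l] co AH yL])
  also have "(\<Sum>g\<in>A. sweedler H H (comul H (\<gamma> g)) (\<lambda>h1 h2. tens H ?T h1 (tens H L h2 (y g)))) =
      (\<Sum>g\<in>A. tens H ?T (\<gamma> g) (tens H L (\<gamma> g) (y g)))"
  proof (intro sum.cong refl)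
    fix g assume g: "g \<in> A"
    show "sweedler H H (comul H (\<gamma> g)) (\<lambda>h1 h2. tens H ?T h1 (tens H L h2 (y g))) = tens H ?T (\<gamma> g) (tens H L (\<gamma> g) (y g))"
      using g A(2) sweedler_tens[OF VH VH vect_space_tensor coassoc_bilinear[OF yL] AH AH, OF g g] by (simp add: comul_\<gamma> subsetD)
  qed
  \<comment> \<open>Both sides of coassociativity now have the same left legs
    \<open>\<gamma> g\<close>, so the differences of the right legs can be tested
    separately.\<close>
  finally have zero: "(\<Sum>g\<in>A. tens H ?T (\<gamma> g) (coact L (y g) - tens H L (\<gamma> g) (y g))) = 0"
    by (simp add: tens_diff_right sum_subtractf)
  have *: "coact L (y g) - tens H L (\<gamma> g) (y g) = 0" if "g \<in> A" for g
  proof (rule \<gamma>_family_zero[OF vect_space_tensor A(1) inj_on_id2 _ _ zero that])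
    show "g \<in> carrier G" if "g \<in> A" for g using that A(2) by blast
    show "coact L (y g) - tens H L (\<gamma> g) (y g) \<in> carr ?T" if "g \<in> A" for g
      by (intro vect_space.carr_diff[OF vect_space_tensor] tens_closed klinear_closed[OF coact_lin] yL AH that)
  qed
  have "y g \<in> Lg g" for g
  proof (cases "g \<in> A")
    case True
    then show ?thesis using *[OF True] y0[of g] by (simp add: Lg_def)
  qed (simp add: y_def Lg_zero)
  then show thesis using that A(1,2) sum by blast
qed

text \<open>The right ideal xL is a subcomodule because the coaction sends xl to
  \<open>\<gamma> g\<close> l_(-1) \<otimes> x l_(0). By simplicity it contains 1, say xl = 1.
  Passing to the degree zero part of l, and there to the component of degree \<open>inv g\<close>,
  makes the inverse homogeneous.\<close>

lemma Lg_inverse_right: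
  assumes g: "g \<in> carrier G" and x: "x \<in> Lg g" "x \<noteq> 0"
  obtains y where "y \<in> Lg (inv g)" "mul L x y = unity L"
proof -
  interpret L: vect_space L by (rule VL)
  note xL = Lg_L[OF x(1)]
  define I where "I = mul L x ` carr L"
  have lin: "klinear L L (mul L x)" by (rule klinear_mul_right[OF alg_L klinear_ident xL])
  have sub: "L.subspace I" unfolding I_def by (rule klinear_image_subspace[OF VL VL lin])
  have IL: "I \<subseteq> carr L" using L_mul[OF xL] by (auto simp: I_def)
  have "mul L a b \<in> I" if "a \<in> I" "b \<in> carr L" for a b
    using that xL by (auto simp: I_def L_assoc L_mul intro!: imageI)
  then have ri: "right_ideal L I" using sub IL by (simp add: right_ideal_def)
  have "coact L a \<in> carr (tensor_space H (L\<lparr>carr := I\<rparr>))" if aI: "a \<in> I" for a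
  proof -
    obtain l where l: "l \<in> carr L" "a = mul L x l" using aI by (auto simp: I_def)
    obtain B w where B: "finite B" "B \<subseteq> carr H" "\<And>v. w v \<in> carr L" "coact L l = (\<Sum>v\<in>B. tens H L v (w v))"
      using tensor_space_basis_repr[OF VH VL klinear_closed[OF coact_lin l(1)]] by metis
    have "coact L a = (\<Sum>v\<in>B. tens H L (mul H (\<gamma> g) v) (mul L x (w v)))"
      using tensor_alg_mul_tens[OF alg alg_L, of "{()}" "\<lambda>_. \<gamma> g" "\<lambda>_. x" B "\<lambda>v. v" w] B(2,3)
      by (simp add: l coact_mul[OF xL l(1)] B(4) Lg_coact[OF x(1)] \<gamma>_H[OF g] xL subset_iff)
    moreover have "tens H (L\<lparr>carr := I\<rparr>) = tens H L" by (rule tens_cong) simp_all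
    ultimately show ?thesis
      using B(2,3) H_mul \<gamma>_H[OF g] tens_closed[of _ H _ "L\<lparr>carr := I\<rparr>"]
      by (auto intro!: vect_space.carr_sum[OF vect_space_tensor] simp: I_def subset_iff)
  qed
  then have sc: "subcomodule H L I" using sub IL by (simp add: subcomodule_def)
  have "x \<in> I" using mul_one_L(1)[OF xL] unity_L unfolding I_def by (metis imageI)
  then have "I = carr L" using simple ri sc x(2) unfolding right_simple_def by blast
  then obtain l where l: "l \<in> carr L" "mul L x l = unity L" using unity_L unfolding I_def by (metis imageE)
  define l0 where "l0 = component Ln 0 l"
  have l0: "l0 \<in> Ln 0" unfolding l0_def by (rule component_mem[OF grs_L l(1)])
  have xl0: "mul L x l0 = unity L"
    using component_zero_mul[OF gralg_L xL l(1)]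
    by (simp add: l(2) l0_def component_homogeneous[OF VL grs_L Lg_L0[OF x(1)]]
        component_homogeneous[OF VL grs_L unity_L0])
  obtain A y where A: "finite A" "A \<subseteq> carrier G" "\<And>g. y g \<in> Lg g" "l0 = (\<Sum>g\<in>A. y g)"
    using L0_decomp[OF l0] by metis
  \<comment> \<open>The index \<open>inv g\<close> is added since the component of \<open>l0\<close>
    in that degree might be absent from \<open>A\<close>, while the term for the unit must appear in
    the sum.\<close>
  define A' where "A' = insert (inv g) A"
  have A': "finite A'" "A' \<subseteq> carrier G" using A(1,2) g by (auto simp: A'_def)
  \<comment> \<open>These are the homogeneous parts of \<open>mul L x l0 - unity L\<close>, with
    \<open>z h\<close> in degree g h; the unit is subtracted at h = \<open>inv g\<close>, where that
    degree is the identity.\<close>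
  define z where "z h = mul L x (if h \<in> A then y h else 0) - (if h = inv g then unity L else 0)" for h
  have "(\<Sum>h\<in>A'. z h) = (\<Sum>h\<in>A'. mul L x (if h \<in> A then y h else 0)) - unity L"
    using A'(1) by (simp add: z_def sum_subtractf A'_def)
  also have "(\<Sum>h\<in>A'. mul L x (if h \<in> A then y h else 0)) = mul L x (\<Sum>h\<in>A'. if h \<in> A then y h else 0)"
    using Lg_L[OF A(3)] L.carr_zero by (subst klinear_sum[OF VL lin]) simp_all
  also have "(\<Sum>h\<in>A'. if h \<in> A then y h else 0) = l0"
    unfolding A(4) using A'(1) by (intro sum.mono_neutral_cong_right) (auto simp: A'_def)
  finally have zero: "(\<Sum>h\<in>A'. z h) = 0" by (simp add: xl0)
  have "z h \<in> Lg (g \<otimes> h)" if "h \<in> A'" for h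
    using that A'(2) A(3) g unity_Lg Lg_zero unfolding z_def
    by (intro Lg_diff Lg_mult x) auto
  moreover have "inj_on (\<lambda>h. g \<otimes> h) A'" using g A'(2) by (auto intro!: inj_onI simp: subset_iff)
  ultimately have "z (inv g) = 0"
    using g A'(2) by (intro Lg_independent[OF A'(1) _ _ _ zero, where e = "\<lambda>h. g \<otimes> h"])
      (auto simp: subset_iff A'_def)
  then have "mul L x (if inv g \<in> A then y (inv g) else 0) = unity L" by (simp add: z_def)
  then show thesis by (rule that[rotated]) (simp add: A(3) Lg_zero)
qed

text \<open>The right inverse y is itself nonzero and homogeneous, so it has a right inverse z, and
  x = (xy)z = z.\<close>

lemma Lg_inverse:
  assumes g: "g \<in> carrier G" and x: "x \<in> Lg g" "x \<noteq> 0"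
  obtains y where "y \<in> Lg (inv g)" "mul L x y = unity L" "mul L y x = unity L"
proof -
  obtain y where y: "y \<in> Lg (inv g)" "mul L x y = unity L" using Lg_inverse_right[OF assms] .
  have y0: "y \<noteq> 0" using y(2) mul_zero_right[OF alg_L Lg_L[OF x(1)]] unity_L_nonzero by auto
  obtain z where z: "z \<in> Lg (inv (inv g))" "mul L y z = unity L"
    using Lg_inverse_right[OF inv_closed[OF g] y(1) y0] .
  have "x = mul L (mul L x y) z"
    using z(2) by (simp add: L_assoc Lg_L[OF x(1)] Lg_L[OF y(1)] Lg_L[OF z(1)])
  then have "z = x" using y(2) Lg_L[OF z(1)] by simp
  then show thesis using that y z(2) by simp
qed

lemma Lg_mult_nonzero:
  assumes g: "g \<in> carrier G" and x: "x \<in> Lg g" "x \<noteq> 0" and y: "y \<in> carr L" "y \<noteq> 0"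
  shows "mul L x y \<noteq> 0"
proof
  obtain z where z: "z \<in> Lg (inv g)" "mul L z x = unity L" by (rule Lg_inverse[OF g x])
  assume "mul L x y = 0"
  then have "mul L (mul L z x) y = 0"
    by (simp add: L_assoc Lg_L[OF z(1)] Lg_L[OF x(1)] y mul_zero_right[OF alg_L])
  then show False using z(2) y by simp
qed

text \<open>With z a right inverse of x, y = x(zy), and zy has degree \<open>\<one>\<close>, so it
  is a scalar. Thus every nonzero component of L(0) is a line.\<close>

lemma Lg_proportional:
  assumes g: "g \<in> carrier G" and x: "x \<in> Lg g" "x \<noteq> 0" and y: "y \<in> Lg g"
  obtains c where "y = scl L c x"
proof -
  obtain z where z: "z \<in> Lg (inv g)" "mul L x z = unity L" by (rule Lg_inverse[OF g x])
  have "mul L z y \<in> Lg \<one>" using Lg_mult[OF inv_closed[OF g] g z(1) y] g by simp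
  then obtain c where c: "mul L z y = scl L c (unity L)" unfolding Lg_one by auto
  have "y = mul L (mul L x z) y" using z(2) Lg_L[OF y] by simp
  also have "\<dots> = scl L c x"
    using c by (simp add: L_assoc Lg_L[OF z(1)] Lg_L[OF x(1)] Lg_L[OF y] L_scale_right unity_L)
  finally show thesis using that by blast
qed

section \<open>The support subgroup and its cocycle\<close>

definition F where "F = {g \<in> carrier G. Lg g \<noteq> {0}}"

lemma F_iff: "g \<in> F \<longleftrightarrow> g \<in> carrier G \<and> (\<exists>x\<in>Lg g. x \<noteq> 0)"
  using Lg_zero by (auto simp: F_def)

lemma subgroup_support: "subgroup F G"
proof (rule subgroupI)
  show "F \<subseteq> carrier G" by (auto simp: F_def)
  have "\<one> \<in> F" using unity_Lg unity_L_nonzero by (auto simp: F_iff)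
  then show "F \<noteq> {}" by blast
  show "inv g \<in> F" if "g \<in> F" for g
  proof -
    obtain x where x: "g \<in> carrier G" "x \<in> Lg g" "x \<noteq> 0" using \<open>g \<in> F\<close> by (auto simp: F_iff)
    then obtain y where y: "y \<in> Lg (inv g)" "mul L x y = unity L" by (rule Lg_inverse)
    have "y \<noteq> 0" using y(2) mul_zero_right[OF alg_L Lg_L[OF x(2)]] unity_L_nonzero by auto
    then show ?thesis using x(1) y(1) by (auto simp: F_iff)
  qed
  show "g \<otimes> h \<in> F" if "g \<in> F" "h \<in> F" for g h
    using that Lg_mult Lg_mult_nonzero Lg_L unfolding F_iff by (metis m_closed)
qed

text \<open>A basis vector of each line L(0)_g with g in the support; the choice of 1 at the
  identity is what normalizes the cocycle.\<close>

definition u where "u g = (if g = \<one> then unity L else SOME x. x \<in> Lg g \<and> x \<noteq> 0)"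

lemma u_Lg: "g \<in> F \<Longrightarrow> u g \<in> Lg g" and u_nonzero: "g \<in> F \<Longrightarrow> u g \<noteq> 0"
proof -
  assume "g \<in> F"
  then have "\<exists>x. x \<in> Lg g \<and> x \<noteq> 0" by (auto simp: F_iff)
  from someI_ex[OF this] show "u g \<in> Lg g" "u g \<noteq> 0"
    by (auto simp: u_def unity_Lg unity_L_nonzero)
qed

text \<open>The structure constants of L(0) in the basis \<open>u\<close>. For g and h in
  \<open>F\<close> the scalar exists because components are lines, and it is unique because
  \<open>u (g \<otimes> h)\<close> is nonzero.\<close>

definition \<psi> where "\<psi> g h = (SOME c. mul L (u g) (u h) = scl L c (u (g \<otimes> h)))"

lemmas FG = subgroup.mem_carrier[OF subgroup_support]
lemmas F_m = subgroup.m_closed[OF subgroup_support]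

lemma \<psi>_eq:
  assumes "g \<in> F" "h \<in> F"
  shows "mul L (u g) (u h) = scl L (\<psi> g h) (u (g \<otimes> h))"
proof -
  have "\<exists>c. mul L (u g) (u h) = scl L c (u (g \<otimes> h))"
    using Lg_proportional[OF FG u_Lg u_nonzero Lg_mult] assms FG F_m u_Lg by metis
  then show ?thesis unfolding \<psi>_def by (rule someI_ex)
qed

lemma u_L: "g \<in> F \<Longrightarrow> u g \<in> carr L"
  using Lg_L u_Lg by blast

text \<open>The cocycle identity is associativity on three basis vectors, nonvanishing is
  invertibility of homogeneous elements, and normalization comes from \<open>u \<one>\<close> =
  1.\<close>

lemma two_cocycle_\<psi>: "two_cocycle G F \<psi>"
proof -
  interpret L: vect_space L by (rule VL)
  have one: "u \<one> = unity L" by (simp add: u_def)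
  have oneF: "\<one> \<in> F" by (rule subgroup.one_closed[OF subgroup_support])
  have cancel: "c = d" if "scl L c (u g) = scl L d (u g)" "g \<in> F" for c d g
    using that u_nonzero[of g] by simp
  have "\<psi> a b \<noteq> 0" if "a \<in> F" "b \<in> F" for a b
    using \<psi>_eq[OF that] Lg_mult_nonzero[OF FG u_Lg u_nonzero u_L u_nonzero] that by auto
  moreover have "\<psi> a b * \<psi> (a \<otimes> b) c = \<psi> b c * \<psi> a (b \<otimes> c)" if "a \<in> F" "b \<in> F" "c \<in> F" for a b c
  proof (rule cancel[of _ "a \<otimes> b \<otimes> c"])
    have "scl L (\<psi> a b * \<psi> (a \<otimes> b) c) (u (a \<otimes> b \<otimes> c)) = mul L (mul L (u a) (u b)) (u c)"
      using that by (simp add: \<psi>_eq F_m L_scale_left u_L)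
    also have "\<dots> = mul L (u a) (mul L (u b) (u c))" using that by (simp add: L_assoc u_L)
    also have "\<dots> = scl L (\<psi> b c * \<psi> a (b \<otimes> c)) (u (a \<otimes> b \<otimes> c))"
      using that by (simp add: \<psi>_eq F_m L_scale_right u_L m_assoc FG)
    finally show "scl L (\<psi> a b * \<psi> (a \<otimes> b) c) (u (a \<otimes> b \<otimes> c)) = scl L (\<psi> b c * \<psi> a (b \<otimes> c)) (u (a \<otimes> b \<otimes> c))" .
  qed (simp add: that F_m)
  moreover have "\<psi> a \<one> = 1 \<and> \<psi> \<one> a = 1" if "a \<in> F" for a
    using \<psi>_eq[OF that oneF] \<psi>_eq[OF oneF that] that u_L[OF that]
    by (auto simp: one FG intro!: cancel[OF _ that])
  ultimately show ?thesis unfolding two_cocycle_def by blast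
qed

end

section \<open>Coordinates\<close>

context simple_comod
begin

sublocale graded_smash G H Hn \<phi> F \<psi>
  by (intro graded_smash.intro graded_smash_axioms.intro graded_hopf_group_axioms subgroup_support)

section \<open>The twisted group algebra as the degree zero part of L\<close>

definition \<Theta> where "\<Theta> = lin_ext L0 u"

lemma \<Theta>_lin: "klinear E L0 \<Theta>"
  unfolding \<Theta>_def using u_Lg Lg_L0 by (intro klinear_lin_ext[OF VL0 E]) auto

lemma \<Theta>_single: "\<Theta> (Poly_Mapping.single g a) = scl L a (u g)"
  unfolding \<Theta>_def by (simp add: lin_ext_single[OF VL0])

lemma \<Theta>_expand: "finite A \<Longrightarrow> Poly_Mapping.keys x \<subseteq> A \<Longrightarrow> \<Theta> x = (\<Sum>g\<in>A. scl L (Poly_Mapping.lookup x g) (u g))"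
  unfolding \<Theta>_def by (simp add: lin_ext_superset[OF VL0])

text \<open>Injective by independence of elements of distinct degrees; surjective since every
  homogeneous component of an element of L(0) is a multiple of the corresponding
  \<open>u g\<close>.\<close>

lemma \<Theta>_bij: "bij_betw \<Theta> (carr E) (Ln 0)"
proof -
  interpret L: vect_space L by (rule VL)
  have zero: "x = 0" if x: "x \<in> carr E" "\<Theta> x = 0" for x
  proof -
    have keys: "g \<in> F" if "g \<in> Poly_Mapping.keys x" for g using that x(1) by auto
    have sum: "(\<Sum>g\<in>Poly_Mapping.keys x. scl L (Poly_Mapping.lookup x g) (u g)) = 0"
      using \<Theta>_expand[OF finite_keys order_refl] x(2) by metis
    have "scl L (Poly_Mapping.lookup x g) (u g) = 0" if "g \<in> Poly_Mapping.keys x" for g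
      by (rule Lg_independent[OF finite_keys inj_on_id2 _ _ sum that]) (intro FG Lg_scale u_Lg keys; assumption)+
    then have "Poly_Mapping.lookup x g = 0" for g
      using u_nonzero keys by (cases "g \<in> Poly_Mapping.keys x") (auto simp: in_keys_iff)
    then show ?thesis by (intro poly_mapping_eqI) simp
  qed
  have "inj_on \<Theta> (carr E)"
  proof (rule inj_onI)
    fix x y assume xy: "x \<in> carr E" "y \<in> carr E" "\<Theta> x = \<Theta> y"
    then have "x - y = 0"
      by (intro zero vect_space.carr_diff[OF VE]) (simp_all add: klinear_diff[OF VE \<Theta>_lin])
    then show "x = y" by simp
  qed
  moreover have "l \<in> \<Theta> ` carr E" if l: "l \<in> Ln 0" for l
  proof -
    obtain A y where A: "finite A" "A \<subseteq> carrier G" "\<And>g. y g \<in> Lg g" "l = (\<Sum>g\<in>A. y g)"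
      using L0_decomp[OF l] by metis
    have "\<exists>c. y g = scl L c (u g)" if "g \<in> F" for g
      using Lg_proportional[OF FG u_Lg u_nonzero A(3)] that by metis
    then obtain c where c: "\<And>g. g \<in> F \<Longrightarrow> y g = scl L (c g) (u g)" by metis
    let ?x = "\<Sum>g\<in>A \<inter> F. Poly_Mapping.single g (c g)"
    \<comment> \<open>Outside \<open>F\<close> the component of L(0) is zero, so those
      \<open>y g\<close> drop out.\<close>
    have "l = (\<Sum>g\<in>A \<inter> F. y g)"
      unfolding A(4) using A(1) subsetD[OF A(2)] A(3) by (intro sum.mono_neutral_right) (auto simp: F_iff)
    also have "\<dots> = (\<Sum>g\<in>A \<inter> F. \<Theta> (Poly_Mapping.single g (c g)))"
      by (intro sum.cong) (auto simp: \<Theta>_single c)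
    also have "\<dots> = \<Theta> ?x"
      by (rule klinear_sum[OF VE \<Theta>_lin, symmetric]) (rule single_E, blast)
    finally have "l = \<Theta> ?x" .
    moreover have "?x \<in> carr E"
      by (rule vect_space.carr_sum[OF VE]) (rule single_E, blast)
    ultimately show ?thesis by blast
  qed
  ultimately show ?thesis
    using klinear_closed[OF \<Theta>_lin] by (auto simp: bij_betw_def)
qed

lemma \<Theta>_mul:
  assumes x: "x \<in> carr E" and y: "y \<in> carr E"
  shows "\<Theta> (twisted_mul G \<psi> x y) = mul L (\<Theta> x) (\<Theta> y)"
proof -
  let ?X = "Poly_Mapping.keys x" and ?Y = "Poly_Mapping.keys y"
  interpret L: vect_space L by (rule VL)
  have k: "g \<in> ?X \<Longrightarrow> g \<in> F" "g \<in> ?Y \<Longrightarrow> g \<in> F" for g using x y by auto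
  note lm = k_algebra.mul_bilinear[OF alg_L]
  have "mul L (\<Theta> x) (\<Theta> y) = (\<Sum>g\<in>?X. \<Sum>h\<in>?Y. mul L (scl L (Poly_Mapping.lookup x g) (u g)) (scl L (Poly_Mapping.lookup y h) (u h)))"
    unfolding \<Theta>_expand[of ?X x, OF finite_keys order_refl] \<Theta>_expand[of ?Y y, OF finite_keys order_refl]
    by (rule kbilinear_sum_sum[OF VL VL lm]) (intro L.carr_scale u_L k; assumption)+
  also have "\<dots> = (\<Sum>g\<in>?X. \<Sum>h\<in>?Y. \<Theta> (Poly_Mapping.single (g \<otimes> h) (Poly_Mapping.lookup x g * Poly_Mapping.lookup y h * \<psi> g h)))"
    using k by (intro sum.cong refl)
      (simp add: \<Theta>_single L_scale_left L_scale_right u_L L.carr_scale \<psi>_eq)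
  also have "\<dots> = \<Theta> (twisted_mul G \<psi> x y)"
    unfolding twisted_mul_def using k
    by (simp add: klinear_sum[OF VE \<Theta>_lin] vect_space.carr_sum[OF VE] single_E F_m del: E_simps)
  finally show ?thesis by simp
qed

text \<open>Projection to degree zero followed by the inverse of \<open>\<Theta>\<close>: an algebra
  map from L to the twisted group algebra. The functions \<open>coord g\<close> are its
  coordinates.\<close>

definition \<Lambda> where "\<Lambda> l = inv_into (carr E) \<Theta> (component Ln 0 l)"

lemma comp_L0: "klinear L L0 (component Ln 0)"
  unfolding degree_zero_comod_def by (rule klinear_component[OF VL grs_L])

lemma \<Lambda>_lin: "klinear L E \<Lambda>"
  unfolding \<Lambda>_def
  by (rule klinear_compose[OF comp_L0 klinear_inv_into[OF VE \<Theta>_lin]]) (use \<Theta>_bij in simp)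

lemma \<Theta>_\<Lambda>: "l \<in> carr L \<Longrightarrow> \<Theta> (\<Lambda> l) = component Ln 0 l"
  using \<Theta>_bij component_mem[OF grs_L] unfolding \<Lambda>_def by (simp add: bij_betw_def f_inv_into_f)

lemma \<Lambda>_eq: "x \<in> carr E \<Longrightarrow> \<Theta> x = component Ln 0 l \<Longrightarrow> \<Lambda> l = x"
  unfolding \<Lambda>_def by (rule inv_into_f_eq[OF bij_betw_imp_inj_on[OF \<Theta>_bij]])

lemma \<Lambda>_u: "g \<in> F \<Longrightarrow> \<Lambda> (u g) = Poly_Mapping.single g 1"
  by (intro \<Lambda>_eq single_E)
   (simp_all add: \<Theta>_single component_homogeneous[OF VL grs_L Lg_L0[OF u_Lg]] vector_space.vector_space_assms(4)[OF vect_space.axioms(1)[OF VL]])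

lemma \<Lambda>_pos: "l \<in> Ln n \<Longrightarrow> n > 0 \<Longrightarrow> \<Lambda> l = 0"
  using vect_space.carr_zero[OF VE] klinear_zero[OF VE \<Theta>_lin]
  by (intro \<Lambda>_eq) (auto simp: component_homogeneous[OF VL grs_L])

lemma \<Lambda>_mul:
  assumes "x \<in> carr L" "y \<in> carr L"
  shows "\<Lambda> (mul L x y) = twisted_mul G \<psi> (\<Lambda> x) (\<Lambda> y)"
  using assms klinear_closed[OF \<Lambda>_lin] kbilinear_closed[OF mul_E]
  by (intro \<Lambda>_eq) (simp_all add: \<Theta>_mul \<Theta>_\<Lambda> component_zero_mul[OF gralg_L] del: E_simps(4))

definition coord where "coord g l = Poly_Mapping.lookup (\<Lambda> l) g"

lemma coord_lin: "klinear L field_alg (coord g)"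
  unfolding coord_def by (rule klinear_compose[OF \<Lambda>_lin klinear_lookup[OF E]])

lemma coord_u: "g \<in> F \<Longrightarrow> coord h (u g) = (if h = g then 1 else 0)"
  by (simp add: coord_def \<Lambda>_u lookup_single when_def)

lemma coord_pos: "l \<in> Ln n \<Longrightarrow> n > 0 \<Longrightarrow> coord g l = 0"
  by (simp add: coord_def \<Lambda>_pos)

lemma coord_outside: "l \<in> carr L \<Longrightarrow> g \<notin> F \<Longrightarrow> coord g l = 0"
  using klinear_closed[OF \<Lambda>_lin, of l] by (auto simp: coord_def in_keys_iff)

lemma finite_coord: "finite {g. coord g l \<noteq> 0}"
  by (simp add: coord_def)

text \<open>Arbitrary finite \<open>A\<close> and \<open>B\<close> are allowed so that the formula
  can be summed over many pairs (l, m) with the same index sets.\<close>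

lemma coord_mul:
  assumes l: "l \<in> carr L" and m: "m \<in> carr L" and A: "finite A" "{g. coord g l \<noteq> 0} \<subseteq> A"
    and B: "finite B" "{g. coord g m \<noteq> 0} \<subseteq> B"
  shows "coord k (mul L l m) = (\<Sum>g\<in>A. \<Sum>h\<in>B. if g \<otimes> h = k then coord g l * coord h m * \<psi> g h else 0)"
proof -
  let ?s = "\<lambda>g h. Poly_Mapping.single (g \<otimes> h) (coord g l * coord h m * \<psi> g h)"
  have keys: "Poly_Mapping.keys (\<Lambda> z) = {g. coord g z \<noteq> 0}" for z by (auto simp: coord_def in_keys_iff)
  have "\<Lambda> (mul L l m) = (\<Sum>g | coord g l \<noteq> 0. \<Sum>h | coord h m \<noteq> 0. ?s g h)"
    unfolding \<Lambda>_mul[OF l m] twisted_mul_def keys by (simp add: coord_def)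
  also have "\<dots> = (\<Sum>g\<in>A. \<Sum>h | coord h m \<noteq> 0. ?s g h)"
    using A by (intro sum.mono_neutral_left) auto
  also have "\<dots> = (\<Sum>g\<in>A. \<Sum>h\<in>B. ?s g h)"
    using B by (intro sum.cong sum.mono_neutral_left) auto
  finally show ?thesis
    by (simp add: coord_def[of k] lookup_sum lookup_single when_def)
qed

lemma L0_expand:
  assumes "l \<in> Ln 0"
  shows "l = (\<Sum>g | coord g l \<noteq> 0. scl L (coord g l) (u g))"
proof -
  have "l = \<Theta> (\<Lambda> l)" by (simp add: \<Theta>_\<Lambda> L_sub[OF assms] component_homogeneous[OF VL grs_L assms])
  also have "\<dots> = (\<Sum>g | coord g l \<noteq> 0. scl L (coord g l) (u g))"
    by (subst \<Theta>_expand[OF finite_coord, of _ l]) (auto simp: coord_def in_keys_iff)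
  finally show ?thesis .
qed

text \<open>Together the \<open>T g\<close> are the coordinates of (id \<otimes>
  \<open>\<Lambda>\<close>) after the coaction, a map from L to H \<otimes> E; working in
  coordinates keeps values in \<open>H\<close>.\<close>

definition T where "T g l = sweedler H L (coact L l) (\<lambda>h l0. scl H (coord g l0) h)"

lemmas slice_bilinear = kbilinear_slice_right[OF VH coord_lin]

lemma T_lin: "klinear L H (T g)"
  unfolding T_def by (rule klinear_sweedler_arg[OF VH VL VH slice_bilinear coact_lin])

lemmas T_H = klinear_closed[OF T_lin]

lemma T_sum:
  assumes "coact L l = (\<Sum>i\<in>I. tens H L (v i) (w i))"
    and "\<And>i. i \<in> I \<Longrightarrow> v i \<in> carr H" "\<And>i. i \<in> I \<Longrightarrow> w i \<in> carr L"
  shows "T g l = (\<Sum>i\<in>I. scl H (coord g (w i)) (v i))"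
  unfolding T_def assms(1) by (rule sweedler_finite_sum[OF VH VL VH slice_bilinear assms(2,3)])

lemma T_Lg: "x \<in> Lg h \<Longrightarrow> h \<in> carrier G \<Longrightarrow> T g x = scl H (coord g x) (\<gamma> h)"
  using T_sum[of x "\<lambda>_. \<gamma> h" "\<lambda>_. x" "{()}" g] by (simp add: Lg_coact \<gamma>_H Lg_L)

lemma coact_repr:
  assumes "l \<in> carr L"
  obtains B w where "finite B" "\<And>v. v \<in> B \<Longrightarrow> v \<in> carr H"
    "\<And>v. w v \<in> carr L" "coact L l = (\<Sum>v\<in>B. tens H L v (w v))"
  by (rule tensor_space_basis_repr[OF VH VL klinear_closed[OF coact_lin assms]]) (rule that, auto)

lemma T_outside:
  assumes "l \<in> carr L" "g \<notin> F"
  shows "T g l = 0"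
proof -
  interpret H: vect_space H by (rule VH)
  show ?thesis
    using assms(1)
  proof (rule coact_repr)
    fix B w assume B: "finite B" "\<And>v. v \<in> B \<Longrightarrow> v \<in> carr H" "\<And>v. w v \<in> carr L"
      "coact L l = (\<Sum>v\<in>B. tens H L v (w v))"
    show ?thesis using T_sum[OF B(4) B(2,3)] by (simp add: coord_outside[OF B(3) assms(2)])
  qed
qed

text \<open>\<open>T g l\<close> can be nonzero only if \<open>coord g\<close> is nonzero on one of
  the finitely many right legs of the coaction of \<open>l\<close>.\<close>

lemma T_finite:
  assumes "l \<in> carr L"
  shows "finite {g. T g l \<noteq> 0}"
proof -
  interpret H: vect_space H by (rule VH)
  obtain B w where B: "finite B" "\<And>v. v \<in> B \<Longrightarrow> v \<in> carr H" "\<And>v. w v \<in> carr L"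
      "coact L l = (\<Sum>v\<in>B. tens H L v (w v))"
    using coact_repr[OF assms] by metis
  have "{g. T g l \<noteq> 0} \<subseteq> (\<Union>v\<in>B. {g. coord g (w v) \<noteq> 0})"
  proof
    fix g assume "g \<in> {g. T g l \<noteq> 0}"
    then have "(\<Sum>v\<in>B. scl H (coord g (w v)) v) \<noteq> 0" using T_sum[OF B(4) B(2,3)] by simp
    then obtain v where "v \<in> B" "scl H (coord g (w v)) v \<noteq> 0" by (meson sum.not_neutral_contains_not_neutral)
    then show "g \<in> (\<Union>v\<in>B. {g. coord g (w v) \<noteq> 0})" by auto
  qed
  then show ?thesis using B(1) finite_coord by (auto intro: finite_subset)
qed

text \<open>Multiplicativity of (id \<otimes> \<open>\<Lambda>\<close>) after the coaction, in
  coordinates. The index sets are independent of \<open>k\<close>, lie in \<open>F\<close> and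
  contain the supports, so that they also serve to expand \<open>embed\<close>.\<close>

lemma T_mul:
  assumes l: "l \<in> carr L" and m: "m \<in> carr L"
  shows "\<exists>A B. finite A \<and> A \<subseteq> F \<and> {g. T g l \<noteq> 0} \<subseteq> A \<and> finite B \<and> B \<subseteq> F \<and> {g. T g m \<noteq> 0} \<subseteq> B \<and>
    (\<forall>k. T k (mul L l m) =
      (\<Sum>g\<in>A. \<Sum>h\<in>B. if g \<otimes> h = k then scl H (\<psi> g h) (mul H (T g l) (T h m)) else 0))"
proof -
  interpret H: vect_space H by (rule VH)
  obtain B w where B: "finite B" "\<And>v. v \<in> B \<Longrightarrow> v \<in> carr H" "\<And>v. w v \<in> carr L"
      "coact L l = (\<Sum>v\<in>B. tens H L v (w v))"
    using coact_repr[OF l] by metis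
  obtain B' w' where B': "finite B'" "\<And>v. v \<in> B' \<Longrightarrow> v \<in> carr H" "\<And>v. w' v \<in> carr L"
      "coact L m = (\<Sum>v\<in>B'. tens H L v (w' v))"
    using coact_repr[OF m] by metis
  \<comment> \<open>The second part supplies the supports over which \<open>coord_mul\<close>
    expands, for all right legs simultaneously; the first makes the required inclusion for
    \<open>T\<close> immediate.\<close>
  define A where "A = {g. T g l \<noteq> 0} \<union> (\<Union>v\<in>B. {g. coord g (w v) \<noteq> 0})"
  define A' where "A' = {g. T g m \<noteq> 0} \<union> (\<Union>v\<in>B'. {g. coord g (w' v) \<noteq> 0})"
  have A: "finite A" "finite A'" "A \<subseteq> F" "A' \<subseteq> F"
    using B(1) B'(1) finite_coord T_finite[OF l] T_finite[OF m] T_outside[OF l] T_outside[OF m]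
      coord_outside[OF B(3)] coord_outside[OF B'(3)]
    unfolding A_def A'_def by blast+
  note hm = k_algebra.mul_bilinear[OF alg]
  have Tl: "T g l = (\<Sum>v\<in>B. scl H (coord g (w v)) v)" for g by (rule T_sum[OF B(4) B(2,3)])
  have Tm: "T g m = (\<Sum>v\<in>B'. scl H (coord g (w' v)) v)" for g by (rule T_sum[OF B'(4) B'(2,3)])
  have co: "coact L (mul L l m) = (\<Sum>(v, v')\<in>B \<times> B'. tens H L (mul H v v') (mul L (w v) (w' v')))"
    using tensor_alg_mul_tens[OF alg alg_L, of B "\<lambda>v. v" w B' "\<lambda>v. v" w'] B(2,3) B'(2,3)
    by (simp add: coact_mul[OF l m] B(4) B'(4) sum.cartesian_product)
  have "T k (mul L l m) = (\<Sum>g\<in>A. \<Sum>h\<in>A'. if g \<otimes> h = k then scl H (\<psi> g h) (mul H (T g l) (T h m)) else 0)" for k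
  proof -
    have "T k (mul L l m) = (\<Sum>p\<in>B \<times> B'. scl H (coord k (mul L (w (fst p)) (w' (snd p)))) (mul H (fst p) (snd p)))"
      using B(2,3) B'(2,3) H_mul L_mul by (intro T_sum) (auto simp: co split_beta)
    also have "\<dots> = (\<Sum>v\<in>B. \<Sum>v'\<in>B'. scl H (coord k (mul L (w v) (w' v'))) (mul H v v'))"
      by (simp add: sum.cartesian_product split_beta)
    also have "\<dots> = (\<Sum>v\<in>B. \<Sum>v'\<in>B'. \<Sum>g\<in>A. \<Sum>h\<in>A'. if g \<otimes> h = k
        then scl H (\<psi> g h) (mul H (scl H (coord g (w v)) v) (scl H (coord h (w' v')) v')) else 0)"
    proof (intro sum.cong refl)
      fix v v' assume v: "v \<in> B" "v' \<in> B'"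
      have "coord k (mul L (w v) (w' v')) = (\<Sum>g\<in>A. \<Sum>h\<in>A'. if g \<otimes> h = k then coord g (w v) * coord h (w' v') * \<psi> g h else 0)"
        using v A by (intro coord_mul B(3) B'(3)) (auto simp: A_def A'_def)
      moreover have "mul H (scl H c v) (scl H d v') = scl H (c * d) (mul H v v')" for c d
        using hm v B(2) B'(2) by (simp add: kbilinear_def klinear_def H.carr_scale)
      ultimately show "scl H (coord k (mul L (w v) (w' v'))) (mul H v v') = (\<Sum>g\<in>A. \<Sum>h\<in>A'. if g \<otimes> h = k
        then scl H (\<psi> g h) (mul H (scl H (coord g (w v)) v) (scl H (coord h (w' v')) v')) else 0)"
        by (auto simp: H.scale_sum_left mult_ac intro!: sum.cong)
    qed
    also have "\<dots> = (\<Sum>v\<in>B. \<Sum>g\<in>A. \<Sum>h\<in>A'. \<Sum>v'\<in>B'. if g \<otimes> h = k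
        then scl H (\<psi> g h) (mul H (scl H (coord g (w v)) v) (scl H (coord h (w' v')) v')) else 0)"
      by (subst sum.swap[of _ A B'], subst sum.swap[of _ A' B']) (rule refl)
    also have "\<dots> = (\<Sum>g\<in>A. \<Sum>h\<in>A'. \<Sum>v\<in>B. \<Sum>v'\<in>B'. if g \<otimes> h = k
        then scl H (\<psi> g h) (mul H (scl H (coord g (w v)) v) (scl H (coord h (w' v')) v')) else 0)"
      by (subst sum.swap[of _ A B], subst sum.swap[of _ A' B]) (rule refl)
    also have "\<dots> = (\<Sum>g\<in>A. \<Sum>h\<in>A'. if g \<otimes> h = k then scl H (\<psi> g h) (mul H (T g l) (T h m)) else 0)"
    proof (intro sum.cong refl)
      fix g h
      have "mul H (T g l) (T h m) = (\<Sum>v\<in>B. \<Sum>v'\<in>B'. mul H (scl H (coord g (w v)) v) (scl H (coord h (w' v')) v'))"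
        unfolding Tl Tm
        by (rule kbilinear_sum_sum[OF VH VH hm]) (intro H.carr_scale B(2) B'(2); assumption)+
      then show "(\<Sum>v\<in>B. \<Sum>v'\<in>B'. if g \<otimes> h = k
        then scl H (\<psi> g h) (mul H (scl H (coord g (w v)) v) (scl H (coord h (w' v')) v')) else 0) =
        (if g \<otimes> h = k then scl H (\<psi> g h) (mul H (T g l) (T h m)) else 0)"
        by (simp add: H.scale_sum_right)
    qed
    finally show ?thesis .
  qed
  then show ?thesis
    using A by (intro exI[of _ A] exI[of _ A'] conjI allI) (auto simp: A_def A'_def)
qed

lemma coord_one: "coord g (unity L) = (if g = \<one> then 1 else 0)"
  using coord_u[of \<one> g] F_one by (simp add: u_def)

lemma T_one: "T g (unity L) = (if g = \<one> then unity H else 0)"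
proof -
  interpret H: vect_space H by (rule VH)
  show ?thesis using T_Lg[OF unity_Lg] by (simp add: coord_one \<gamma>_one)
qed

text \<open>\<open>coord g\<close> vanishes in positive degree, so among the summands H(i) \<otimes>
  L(j) with i + j = n only j = 0 contributes. The tensors with this property form a subspace, hence
  checking generators is enough.\<close>

lemma T_degree:
  assumes l: "l \<in> Ln n"
  shows "T g l \<in> Hn n"
proof -
  interpret H: vect_space H by (rule VH)
  interpret TS: vector_space "tscale :: 'k \<Rightarrow> ('h, 'l, 'k) tensor \<Rightarrow> _" by (rule vector_space_tscale)
  let ?s = "\<lambda>t. sweedler H L t (\<lambda>h l0. scl H (coord g l0) h)"
  let ?S = "{t \<in> carr (tensor_space H L). ?s t \<in> Hn n}"
  note lin = klinear_sweedler[OF VH VL VH slice_bilinear]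
  have sub: "H.subspace (Hn n)" using grs by (simp add: graded_space_def)
  have "TS.subspace ?S"
    unfolding TS.subspace_def
    using klinear_zero[OF vect_space_tensor lin] klinear_add[OF lin] klinear_scale[OF lin]
      vect_space.carr_zero[OF vect_space_tensor[of H L]] vect_space.carr_add[OF vect_space_tensor[of H L]]
      vect_space.carr_scale[OF vect_space_tensor[of H L]] sub
    by (auto simp: H.subspace_0 H.subspace_add H.subspace_scale)
  moreover have "{tens H L v w | v w i j. i + j = n \<and> v \<in> Hn i \<and> w \<in> Ln j} \<subseteq> ?S"
  proof clarify
    fix v w i j assume v: "v \<in> Hn i" "w \<in> Ln j" "n = i + j"
    have vw: "v \<in> carr H" "w \<in> carr L" using v graded_space_subset[OF grs] L_sub by auto
    have "?s (tens H L v w) = scl H (coord g w) v"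
      by (rule sweedler_tens[OF VH VL VH slice_bilinear vw])
    moreover have "scl H (coord g w) v \<in> Hn (i + j)"
      using v(1) sub coord_pos[OF v(2)] v(3) by (cases "j = 0") (auto simp: H.subspace_0 H.subspace_scale)
    ultimately show "tens H L v w \<in> carr (tensor_space H L) \<and> ?s (tens H L v w) \<in> Hn (i + j)"
      using tens_closed[OF vw] by simp
  qed
  ultimately have "tensor_grading H Hn L Ln n \<subseteq> ?S"
    unfolding tensor_grading_def by (intro TS.span_minimal)
  then show ?thesis
    using graded_comod l unfolding graded_comodule_algebra_def T_def by blast
qed

text \<open>Both sides vanish in positive degree. In degree zero \<open>x\<close> expands in the
  basis \<open>u h\<close>, and \<open>T g\<close> sees only h = g. This relation is the source of
  the coinvariance of \<open>coeff g l\<close>.\<close>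

lemma T_comp:
  assumes l: "l \<in> carr L" and g: "g \<in> F"
  shows "component Hn 0 (T g l) = scl H (coord g l) (\<gamma> g)"
  using VL grs_L klinear_compose[OF T_lin comp_lin] kbilinear_left[OF kbilinear_scl[OF VH] coord_lin \<gamma>_H[OF FG[OF g]]] _ l
proof (rule graded_space_ext)
  interpret H: vect_space H by (rule VH)
  interpret L: vect_space L by (rule VL)
  fix n x assume x: "x \<in> Ln n"
  show "component Hn 0 (T g x) = scl H (coord g x) (\<gamma> g)"
  proof (cases "n = 0")
    case False
    then show ?thesis using x by (simp add: component_homogeneous[OF VH grs T_degree[OF x]] coord_pos)
  next
    case True
    let ?A = "{h. coord h x \<noteq> 0}"
    have A: "h \<in> F" if "h \<in> ?A" for h using that coord_outside[OF L_sub[OF x]] by blast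
    have "T g x = T g (\<Sum>h\<in>?A. scl L (coord h x) (u h))"
      using L0_expand x True by simp
    also have "\<dots> = (\<Sum>h\<in>?A. T g (scl L (coord h x) (u h)))"
      by (rule klinear_sum[OF VL T_lin]) (rule L.carr_scale, rule u_L, rule A)
    also have "\<dots> = (\<Sum>h\<in>?A. scl H (coord h x) (if h = g then \<gamma> h else 0))"
      using A by (intro sum.cong refl)
        (simp add: klinear_scale[OF T_lin] u_L T_Lg[OF u_Lg FG] coord_u)
    also have "\<dots> = (\<Sum>h\<in>?A. if h = g then scl H (coord g x) (\<gamma> g) else 0)"
      by (intro sum.cong) auto
    also have "\<dots> = scl H (coord g x) (\<gamma> g)"
      using finite_coord by simp
    finally have "T g x = scl H (coord g x) (\<gamma> g)" .
    moreover have "T g x \<in> Hn 0" using T_degree x True by simp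
    ultimately show ?thesis by (simp add: comp_H0)
  qed
qed

text \<open>Contract the last leg of coassociativity with \<open>coord g\<close>: this gives
  \<Delta>(\<open>T g l\<close>) = l_(-1) \<otimes> \<open>T g\<close> l_(0), so \<open>T g\<close>
  is a map of left \<open>H\<close>-comodules.\<close>

lemma comul_T:
  assumes l: "l \<in> carr L" and co: "coact L l = (\<Sum>i\<in>I. tens H L (v i) (w i))"
    and v: "\<And>i. i \<in> I \<Longrightarrow> v i \<in> carr H" and w: "\<And>i. i \<in> I \<Longrightarrow> w i \<in> carr L"
  shows "comul H (T g l) = (\<Sum>i\<in>I. tens H H (v i) (T g (w i)))"
proof -
  interpret H: vect_space H by (rule VH)
  note VT = vect_space_tensor[of H L]
  let ?\<sigma> = "\<lambda>s. sweedler H L s (\<lambda>h l0. scl H (coord g l0) h)"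
  note \<sigma> = klinear_sweedler[OF VH VL VH slice_bilinear[of g]]
  note kH = kbilinear_tens[OF VH VH]
  have b: "kbilinear H (tensor_space H L) (tensor_space H H) (\<lambda>h s. tens H H h (?\<sigma> s))"
    by (intro kbilinearI kbilinear_left[OF kH] kbilinear_right[OF kH] klinear_ident \<sigma> klinear_closed[OF \<sigma>])
  \<comment> \<open>The contraction on H \<otimes> (H \<otimes> L) that keeps the two legs in
    \<open>H\<close> and applies \<open>coord g\<close> to the leg in \<open>L\<close>.\<close>
  let ?\<Phi> = "\<lambda>t. sweedler H (tensor_space H L) t (\<lambda>h s. tens H H h (?\<sigma> s))"
  note \<Phi> = klinear_sweedler[OF VH VT vect_space_tensor b]
  let ?q = "\<lambda>i. sweedler H H (comul H (v i)) (\<lambda>h1 h2. tens H (tensor_space H L) h1 (tens H L h2 (w i)))"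
  have cv: "comul H (v i) \<in> carr (tensor_space H H)" if "i \<in> I" for i
    using klinear_closed[OF comul_lin v[OF that]] .
  have step: "?\<Phi> (?q i) = tscale (coord g (w i)) (comul H (v i))" if i: "i \<in> I" for i
  proof -
    have bl: "kbilinear H H (tensor_space H H) (\<lambda>h1 h2. tens H H h1 (scl H (coord g (w i)) h2))"
      by (intro kbilinearI kbilinear_left[OF kH] kbilinear_right[OF kH] klinear_ident
          klinear_scale_const[OF VH] H.carr_scale)
    have eq: "tens H H h1 (scl H (coord g (w i)) h2) = ?\<Phi> (tens H (tensor_space H L) h1 (tens H L h2 (w i)))"
      if "h1 \<in> carr H" "h2 \<in> carr H" for h1 h2
      using that by (simp add: sweedler_tens[OF VH VT vect_space_tensor b] tens_closed w[OF i]
          sweedler_tens[OF VH VL VH slice_bilinear])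
    have "?\<Phi> (?q i) = sweedler H H (comul H (v i)) (\<lambda>h1 h2. ?\<Phi> (tens H (tensor_space H L) h1 (tens H L h2 (w i))))"
      by (rule klinear_apply_sweedler[OF VH VH vect_space_tensor vect_space_tensor
            coassoc_bilinear[OF w[OF i]] \<Phi> cv[OF i]])
    also have "\<dots> = sweedler H H (comul H (v i)) (\<lambda>h1 h2. tens H H h1 (scl H (coord g (w i)) h2))"
      by (rule sweedler_cong[OF VH VH vect_space_tensor bl eq cv[OF i], symmetric])
    also have "\<dots> = sweedler H H (comul H (v i)) (\<lambda>h1 h2. tscale (coord g (w i)) (tens H H h1 h2))"
      by (simp add: tens_scale_right)
    also have "\<dots> = tscale (coord g (w i)) (sweedler H H (comul H (v i)) (tens H H))"
      using klinear_apply_sweedler[OF VH VH vect_space_tensor vect_space_tensor kH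
          klinear_scale_const[OF vect_space_tensor klinear_ident] cv[OF i], of "coord g (w i)"] by simp
    finally show ?thesis by (simp add: sweedler_tens_self[OF VH VH cv[OF i]])
  qed
  have "(\<Sum>i\<in>I. tens H H (v i) (T g (w i))) = ?\<Phi> (\<Sum>i\<in>I. tens H (tensor_space H L) (v i) (coact L (w i)))"
    unfolding T_def
    by (rule sweedler_finite_sum[OF VH VT vect_space_tensor b v klinear_closed[OF coact_lin w], symmetric])
  also have "\<dots> = ?\<Phi> (\<Sum>i\<in>I. ?q i)" by (simp only: coassoc_sum[OF l co v w])
  also have "\<dots> = (\<Sum>i\<in>I. ?\<Phi> (?q i))"
    by (rule klinear_sum[OF vect_space_tensor \<Phi>])
      (rule sweedler_closed[OF VH VH vect_space_tensor coassoc_bilinear[OF w] cv])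
  also have "\<dots> = (\<Sum>i\<in>I. comul H (scl H (coord g (w i)) (v i)))"
    using step v by (simp add: klinear_scale[OF comul_lin])
  also have "\<dots> = comul H (T g l)"
    using v by (simp add: T_sum[OF co v w] klinear_sum[OF VH comul_lin] H.carr_scale)
  finally show ?thesis by simp
qed

section \<open>The embedding\<close>

definition coeff where "coeff g l = mul H (T g l) (\<gamma> (inv g))"

lemma \<gamma>_inv_H: "g \<in> F \<Longrightarrow> \<gamma> (inv g) \<in> carr H" and \<gamma>_inv_H0: "g \<in> F \<Longrightarrow> \<gamma> (inv g) \<in> Hn 0"
  by (simp_all add: FG \<gamma>_H \<gamma>_H0)

lemma coeff_lin: "g \<in> F \<Longrightarrow> klinear L H (coeff g)"
  unfolding coeff_def by (rule klinear_mul_left[OF alg T_lin \<gamma>_inv_H])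

lemma coeff_H: "g \<in> F \<Longrightarrow> l \<in> carr L \<Longrightarrow> coeff g l \<in> carr H"
  by (rule klinear_closed[OF coeff_lin])

lemma T_coeff: "g \<in> F \<Longrightarrow> l \<in> carr L \<Longrightarrow> mul H (coeff g l) (\<gamma> g) = T g l"
  by (simp add: coeff_def \<gamma>_cancel FG T_H)

lemma coeff_zero: "g \<in> F \<Longrightarrow> T g l = 0 \<Longrightarrow> coeff g l = 0"
  by (simp add: coeff_def mul_zero_left[OF alg] \<gamma>_inv_H)

lemma coeff_degree: "g \<in> F \<Longrightarrow> l \<in> Ln n \<Longrightarrow> coeff g l \<in> Hn n"
  unfolding coeff_def by (intro mul_H0_right T_degree \<gamma>_inv_H0)

text \<open>\<open>\<gamma> (inv g)\<close> is group-like, so multiplying \<open>comul_T\<close> by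
  it on the right turns the right legs into values of \<open>coeff g\<close> again.\<close>

lemma comul_coeff:
  assumes g: "g \<in> F" and l: "l \<in> carr L" and co: "coact L l = (\<Sum>i\<in>I. tens H L (v i) (w i))"
    and v: "\<And>i. i \<in> I \<Longrightarrow> v i \<in> carr H" and w: "\<And>i. i \<in> I \<Longrightarrow> w i \<in> carr L"
  shows "comul H (coeff g l) = (\<Sum>i\<in>I. tens H H (mul H (v i) (\<gamma> (inv g))) (coeff g (w i)))"
proof -
  have "comul H (coeff g l) = mul (tensor_alg H H) (comul H (T g l)) (comul H (\<gamma> (inv g)))"
    unfolding coeff_def
    by (rule alg_hom_mul[OF hopf_algebra.comul_alg_hom[OF hopf] T_H[OF l] \<gamma>_inv_H[OF g]])
  also have "\<dots> = (\<Sum>i\<in>I. tens H H (mul H (v i) (\<gamma> (inv g))) (coeff g (w i)))"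
    using tensor_alg_mul_tens[OF alg alg, of I v "\<lambda>i. T g (w i)" "{()}" "\<lambda>_. \<gamma> (inv g)" "\<lambda>_. \<gamma> (inv g)"]
    by (simp add: comul_T[OF l co v w] comul_\<gamma> FG[OF g] v T_H[OF w] \<gamma>_inv_H[OF g] coeff_def)
  finally show ?thesis .
qed

lemma coeff_comp:
  assumes g: "g \<in> F" and l: "l \<in> carr L"
  shows "component Hn 0 (coeff g l) = scl H (coord g l) (unity H)"
proof -
  have hm: "klinear H H (\<lambda>x. mul H x (\<gamma> (inv g)))"
    by (rule klinear_mul_left[OF alg klinear_ident \<gamma>_inv_H[OF g]])
  have "component Hn 0 (coeff g l) = mul H (scl H (coord g l) (\<gamma> g)) (\<gamma> (inv g))"
    by (simp add: coeff_def component_zero_mul[OF gralg T_H[OF l] \<gamma>_inv_H[OF g]] T_comp[OF l g]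
        comp_H0[OF \<gamma>_inv_H0[OF g]])
  then show ?thesis
    by (simp add: klinear_scale[OF hm] \<gamma>_H \<gamma>_mult \<gamma>_one FG[OF g])
qed

text \<open>Projecting the right legs of \<open>comul_coeff\<close> to degree zero leaves the
  scalars \<open>coord g (w v)\<close> times 1, by \<open>coeff_comp\<close>. Moved to the left
  legs, they reassemble \<open>coeff g l\<close>.\<close>

lemma coeff_coinv:
  assumes g: "g \<in> F" and l: "l \<in> carr L"
  shows "coeff g l \<in> carr R"
proof -
  interpret H: vect_space H by (rule VH)
  obtain B w where B: "finite B" "\<And>v. v \<in> B \<Longrightarrow> v \<in> carr H" "\<And>v. w v \<in> carr L"
      "coact L l = (\<Sum>v\<in>B. tens H L v (w v))"
    using coact_repr[OF l] by metis
  let ?\<gamma> = "\<gamma> (inv g)"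
  have vH: "mul H v ?\<gamma> \<in> carr H" if "v \<in> B" for v by (intro H_mul B(2) that \<gamma>_inv_H g)
  have hm: "klinear H H (\<lambda>x. mul H x ?\<gamma>)"
    by (rule klinear_mul_left[OF alg klinear_ident \<gamma>_inv_H[OF g]])
  have comul: "comul H (coeff g l) = (\<Sum>v\<in>B. tens H H (mul H v ?\<gamma>) (coeff g (w v)))"
    by (rule comul_coeff[OF g l B(4) B(2,3)])
  have "coinv_map (coeff g l) = (\<Sum>v\<in>B. tens H H (mul H v ?\<gamma>) (component Hn 0 (coeff g (w v))))"
    unfolding coinv_map_def comul
    by (rule sweedler_finite_sum[OF VH VH vect_space_tensor coinv_bilinear vH coeff_H[OF g B(3)]])
  also have "\<dots> = tens H H (\<Sum>v\<in>B. scl H (coord g (w v)) (mul H v ?\<gamma>)) (unity H)"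
    by (simp add: coeff_comp[OF g B(3)] tens_sum_left tens_scale_left tens_scale_right)
  also have "(\<Sum>v\<in>B. scl H (coord g (w v)) (mul H v ?\<gamma>)) = coeff g l"
    by (simp add: coeff_def T_sum[OF B(4) B(2,3)] klinear_sum[OF VH hm] klinear_scale[OF hm] H.carr_scale B(2))
  finally show ?thesis by (simp add: Hcoinv_iff coeff_H g l)
qed

section \<open>The embedding and its compatibility with product and coaction\<close>

abbreviation unit where "unit g \<equiv> Poly_Mapping.single g (1::'k)"

text \<open>The sum runs over the support of \<open>T\<close>, finite for \<open>l\<close> in L,
  since \<open>F\<close> may be infinite; \<open>embed_superset\<close> frees it from that
  particular index set.\<close>

definition embed where "embed l = (\<Sum>g | T g l \<noteq> 0. tens H E (coeff g l) (unit g))"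

lemma embed_superset:
  assumes "finite A" "{g. T g l \<noteq> 0} \<subseteq> A" "A \<subseteq> F"
  shows "embed l = (\<Sum>g\<in>A. tens H E (coeff g l) (unit g))"
  unfolding embed_def using assms
  by (intro sum.mono_neutral_left) (auto simp: coeff_zero tens_zero_left subset_iff)

lemma T_support: "l \<in> carr L \<Longrightarrow> {g. T g l \<noteq> 0} \<subseteq> F"
  using T_outside by blast

lemma unit_tens_M: "g \<in> F \<Longrightarrow> l \<in> carr L \<Longrightarrow> tens H E (coeff g l) (unit g) \<in> carr (tensor_space R E)"
  using tens_closed[OF coeff_coinv single_E, of g l g 1] by simp

lemma embed_M: "l \<in> carr L \<Longrightarrow> embed l \<in> carr (tensor_space R E)"
  unfolding embed_def using T_support by (intro vect_space.carr_sum[OF vect_space_tensor] unit_tens_M) auto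

lemma VM: "vect_space M"
  using vect_space_tensor[of R E] by (simp add: vect_space_def vect_space_axioms_def)

lemma embed_lin: "klinear L M embed"
proof (rule klinearI)
  interpret L: vect_space L by (rule VL)
  interpret H: vect_space H by (rule VH)
  interpret TS: vector_space "tscale :: 'k \<Rightarrow> ('h, 'g \<Rightarrow>\<^sub>0 'k, 'k) tensor \<Rightarrow> _" by (rule vector_space_tscale)
  fix x y c assume x: "x \<in> carr L"
  show "embed x \<in> carr M" using embed_M[OF x] by simp
  have "embed (scl L c x) = (\<Sum>g | T g x \<noteq> 0. tens H E (coeff g (scl L c x)) (unit g))"
    using T_support[OF x] T_finite[OF x] klinear_scale[OF T_lin x]
    by (intro embed_superset) auto
  also have "\<dots> = tscale c (embed x)"
    unfolding embed_def TS.scale_sum_right using T_support[OF x]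
    by (intro sum.cong) (auto simp: klinear_scale[OF coeff_lin] x tens_scale_left)
  finally show "embed (scl L c x) = scl M c (embed x)" by simp
  assume y: "y \<in> carr L"
  let ?A = "{g. T g x \<noteq> 0} \<union> {g. T g y \<noteq> 0}"
  have A: "finite ?A" "?A \<subseteq> F" using T_finite T_support x y by auto
  have "embed (x + y) = (\<Sum>g\<in>?A. tens H E (coeff g (x + y)) (unit g))"
    using A klinear_add[OF T_lin x y] by (intro embed_superset) auto
  also have "\<dots> = (\<Sum>g\<in>?A. tens H E (coeff g x) (unit g)) + (\<Sum>g\<in>?A. tens H E (coeff g y) (unit g))"
    unfolding sum.distrib[symmetric] using A(2)
    by (intro sum.cong) (auto simp: klinear_add[OF coeff_lin] x y tens_add_left)
  also have "\<dots> = embed x + embed y"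
    using embed_superset[OF A(1) _ A(2)] by simp
  finally show "embed (x + y) = embed x + embed y" .
qed

lemma embed_one: "embed (unity L) = unity M"
proof -
  have "{g. T g (unity L) \<noteq> 0} \<subseteq> {\<one>}" by (auto simp: T_one split: if_splits)
  then show ?thesis
    using embed_superset[of "{\<one>}" "unity L"] F_one by (simp add: T_one coeff_def \<gamma>_one unity_H)
qed

text \<open>In a product of two summands the factor \<open>\<gamma> g\<close> from the smash product
  turns \<open>coeff g l\<close> back into \<open>T g l\<close>, and the trailing
  \<open>\<gamma> (inv g)\<close> merges with that of \<open>coeff h m\<close> into
  \<open>\<gamma> (inv (g \<otimes> h))\<close>. What remains is the expansion of
  \<open>T_mul\<close>, regrouped by the product of the indices.\<close>

lemma embed_mul:
  assumes l: "l \<in> carr L" and m: "m \<in> carr L"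
  shows "embed (mul L l m) = mul M (embed l) (embed m)"
proof -
  interpret H: vect_space H by (rule VH)
  obtain A B where A: "finite A" "A \<subseteq> F" "{g. T g l \<noteq> 0} \<subseteq> A" and B: "finite B" "B \<subseteq> F" "{g. T g m \<noteq> 0} \<subseteq> B"
    and T: "\<forall>k. T k (mul L l m) = (\<Sum>g\<in>A. \<Sum>h\<in>B. if g \<otimes> h = k then scl H (\<psi> g h) (mul H (T g l) (T h m)) else 0)"
    using T_mul[OF l m] by (elim exE conjE)
  have AF: "g \<in> A \<Longrightarrow> g \<in> F" and BF: "g \<in> B \<Longrightarrow> g \<in> F" for g using A(2) B(2) by auto
  let ?p = "\<lambda>g h. mul H (T g l) (T h m)"
  have p: "?p g h \<in> carr H" for g h by (intro H_mul T_H l m)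
  \<comment> \<open>Different pairs may have the same product, so the target degrees are collected
    in one finite set over which the sum can be exchanged.\<close>
  define C where "C = (\<lambda>(g, h). g \<otimes> h) ` (A \<times> B)"
  have C: "finite C" "C \<subseteq> F" "g \<in> A \<Longrightarrow> h \<in> B \<Longrightarrow> g \<otimes> h \<in> C" for g h
    using A(1) B(1) AF BF F_m by (auto simp: C_def)
  have "{k. T k (mul L l m) \<noteq> 0} \<subseteq> C"
  proof (rule subsetI, rule ccontr)
    fix k assume k: "k \<in> {k. T k (mul L l m) \<noteq> 0}" "k \<notin> C"
    have "g \<otimes> h \<noteq> k" if "g \<in> A" "h \<in> B" for g h using C(3)[OF that] k(2) by blast
    then have "T k (mul L l m) = 0" unfolding T[rule_format] by (intro sum.neutral ballI) simp
    then show False using k(1) by simp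
  qed
  then have "embed (mul L l m) = (\<Sum>k\<in>C. tens H E (coeff k (mul L l m)) (unit k))"
    by (intro embed_superset C)
  also have "\<dots> = (\<Sum>k\<in>C. \<Sum>g\<in>A. \<Sum>h\<in>B. if g \<otimes> h = k
      then tens H E (mul H (scl H (\<psi> g h) (?p g h)) (\<gamma> (inv k))) (unit k) else 0)"
  proof (intro sum.cong refl)
    fix k assume "k \<in> C"
    then have "k \<in> F" using C(2) by blast
    then have lin: "klinear H (tensor_space H E) (\<lambda>x. tens H E (mul H x (\<gamma> (inv k))) (unit k))"
      by (intro kbilinear_left[OF kbilinear_tens[OF VH VE]] klinear_mul_left[OF alg] klinear_ident \<gamma>_inv_H single_E)
    define z where "z g h = (if g \<otimes> h = k then scl H (\<psi> g h) (?p g h) else 0)" for g h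
    have zH: "z g h \<in> carr H" for g h using p by (simp add: z_def H.carr_scale H.carr_zero)
    have "tens H E (coeff k (mul L l m)) (unit k) = (\<Sum>g\<in>A. \<Sum>h\<in>B. tens H E (mul H (z g h) (\<gamma> (inv k))) (unit k))"
      unfolding coeff_def T[rule_format] z_def[symmetric]
      by (simp add: klinear_sum[OF VH lin] H.carr_sum zH)
    also have "\<dots> = (\<Sum>g\<in>A. \<Sum>h\<in>B. if g \<otimes> h = k
      then tens H E (mul H (scl H (\<psi> g h) (?p g h)) (\<gamma> (inv k))) (unit k) else 0)"
      by (intro sum.cong refl) (simp add: z_def klinear_zero[OF VH lin])
    finally show "tens H E (coeff k (mul L l m)) (unit k) = (\<Sum>g\<in>A. \<Sum>h\<in>B. if g \<otimes> h = k
      then tens H E (mul H (scl H (\<psi> g h) (?p g h)) (\<gamma> (inv k))) (unit k) else 0)" .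
  qed
  also have "\<dots> = (\<Sum>g\<in>A. \<Sum>h\<in>B. \<Sum>k\<in>C. if g \<otimes> h = k
      then tens H E (mul H (scl H (\<psi> g h) (?p g h)) (\<gamma> (inv k))) (unit k) else 0)"
    by (subst sum.swap[of _ A C], subst sum.swap[of _ B C]) (rule refl)
  also have "\<dots> = (\<Sum>g\<in>A. \<Sum>h\<in>B. tens H E (mul H (scl H (\<psi> g h) (?p g h)) (\<gamma> (inv (g \<otimes> h)))) (unit (g \<otimes> h)))"
    using C(1,3) by (intro sum.cong refl) simp
  also have "\<dots> = (\<Sum>g\<in>A. \<Sum>h\<in>B. mul M (tens H E (coeff g l) (unit g)) (tens H E (coeff h m) (unit h)))"
  proof (intro sum.cong refl)
    fix g h assume gh: "g \<in> A" "h \<in> B"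
    note g = AF[OF gh(1)] and h = BF[OF gh(2)]
    let ?\<gamma> = "\<gamma> (inv (g \<otimes> h))"
    have \<gamma>: "?\<gamma> \<in> carr H" using \<gamma>_inv_H[OF F_m[OF g h]] .
    have lin: "klinear H H (\<lambda>x. mul H x ?\<gamma>)" by (rule klinear_mul_left[OF alg klinear_ident \<gamma>])
    \<comment> \<open>The cancellation that dictates the factor \<open>\<gamma> (inv g)\<close> in
      \<open>coeff\<close>: both inverses end up on the right, in the order of the inverse of a
      product.\<close>
    have "mul H (mul H (T g l) (coeff h m)) (\<gamma> (inv g)) = mul H (?p g h) ?\<gamma>"
      using FG[OF g] FG[OF h] T_H[OF l] T_H[OF m] by (simp add: coeff_def H_assoc H_mul \<gamma>_H \<gamma>_mult inv_mult_group)
    then have "mul M (tens H E (coeff g l) (unit g)) (tens H E (coeff h m) (unit h)) =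
        tens H E (mul H (?p g h) ?\<gamma>) (Poly_Mapping.single (g \<otimes> h) (\<psi> g h))"
      using M_mul_tens[OF coeff_coinv[OF g l] coeff_coinv[OF h m] g h] by (simp add: T_coeff[OF g l])
    also have "Poly_Mapping.single (g \<otimes> h) (\<psi> g h) = scl E (\<psi> g h) (unit (g \<otimes> h))"
      by (simp add: pm_scale_single)
    finally show "tens H E (mul H (scl H (\<psi> g h) (?p g h)) ?\<gamma>) (unit (g \<otimes> h)) =
        mul M (tens H E (coeff g l) (unit g)) (tens H E (coeff h m) (unit h))"
      by (simp only: tens_scale_right klinear_scale[OF lin p] tens_scale_left)
  qed
  also have "\<dots> = mul M (embed l) (embed m)"
    unfolding embed_superset[OF A(1,3,2)] embed_superset[OF B(1,3,2)]
    by (rule kbilinear_sum_sum[OF vect_space_tensor vect_space_tensor M_mul_bilinear, symmetric])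
      (intro unit_tens_M AF BF l m; assumption)+
  finally show ?thesis .
qed

lemma embed_coact_bilinear: "kbilinear H L (tensor_space H M) (\<lambda>h l0. tens H M h (embed l0))"
  by (intro kbilinearI kbilinear_left[OF kbilinear_tens[OF VH VM]] kbilinear_right[OF kbilinear_tens[OF VH VM]]
      klinear_ident embed_lin klinear_closed[OF embed_lin])

lemma tens_M: "tens H M = tens H (tensor_space H E)"
  by (rule tens_cong) simp_all

text \<open>The coaction of the smash product multiplies the left leg v
  \<open>\<gamma> (inv g)\<close> by \<open>\<gamma> g\<close>, which restores v. The form with
  finite sums also shows that the image of \<open>embed\<close> is a subcomodule.\<close>

lemma embed_coact_sum:
  assumes l: "l \<in> carr L" and B: "finite B" "\<And>v. v \<in> B \<Longrightarrow> v \<in> carr H" "\<And>v. w v \<in> carr L"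
    and co: "coact L l = (\<Sum>v\<in>B. tens H L v (w v))"
  shows "coact M (embed l) = (\<Sum>v\<in>B. tens H M v (embed (w v)))"
proof -
  define A where "A = {g. T g l \<noteq> 0} \<union> (\<Union>v\<in>B. {g. T g (w v) \<noteq> 0})"
  have A: "finite A" "A \<subseteq> F" "{g. T g l \<noteq> 0} \<subseteq> A" "\<And>v. v \<in> B \<Longrightarrow> {g. T g (w v) \<noteq> 0} \<subseteq> A"
    using B(1) T_finite[OF l] T_finite[OF B(3)] T_support[OF l] T_support[OF B(3)] unfolding A_def by blast+
  have AF: "g \<in> A \<Longrightarrow> g \<in> F" for g using A(2) by blast
  have "coact M (embed l) = (\<Sum>g\<in>A. coact M (tens H E (coeff g l) (unit g)))"
    unfolding embed_superset[OF A(1,3,2)]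
    by (rule klinear_sum[OF vect_space_tensor M_coact_lin]) (intro unit_tens_M AF l)
  also have "\<dots> = (\<Sum>g\<in>A. \<Sum>v\<in>B. tens H M v (tens H E (coeff g (w v)) (unit g)))"
  proof (intro sum.cong refl)
    fix g assume "g \<in> A"
    note g = AF[OF this]
    have \<gamma>: "\<gamma> g \<in> carr H0" using \<gamma>_H0[OF FG[OF g]] by simp
    have b: "kbilinear H H (tensor_space H (tensor_space H E)) (coact_term (unit g) (\<gamma> g))"
      by (intro kbilinearI coact_term_lin \<gamma> single_E g)
    have "coact M (tens H E (coeff g l) (unit g)) = (\<Sum>v\<in>B. coact_term (unit g) (\<gamma> g) (mul H v (\<gamma> (inv g))) (coeff g (w v)))"
      by (simp only: M_coact_tens[OF coeff_coinv[OF g l] g] comul_coeff[OF g l co B(2,3)])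
        (rule sweedler_finite_sum[OF VH VH vect_space_tensor b], (intro H_mul B \<gamma>_inv_H coeff_H g; assumption)+)
    also have "\<dots> = (\<Sum>v\<in>B. tens H M v (tens H E (coeff g (w v)) (unit g)))"
      using FG[OF g] B(2) by (intro sum.cong refl) (simp add: \<gamma>_cancel tens_M)
    finally show "coact M (tens H E (coeff g l) (unit g)) = (\<Sum>v\<in>B. tens H M v (tens H E (coeff g (w v)) (unit g)))" .
  qed
  also have "\<dots> = (\<Sum>v\<in>B. \<Sum>g\<in>A. tens H M v (tens H E (coeff g (w v)) (unit g)))"
    by (rule sum.swap)
  also have "\<dots> = (\<Sum>v\<in>B. tens H M v (embed (w v)))"
    using embed_superset[OF A(1,4,2)] by (intro sum.cong refl) (simp add: tens_sum_right)
  finally show ?thesis .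
qed

lemma embed_coact:
  assumes l: "l \<in> carr L"
  shows "coact M (embed l) = sweedler H L (coact L l) (\<lambda>h l0. tens H M h (embed l0))"
proof -
  obtain B w where B: "finite B" "\<And>v. v \<in> B \<Longrightarrow> v \<in> carr H" "\<And>v. w v \<in> carr L"
      "coact L l = (\<Sum>v\<in>B. tens H L v (w v))"
    using coact_repr[OF l] by metis
  have "coact M (embed l) = (\<Sum>v\<in>B. tens H M v (embed (w v)))" by (rule embed_coact_sum[OF l B])
  also have "\<dots> = sweedler H L (\<Sum>v\<in>B. tens H L v (w v)) (\<lambda>h l0. tens H M h (embed l0))"
    by (rule sweedler_finite_sum[OF VH VL vect_space_tensor embed_coact_bilinear B(2,3), symmetric])
  finally show ?thesis by (simp only: B(4))
qed

section \<open>Vanishing of the common kernel of the maps T g\<close>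

lemma unity_H_nonzero: "unity H \<noteq> 0"
proof
  assume "unity H = 0"
  moreover have "klinear H field_alg (counit H)"
    using hopf_algebra.counit_alg_hom[OF hopf] by (rule alg_hom_klinear)
  ultimately show False
    using counit_\<gamma>[OF one_closed] klinear_zero[OF VH] by (fastforce simp: \<gamma>_one)
qed

text \<open>The common kernel is a right ideal because by \<open>T_mul\<close> every
  \<open>T k (mul L a b)\<close> is a combination of products with left factor \<open>T g a\<close>.
  It is a subcomodule by \<open>comul_T\<close>. Since \<open>T \<one>\<close> sends 1 to 1,
  simplicity leaves only the zero ideal.\<close>

lemma T_eq_zero:
  assumes x: "x \<in> carr L" "\<And>g. T g x = 0"
  shows "x = 0"
proof -
  interpret L: vect_space L by (rule VL)
  interpret H: vect_space H by (rule VH)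
  define I where "I = {x \<in> carr L. \<forall>g. T g x = 0}"
  have IL: "I \<subseteq> carr L" by (auto simp: I_def)
  have sub: "L.subspace I"
    unfolding L.subspace_def I_def
    using klinear_zero[OF VL T_lin] klinear_add[OF T_lin] klinear_scale[OF T_lin]
    by (auto simp: L.carr_zero L.carr_add L.carr_scale)
  have "mul L a b \<in> I" if aI: "a \<in> I" and b: "b \<in> carr L" for a b
  proof -
    have a: "a \<in> carr L" "T g a = 0" for g using aI by (auto simp: I_def)
    obtain A B where T: "\<forall>k. T k (mul L a b) = (\<Sum>g\<in>A. \<Sum>h\<in>B. if g \<otimes> h = k then scl H (\<psi> g h) (mul H (T g a) (T h b)) else 0)"
      using T_mul[OF a(1) b] by (elim exE conjE)
    have "T k (mul L a b) = 0" for k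
      unfolding T[rule_format] a(2) using mul_zero_left[OF alg T_H[OF b]] by (intro sum.neutral ballI) simp
    then show ?thesis using L_mul[OF a(1) b] by (simp add: I_def)
  qed
  then have ri: "right_ideal L I" using sub IL by (simp add: right_ideal_def)
  have "coact L a \<in> carr (tensor_space H (L\<lparr>carr := I\<rparr>))" if "a \<in> I" for a
  proof -
    have a: "a \<in> carr L" "T g a = 0" for g using that by (auto simp: I_def)
    obtain B w where B: "finite B" "B \<subseteq> carr H" "\<not> module.dependent (scl H) B" "\<And>v. w v \<in> carr L"
      "coact L a = (\<Sum>v\<in>B. tens H L v (w v))"
      using tensor_space_basis_repr[OF VH VL klinear_closed[OF coact_lin a(1)]] by metis
    have BH: "v \<in> B \<Longrightarrow> v \<in> carr H" for v using B(2) by blast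
    \<comment> \<open>For \<open>a\<close> in the kernel the coproduct of \<open>T g a\<close> = 0
      is the sum of the v \<otimes> \<open>T g (w v)\<close>; as the left legs are independent,
      every right leg is killed.\<close>
    have "T g (w v) = 0" if v: "v \<in> B" for g v
    proof (rule tens_independent_zero[OF VH VH B(1-3) T_H[OF B(4)] _ v])
      show "(\<Sum>v\<in>B. tens H H v (T g (w v))) = 0"
        using comul_T[OF a(1) B(5) BH B(4), of g] by (simp add: a(2) klinear_zero[OF VH comul_lin])
    qed
    then have "w v \<in> I" if "v \<in> B" for v using that B(4) by (simp add: I_def)
    moreover have "tens H L = tens H (L\<lparr>carr := I\<rparr>)" by (rule tens_cong) simp_all
    ultimately show ?thesis
      unfolding B(5) using tens_closed[of _ H _ "L\<lparr>carr := I\<rparr>"] BH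
      by (auto intro!: vect_space.carr_sum[OF vect_space_tensor])
  qed
  then have "subcomodule H L I" using sub IL by (simp add: subcomodule_def)
  then have "I = {0} \<or> I = carr L" using simple ri by (simp add: right_simple_def)
  moreover have "T \<one> (unity L) \<noteq> 0" using unity_H_nonzero by (simp add: T_one)
  then have "unity L \<notin> I" unfolding I_def by blast
  ultimately show ?thesis using x unity_L by (auto simp: I_def)
qed

lemma coeff_eq_zero:
  assumes x: "x \<in> carr L" "\<And>g. g \<in> F \<Longrightarrow> coeff g x = 0"
  shows "x = 0"
proof (rule T_eq_zero[OF x(1)])
  show "T g x = 0" for g
    using T_coeff[of g x] x T_outside[OF x(1)] mul_zero_left[OF alg \<gamma>_H[OF FG]] by (cases "g \<in> F") auto
qed

text \<open>Reads off the coefficient of \<open>g\<close> in the second leg; through it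
  \<open>embed\<close> is tested one coordinate \<open>coeff g\<close> at a time, both for
  injectivity and for degrees.\<close>

definition slice where "slice g t = sweedler H E t (\<lambda>h e. scl H (Poly_Mapping.lookup e g) h)"

lemmas lookup_bilinear = kbilinear_slice_right[OF VH klinear_lookup[OF E]]

lemma slice_lin: "klinear (tensor_space H E) H (slice g)"
  unfolding slice_def by (rule klinear_sweedler[OF VH VE VH lookup_bilinear])

lemma slice_tens: "h \<in> carr H \<Longrightarrow> e \<in> carr E \<Longrightarrow> slice g (tens H E h e) = scl H (Poly_Mapping.lookup e g) h"
  unfolding slice_def by (rule sweedler_tens[OF VH VE VH lookup_bilinear])

lemma slice_embed:
  assumes l: "l \<in> carr L" and g: "g \<in> F"
  shows "slice g (embed l) = coeff g l"
proof -
  interpret H: vect_space H by (rule VH)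
  let ?A = "insert g {g. T g l \<noteq> 0}"
  have A: "finite ?A" "?A \<subseteq> F" "{g. T g l \<noteq> 0} \<subseteq> ?A" using T_finite[OF l] T_support[OF l] g by auto
  have AF: "h \<in> ?A \<Longrightarrow> h \<in> F" for h using A(2) by blast
  have "slice g (embed l) = (\<Sum>h\<in>?A. slice g (tens H E (coeff h l) (unit h)))"
    unfolding embed_superset[OF A(1,3,2)]
    by (rule klinear_sum[OF vect_space_tensor slice_lin]) (intro tens_closed coeff_H single_E AF l; assumption)
  also have "\<dots> = (\<Sum>h\<in>?A. if h = g then coeff g l else 0)"
  proof (intro sum.cong refl)
    fix h assume "h \<in> ?A"
    note h = AF[OF this]
    show "slice g (tens H E (coeff h l) (unit h)) = (if h = g then coeff g l else 0)"
      unfolding slice_tens[OF coeff_H[OF h l] single_E[OF h]] by (simp add: lookup_single when_def)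
  qed
  also have "\<dots> = coeff g l" using A(1) by simp
  finally show ?thesis .
qed

section \<open>The grading of the image\<close>

lemma slice_degree:
  assumes "t \<in> smash_grading H Hn E n"
  shows "slice g t \<in> Hn n"
proof -
  interpret H: vect_space H by (rule VH)
  have sub: "H.subspace (Hn n)" using grs by (simp add: graded_space_def)
  let ?R = "H\<lparr>carr := Hn n \<inter> Hcoinv H Hn\<rparr>"
  have "H.subspace (Hcoinv H Hn)" using vect_space.subspace_carr[OF VR] by simp
  then have V: "vect_space ?R" using sub by (intro H.vect_space_subspace H.subspace_inter)
  have t: "t \<in> carr (tensor_space ?R E)" using assms by (simp only: smash_grading_def)
  show ?thesis
  proof (rule tensor_space_basis_repr[OF V VE t])
    fix B w assume B: "B \<subseteq> carr ?R" "\<And>v. w v \<in> carr E" "t = (\<Sum>v\<in>B. tens ?R E v (w v))"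
    have BH: "v \<in> carr H" "v \<in> Hn n" if "v \<in> B" for v using B(1) that by (auto simp: Hcoinv_iff)
    have "tens ?R E = tens H E" by (rule tens_cong) simp_all
    then have "slice g t = (\<Sum>v\<in>B. slice g (tens H E v (w v)))"
      unfolding B(3) using klinear_sum[OF vect_space_tensor slice_lin, of B "\<lambda>v. tens H E v (w v)" g]
        tens_closed[OF BH(1) B(2)] by simp
    also have "\<dots> = (\<Sum>v\<in>B. scl H (Poly_Mapping.lookup (w v) g) v)"
      by (intro sum.cong refl slice_tens BH B(2))
    also have "\<dots> \<in> Hn n"
      using sub BH(2) by (intro H.subspace_sum H.subspace_scale)
    finally show "slice g t \<in> Hn n" .
  qed
qed

lemma embed_degree:
  assumes l: "l \<in> Ln n"
  shows "embed l \<in> smash_grading H Hn E n"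
proof -
  let ?R = "H\<lparr>carr := Hn n \<inter> Hcoinv H Hn\<rparr>"
  have "tens ?R E = tens H E" by (rule tens_cong) simp_all
  moreover have "coeff g l \<in> carr ?R" if "g \<in> F" for g
    using coeff_coinv[OF that L_sub[OF l]] coeff_degree[OF that l] by simp
  ultimately have "tens H E (coeff g l) (unit g) \<in> carr (tensor_space ?R E)" if "g \<in> F" for g
    using that tens_closed[OF _ single_E, of "coeff g l" ?R g 1] by metis
  then show ?thesis
    unfolding embed_def smash_grading_def using T_support[OF L_sub[OF l]]
    by (intro vect_space.carr_sum[OF vect_space_tensor]) auto
qed

text \<open>Needed for the grading of L to correspond exactly to the one induced on the image. Each
  \<open>coeff g\<close> commutes with taking components, and \<open>coeff g l\<close> lies in H(n),
  so it kills the components of \<open>l\<close> in all other degrees; the \<open>coeff g\<close>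
  together separate points.\<close>

lemma embed_degree_converse:
  assumes l: "l \<in> carr L" and deg: "embed l \<in> smash_grading H Hn E n"
  shows "l \<in> Ln n"
proof -
  interpret H: vect_space H by (rule VH)
  let ?c = "\<lambda>m. component Ln m l"
  have c: "?c m \<in> Ln m" "?c m \<in> carr L" for m
    using component_mem[OF grs_L l] L_sub by auto
  have "?c m = 0" if "m \<noteq> n" for m
  proof (rule coeff_eq_zero[OF c(2)])
    fix g assume g: "g \<in> F"
    have lin: "klinear L (H\<lparr>carr := Hn m\<rparr>) (\<lambda>x. component Hn m (coeff g x))"
      by (rule klinear_compose[OF coeff_lin[OF g] klinear_component[OF VH grs]])
    have lin': "klinear L (H\<lparr>carr := Hn m\<rparr>) (\<lambda>x. coeff g (component Ln m x))"
    proof (rule klinear_compose[OF klinear_component[OF VL grs_L]])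
      show "klinear (L\<lparr>carr := Ln m\<rparr>) (H\<lparr>carr := Hn m\<rparr>) (coeff g)"
        using coeff_degree[OF g] klinear_add[OF coeff_lin[OF g]] klinear_scale[OF coeff_lin[OF g]] L_sub
        by (intro klinearI) auto
    qed
    have "coeff g 0 = 0" by (rule klinear_zero[OF VL coeff_lin[OF g]])
    then have "component Hn m (coeff g x) = coeff g (component Ln m x)" if "x \<in> Ln k" for x k
      using coeff_degree[OF g that] that
      by (auto simp: component_homogeneous[OF VL grs_L] component_homogeneous[OF VH grs])
    then have "component Hn m (coeff g l) = coeff g (?c m)"
      by (rule graded_space_ext[OF VL grs_L lin lin' _ l])
    moreover have "coeff g l \<in> Hn n" using slice_degree[OF deg, of g] by (simp add: slice_embed[OF l g])
    ultimately show "coeff g (?c m) = 0" using \<open>m \<noteq> n\<close> by (simp add: component_homogeneous[OF VH grs])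
  qed
  then have "{m. ?c m \<noteq> 0} \<subseteq> {n}" by auto
  from component_sum_eq[OF grs_L l _ this] have "?c n = l" by simp
  then show ?thesis using c(1)[of n] by simp
qed

lemma embed_inj: "inj_on embed (carr L)"
proof (rule inj_onI)
  fix x y assume xy: "x \<in> carr L" "y \<in> carr L" "embed x = embed y"
  interpret L: vect_space L by (rule VL)
  have "x - y = 0"
  proof (rule coeff_eq_zero[OF L.carr_diff[OF xy(1,2)]])
    show "coeff g (x - y) = 0" if "g \<in> F" for g
      using slice_embed[OF xy(1) that] slice_embed[OF xy(2) that] xy by (simp add: klinear_diff[OF VL coeff_lin[OF that]])
  qed
  then show "x = y" by simp
qed

lemma embed_image_degree: "embed ` Ln n = smash_grading H Hn E n \<inter> embed ` carr L"
  using embed_degree embed_degree_converse L_sub by blast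

text \<open>Closure properties are read off from the compatibilities of \<open>embed\<close>. The
  grading is that of L transported along the bijection, and \<open>embed_image_degree\<close>
  identifies it with the induced one.\<close>

lemma image_graded_comodule_subalgebra:
  "graded_comodule_subalgebra H M (smash_grading H Hn E) (embed ` carr L)" (is "graded_comodule_subalgebra H M _ ?S")
proof -
  have sub: "module.subspace (scl M) ?S" by (rule klinear_image_subspace[OF VL VM embed_lin])
  have "coact M (embed l) \<in> carr (tensor_space H (M\<lparr>carr := ?S\<rparr>))" if l: "l \<in> carr L" for l
  proof -
    obtain B w where B: "finite B" "\<And>v. v \<in> B \<Longrightarrow> v \<in> carr H" "\<And>v. w v \<in> carr L"
        "coact L l = (\<Sum>v\<in>B. tens H L v (w v))"
      using coact_repr[OF l] by metis
    have co: "coact M (embed l) = (\<Sum>v\<in>B. tens H M v (embed (w v)))" by (rule embed_coact_sum[OF l B])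
    have "tens H M = tens H (M\<lparr>carr := ?S\<rparr>)" by (rule tens_cong) simp_all
    then show ?thesis
      unfolding co
      using tens_closed[OF B(2), of _ "embed (w _)" "M\<lparr>carr := ?S\<rparr>"] B(3)
      by (intro vect_space.carr_sum[OF vect_space_tensor]) simp
  qed
  then have "subcomodule H M ?S"
    using sub klinear_closed[OF embed_lin] unfolding subcomodule_def by blast
  moreover have "unity M \<in> ?S" using embed_one unity_L by (metis imageI)
  moreover have "mul M x y \<in> ?S" if "x \<in> ?S" "y \<in> ?S" for x y
    using that embed_mul[symmetric] L_mul by auto
  moreover have "graded_space (M\<lparr>carr := ?S\<rparr>) (\<lambda>n. smash_grading H Hn E n \<inter> ?S)"
    unfolding embed_image_degree[symmetric]
  proof (rule graded_space_image[OF VL vect_space.vect_space_subspace[OF VM sub] grs_L])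
    show "klinear L (M\<lparr>carr := ?S\<rparr>) embed" using embed_lin by (simp add: klinear_def)
    show "bij_betw embed (carr L) (carr (M\<lparr>carr := ?S\<rparr>))" using embed_inj by (simp add: bij_betw_def)
  qed
  ultimately show ?thesis unfolding graded_comodule_subalgebra_def by blast
qed

lemma image_graded_comodule_algebra_iso:
  "graded_comodule_algebra_iso H L Ln (M\<lparr>carr := embed ` carr L\<rparr>) (\<lambda>n. smash_grading H Hn E n \<inter> embed ` carr L) embed"
proof -
  let ?M = "M\<lparr>carr := embed ` carr L\<rparr>"
  have "alg_hom L ?M embed"
    using embed_lin embed_one embed_mul by (simp add: alg_hom_def klinear_def)
  moreover have "bij_betw embed (carr L) (carr ?M)" using embed_inj by (simp add: bij_betw_def)
  moreover have "tens H ?M = tens H M" by (rule tens_cong) simp_all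
  ultimately show ?thesis
    unfolding graded_comodule_algebra_iso_def using embed_coact embed_image_degree by simp
qed

end

theorem proposition6p15:
  fixes H :: "('k::field, 'h::ab_group_add) hopf" and Hn :: "nat \<Rightarrow> 'h set"
    and L :: "('k, 'h, 'l::ab_group_add) comod_alg" and Ln :: "nat \<Rightarrow> 'l set"
    and G :: "('g, 'm) monoid_scheme" and \<phi> :: "('g \<Rightarrow>\<^sub>0 'k) \<Rightarrow> 'h"
  assumes "graded_hopf_algebra H Hn"
    and "group G"
    and "hopf_iso (group_hopf G) (degree_zero H Hn) \<phi>"
    and "graded_comodule_algebra H Hn L Ln"
    and "right_simple H L"
    and "coinvariants (degree_zero H Hn) (degree_zero_comod L Ln) = {scl L c (unity L) | c. True}"
  shows "\<exists>F (\<psi> :: 'g \<Rightarrow> 'g \<Rightarrow> 'k) S f.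
    subgroup F G \<and> two_cocycle G F \<psi> \<and>
    (let E = push_coact (group_hopf G) (degree_zero H Hn) \<phi> (twisted_group_algebra G F \<psi>);
         M = smash H Hn E; Mn = smash_grading H Hn E
     in graded_comodule_subalgebra H M Mn S \<and>
        graded_comodule_algebra_iso H L Ln (M\<lparr>carr := S\<rparr>) (\<lambda>n. Mn n \<inter> S) f)"
proof -
  interpret simple_comod G H Hn \<phi> L Ln
    by (intro simple_comod.intro graded_hopf_group.intro graded_hopf_group_axioms.intro
        simple_comod_axioms.intro assms)
  show ?thesis
    unfolding Let_def
    using subgroup_support two_cocycle_\<psi> image_graded_comodule_subalgebra image_graded_comodule_algebra_iso
    by blast
qed

end
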